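(* A left or right Noetherian Hopf algebra $H$ over a field $\Bbbk$ is affine provided that its coradical $H_{(0)}$ is a subalgebra of $H$; that is, provided that $H$ satisfies the dual Chevalley property.
   Context: A $\Bbbk$-algebra is called affine if it is finitely generated as a $\Bbbk$-algebra. The coradical $H_{(0)}$ of a Hopf algebra $H$ is the sum of all simple subcoalgebras of $H$. The field $\Bbbk$ is arbitrary. *)

theory Defs
  imports Complex_Main "HOL-Library.Poly_Mapping"
begin

section \<open>Tensor products over a field\<close>

text \<open>A value of type \<open>'i \<Rightarrow>\<^sub>0 'k\<close> is a formal \<open>'k\<close>-linear combination of elements of \<open>'i\<close>.\<close>

abbreviation fscale :: "'k::field \<Rightarrow> ('i \<Rightarrow>\<^sub>0 'k) \<Rightarrow> ('i \<Rightarrow>\<^sub>0 'k)"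
  where "fscale c \<equiv> Poly_Mapping.map ((*) c)"

lemma lookup_fscale [simp]: "Poly_Mapping.lookup (fscale c t) i = c * Poly_Mapping.lookup t i"
  by (simp add: Poly_Mapping.map.rep_eq when_def)

interpretation formal: vector_space "fscale :: 'k::field \<Rightarrow> ('i \<Rightarrow>\<^sub>0 'k) \<Rightarrow> ('i \<Rightarrow>\<^sub>0 'k)"
  by unfold_locales (auto intro!: poly_mapping_eqI simp: lookup_add algebra_simps)

definition lin_ext :: "('k::field \<Rightarrow> 'v::ab_group_add \<Rightarrow> 'v) \<Rightarrow> ('i \<Rightarrow> 'v) \<Rightarrow> ('i \<Rightarrow>\<^sub>0 'k) \<Rightarrow> 'v"
  where "lin_ext scale f t = (\<Sum>i\<in>Poly_Mapping.keys t. scale (Poly_Mapping.lookup t i) (f i))"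

abbreviation pure_tensor :: "'i \<Rightarrow> ('i \<Rightarrow>\<^sub>0 'k::field)"
  where "pure_tensor i \<equiv> Poly_Mapping.single i 1"

inductive_set bilinear_relators ::
    "('k::field \<Rightarrow> 'a::ab_group_add \<Rightarrow> 'a) \<Rightarrow> ('a \<times> 'a \<Rightarrow>\<^sub>0 'k) set"
  for scale :: "'k::field \<Rightarrow> 'a::ab_group_add \<Rightarrow> 'a" where
  "pure_tensor (x + y, z) - pure_tensor (x, z) - pure_tensor (y, z) \<in> bilinear_relators scale"
| "pure_tensor (z, x + y) - pure_tensor (z, x) - pure_tensor (z, y) \<in> bilinear_relators scale"
| "pure_tensor (scale c x, z) - fscale c (pure_tensor (x, z)) \<in> bilinear_relators scale"
| "pure_tensor (z, scale c x) - fscale c (pure_tensor (z, x)) \<in> bilinear_relators scale"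

inductive_set trilinear_relators ::
    "('k::field \<Rightarrow> 'a::ab_group_add \<Rightarrow> 'a) \<Rightarrow> ('a \<times> 'a \<times> 'a \<Rightarrow>\<^sub>0 'k) set"
  for scale :: "'k::field \<Rightarrow> 'a::ab_group_add \<Rightarrow> 'a" where
  "pure_tensor (x + y, z, w) - pure_tensor (x, z, w) - pure_tensor (y, z, w) \<in> trilinear_relators scale"
| "pure_tensor (z, x + y, w) - pure_tensor (z, x, w) - pure_tensor (z, y, w) \<in> trilinear_relators scale"
| "pure_tensor (z, w, x + y) - pure_tensor (z, w, x) - pure_tensor (z, w, y) \<in> trilinear_relators scale"
| "pure_tensor (scale c x, z, w) - fscale c (pure_tensor (x, z, w)) \<in> trilinear_relators scale"
| "pure_tensor (z, scale c x, w) - fscale c (pure_tensor (z, x, w)) \<in> trilinear_relators scale"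
| "pure_tensor (z, w, scale c x) - fscale c (pure_tensor (z, w, x)) \<in> trilinear_relators scale"

text \<open>The elements of the tensor square \<open>V \<otimes> V\<close> and of the tensor cube \<open>V \<otimes> V \<otimes> V\<close> of the
  vector space \<open>V\<close> given by \<open>scale\<close> are the classes of formal combinations of pairs and triples
  modulo the spans of these relators.\<close>

definition tensor_class2 ::
    "('k::field \<Rightarrow> 'a::ab_group_add \<Rightarrow> 'a) \<Rightarrow> ('a \<times> 'a \<Rightarrow>\<^sub>0 'k) \<Rightarrow> ('a \<times> 'a \<Rightarrow>\<^sub>0 'k) set"
  where "tensor_class2 scale t = {u. u - t \<in> formal.span (bilinear_relators scale)}"

definition tensor_class3 ::
    "('k::field \<Rightarrow> 'a::ab_group_add \<Rightarrow> 'a) \<Rightarrow> ('a \<times> 'a \<times> 'a \<Rightarrow>\<^sub>0 'k) \<Rightarrow>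
      ('a \<times> 'a \<times> 'a \<Rightarrow>\<^sub>0 'k) set"
  where "tensor_class3 scale t = {u. u - t \<in> formal.span (trilinear_relators scale)}"


section \<open>Algebras\<close>

locale k_algebra = vector_space scale
  for scale :: "'k::field \<Rightarrow> 'a::ring_1 \<Rightarrow> 'a" +
  assumes scale_mult_left: "scale c x * y = scale c (x * y)"
    and scale_mult_right: "x * scale c y = scale c (x * y)"
begin

definition subalgebra :: "'a set \<Rightarrow> bool"
  where "subalgebra B \<longleftrightarrow> subspace B \<and> 1 \<in> B \<and> (\<forall>x\<in>B. \<forall>y\<in>B. x * y \<in> B)"

definition affine_algebra :: bool
  where "affine_algebra \<longleftrightarrow> (\<exists>A. finite A \<and> subalgebra hull A = UNIV)"

end

definition left_ideal :: "'a::ring_1 set \<Rightarrow> bool"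
  where "left_ideal I \<longleftrightarrow> 0 \<in> I \<and> (\<forall>x\<in>I. \<forall>y\<in>I. x + y \<in> I) \<and> (\<forall>r. \<forall>x\<in>I. r * x \<in> I)"

definition right_ideal :: "'a::ring_1 set \<Rightarrow> bool"
  where "right_ideal I \<longleftrightarrow> 0 \<in> I \<and> (\<forall>x\<in>I. \<forall>y\<in>I. x + y \<in> I) \<and> (\<forall>r. \<forall>x\<in>I. x * r \<in> I)"

definition left_noetherian :: "'a::ring_1 itself \<Rightarrow> bool"
  where "left_noetherian _ \<longleftrightarrow>
    (\<forall>I :: nat \<Rightarrow> 'a set. (\<forall>n. left_ideal (I n)) \<and> (\<forall>n. I n \<subseteq> I (Suc n)) \<longrightarrow>
      (\<exists>N. \<forall>n\<ge>N. I n = I N))"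

definition right_noetherian :: "'a::ring_1 itself \<Rightarrow> bool"
  where "right_noetherian _ \<longleftrightarrow>
    (\<forall>I :: nat \<Rightarrow> 'a set. (\<forall>n. right_ideal (I n)) \<and> (\<forall>n. I n \<subseteq> I (Suc n)) \<longrightarrow>
      (\<exists>N. \<forall>n\<ge>N. I n = I N))"


section \<open>Coalgebras\<close>

text \<open>The comultiplication takes values in the tensor square, so \<open>t \<in> \<Delta> x\<close> says that the formal
  combination \<open>t\<close> represents the tensor \<open>\<Delta> x\<close>. Operations on tensors are written on
  representatives, and the axioms are required for every choice of representatives. The
  operations involved respect the relators, so this is the same as requiring them for one choice.
  In \<open>coassoc\<close>, \<open>r\<close> chooses a representative of every \<open>\<Delta> a\<close>; the two sides are
  \<open>(\<Delta> \<otimes> id) (\<Delta> x)\<close> and \<open>(id \<otimes> \<Delta>) (\<Delta> x)\<close>.\<close>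

locale coalgebra = vector_space scale
  for scale :: "'k::field \<Rightarrow> 'a::ab_group_add \<Rightarrow> 'a" +
  fixes \<Delta> :: "'a \<Rightarrow> ('a \<times> 'a \<Rightarrow>\<^sub>0 'k) set"
    and \<epsilon> :: "'a \<Rightarrow> 'k"
  assumes comult_tensor: "\<Delta> x \<in> range (tensor_class2 scale)"
    and comult_add: "s \<in> \<Delta> x \<Longrightarrow> t \<in> \<Delta> y \<Longrightarrow> s + t \<in> \<Delta> (x + y)"
    and comult_scale: "t \<in> \<Delta> x \<Longrightarrow> fscale c t \<in> \<Delta> (scale c x)"
    and counit_add: "\<epsilon> (x + y) = \<epsilon> x + \<epsilon> y"
    and counit_scale: "\<epsilon> (scale c x) = c * \<epsilon> x"
    and coassoc: "t \<in> \<Delta> x \<Longrightarrow> (\<And>a. r a \<in> \<Delta> a) \<Longrightarrow>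
      tensor_class3 scale
        (lin_ext fscale (\<lambda>(a, b). lin_ext fscale (\<lambda>(p, q). pure_tensor (p, q, b)) (r a)) t) =
      tensor_class3 scale
        (lin_ext fscale (\<lambda>(a, b). lin_ext fscale (\<lambda>(p, q). pure_tensor (a, p, q)) (r b)) t)"
    and counit_left: "t \<in> \<Delta> x \<Longrightarrow> lin_ext scale (\<lambda>(a, b). scale (\<epsilon> a) b) t = x"
    and counit_right: "t \<in> \<Delta> x \<Longrightarrow> lin_ext scale (\<lambda>(a, b). scale (\<epsilon> b) a) t = x"
begin

text \<open>\<open>\<Delta> d\<close> lies in the image of \<open>D \<otimes> D\<close> iff it is represented by a combination of pairs
  from \<open>D\<close>.\<close>

definition subcoalgebra :: "'a set \<Rightarrow> bool"
  where "subcoalgebra D \<longleftrightarrow> subspace D \<and> (\<forall>d\<in>D. \<exists>t\<in>\<Delta> d. Poly_Mapping.keys t \<subseteq> D \<times> D)"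

definition simple_subcoalgebra :: "'a set \<Rightarrow> bool"
  where "simple_subcoalgebra D \<longleftrightarrow> subcoalgebra D \<and> D \<noteq> {0} \<and>
    (\<forall>E. subcoalgebra E \<and> E \<subseteq> D \<longrightarrow> E = {0} \<or> E = D)"

definition coradical :: "'a set"
  where "coradical = span (\<Union>{D. simple_subcoalgebra D})"

end


section \<open>Hopf algebras\<close>

definition formal_mult :: "('a::ring_1 \<times> 'a \<Rightarrow>\<^sub>0 'k::field) \<Rightarrow> ('a \<times> 'a \<Rightarrow>\<^sub>0 'k) \<Rightarrow> ('a \<times> 'a \<Rightarrow>\<^sub>0 'k)"
  where "formal_mult s t =
    lin_ext fscale (\<lambda>(a, b). lin_ext fscale (\<lambda>(c, d). pure_tensor (a * c, b * d)) t) s"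

locale hopf_algebra = k_algebra scale + coalgebra scale \<Delta> \<epsilon>
  for scale :: "'k::field \<Rightarrow> 'a::ring_1 \<Rightarrow> 'a"
    and \<Delta> :: "'a \<Rightarrow> ('a \<times> 'a \<Rightarrow>\<^sub>0 'k) set"
    and \<epsilon> :: "'a \<Rightarrow> 'k" +
  fixes antipode :: "'a \<Rightarrow> 'a"
  assumes comult_one: "pure_tensor (1, 1) \<in> \<Delta> 1"
    and comult_mult: "s \<in> \<Delta> x \<Longrightarrow> t \<in> \<Delta> y \<Longrightarrow> formal_mult s t \<in> \<Delta> (x * y)"
    and counit_one: "\<epsilon> 1 = 1"
    and counit_mult: "\<epsilon> (x * y) = \<epsilon> x * \<epsilon> y"
    and antipode_add: "antipode (x + y) = antipode x + antipode y"
    and antipode_scale: "antipode (scale c x) = scale c (antipode x)"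
    and antipode_left: "t \<in> \<Delta> x \<Longrightarrow> lin_ext scale (\<lambda>(a, b). antipode a * b) t = scale (\<epsilon> x) 1"
    and antipode_right: "t \<in> \<Delta> x \<Longrightarrow> lin_ext scale (\<lambda>(a, b). a * antipode b) t = scale (\<epsilon> x) 1"

end

theory Submission
  imports Defs
begin

text \<open>Let \<open>H\<close> be left noetherian. Free \<open>H\<close>-modules of finite rank are noetherian, so \<open>H\<close> is stably finite, and
  this forces the antipode \<open>S\<close> to be injective. Hence \<open>S\<close> permutes the simple subcoalgebras, the coradical
  \<open>H\<^sub>0\<close> is a Hopf subalgebra, and an invariant functional on \<open>H\<^sub>0\<close> gives \<open>S (S C) = C\<close> for every simple \<open>C\<close>.

  If a Hopf subalgebra \<open>K\<close> admits a right \<open>K\<close>-linear projection \<open>H \<rightarrow> K\<close>, then \<open>K\<close> is determined among the Hopf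
  subalgebras containing it by the left ideal \<open>H K\<^sup>+\<close>. Such projections exist for \<open>K\<close> containing
  \<open>H\<^sub>0\<close>, because the layers of the filtration of \<open>H\<close> by iterated wedges of \<open>K\<close> are Hopf modules, and for
  \<open>K\<close> inside \<open>H\<^sub>0\<close>, because \<open>K\<close> then has a complement spanned by simple subcoalgebras. So the ascending chain
  condition for the ideals \<open>H K\<^sup>+\<close> first yields a finitely generated Hopf subalgebra equal to \<open>H\<^sub>0\<close>, and then
  one, generated by \<open>H\<^sub>0\<close> and a finite-dimensional subcoalgebra, equal to \<open>H\<close>. The right noetherian case
  is the left one for the opposite product and coproduct.

  Tensors are handled by their values on bilinear maps: \<open>sweedler cop B x\<close> is \<open>\<Sum> B x\<^sub>1 x\<^sub>2\<close>, where the list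
  \<open>cop x\<close> represents \<open>\<Delta> x\<close>.\<close>

section \<open>Linear and bilinear maps\<close>

text \<open>The obstacle is closure under \<open>S\<close>. The chain condition is applied to Hopf
  subalgebras generated by finite-dimensional data, whereas the orbit of a simple subcoalgebra
  \<open>C\<close> under \<open>S\<close> could be infinite. Below the coradical,
  \<open>S (S C) = C\<close> makes \<open>{C, S C}\<close> a finite stable family. Above it,
  \<open>antipode_stable\<close> shows that every subalgebra that is also a subcoalgebra containing
  the coradical is stable, so any finite-dimensional subcoalgebra may be adjoined. This difference,
  together with the two constructions of projections, is why there are two stages. Injectivity of
  \<open>S\<close> has to come first: it keeps \<open>S C\<close> nonzero and makes every functional
  factor through \<open>S\<close>, which is how simplicity passes from \<open>C\<close> to
  \<open>S C\<close>. No quotient spaces are formed. A statement modulo a subspace is tested on the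
  functionals vanishing there, and a coideal is a subspace stable under contraction of one tensor
  leg.\<close>

locale k_space = vector_space scale
  for scale :: "'k::field \<Rightarrow> 'a::ab_group_add \<Rightarrow> 'a"
begin

definition lin :: "('k \<Rightarrow> 'v::ab_group_add \<Rightarrow> 'v) \<Rightarrow> ('a \<Rightarrow> 'v) \<Rightarrow> bool"
  where "lin sc f \<longleftrightarrow> (\<forall>x y. f (x + y) = f x + f y) \<and> (\<forall>c x. f (scale c x) = sc c (f x))"

definition bil :: "('k \<Rightarrow> 'v::ab_group_add \<Rightarrow> 'v) \<Rightarrow> ('a \<Rightarrow> 'a \<Rightarrow> 'v) \<Rightarrow> bool"
  where "bil sc B \<longleftrightarrow> (\<forall>a. lin sc (B a)) \<and> (\<forall>b. lin sc (\<lambda>a. B a b))"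

lemma linI:
  "(\<And>x y. f (x + y) = f x + f y) \<Longrightarrow> (\<And>c x. f (scale c x) = sc c (f x)) \<Longrightarrow> lin sc f"
  by (simp add: lin_def)

lemma bilI:
  "(\<And>a a' b. B (a + a') b = B a b + B a' b) \<Longrightarrow> (\<And>c a b. B (scale c a) b = sc c (B a b)) \<Longrightarrow>
   (\<And>a b b'. B a (b + b') = B a b + B a b') \<Longrightarrow> (\<And>c a b. B a (scale c b) = sc c (B a b)) \<Longrightarrow>
   bil sc B"
  by (simp add: bil_def lin_def)

lemma lin_add: "lin sc f \<Longrightarrow> f (x + y) = f x + f y"
  by (simp add: lin_def)

lemma lin_scale: "lin sc f \<Longrightarrow> f (scale c x) = sc c (f x)"
  by (simp add: lin_def)

lemma lin_0: "lin sc f \<Longrightarrow> f 0 = 0"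
  using lin_add[of sc f 0 0] by simp

lemma lin_minus: "lin sc f \<Longrightarrow> f (- x) = - f x"
  using lin_add[of sc f x "- x"] lin_0[of sc f] by (simp add: eq_neg_iff_add_eq_0 add.commute)

lemma lin_diff: "lin sc f \<Longrightarrow> f (x - y) = f x - f y"
  using lin_add[of sc f x "- y"] lin_minus[of sc f y] by simp

lemma lin_sum: "lin sc f \<Longrightarrow> f (sum g A) = (\<Sum>i\<in>A. f (g i))"
  by (induction A rule: infinite_finite_induct) (auto simp: lin_0 lin_add)

lemma lin_sum_list: "lin sc f \<Longrightarrow> f (sum_list xs) = sum_list (map f xs)"
  by (induction xs) (auto simp: lin_0 lin_add)

lemmas lin_simps = lin_add lin_scale lin_0 lin_minus lin_diff

lemma bil_add1: "bil sc B \<Longrightarrow> B (a + a') b = B a b + B a' b"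
  and bil_add2: "bil sc B \<Longrightarrow> B a (b + b') = B a b + B a b'"
  and bil_scale1: "bil sc B \<Longrightarrow> B (scale c a) b = sc c (B a b)"
  and bil_scale2: "bil sc B \<Longrightarrow> B a (scale c b) = sc c (B a b)"
  by (simp_all add: bil_def lin_def)

lemma bil_lin1: "bil sc B \<Longrightarrow> lin sc (\<lambda>a. B a b)"
  and bil_lin2: "bil sc B \<Longrightarrow> lin sc (B a)"
  by (simp_all add: bil_def)

lemma bil_0: "bil sc B \<Longrightarrow> B 0 b = 0" "bil sc B \<Longrightarrow> B a 0 = 0"
  by (rule lin_0[OF bil_lin1], assumption) (rule lin_0[OF bil_lin2])

lemma bil_diff:
  "bil sc B \<Longrightarrow> B (a - a') b = B a b - B a' b"
  "bil sc B \<Longrightarrow> B a (b - b') = B a b - B a b'"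
  by (rule lin_diff[OF bil_lin1], assumption) (rule lin_diff[OF bil_lin2])

lemmas bil_simps = bil_add1 bil_add2 bil_scale1 bil_scale2 bil_0 bil_diff

lemma bil_functionals: "lin (*) f \<Longrightarrow> lin (*) g \<Longrightarrow> bil (*) (\<lambda>a b. f a * g b)"
  by (rule bilI) (simp_all add: lin_simps algebra_simps)

lemma lin_iff_linear: "vector_space sc \<Longrightarrow> lin sc f \<longleftrightarrow> Vector_Spaces.linear scale sc f"
  using vector_space_axioms by (auto simp: lin_def Vector_Spaces.linear_iff)

lemma vector_space_field: "vector_space ((*) :: 'k \<Rightarrow> 'k \<Rightarrow> 'k)"
  by unfold_locales (auto simp: algebra_simps)

lemma vector_space_scale: "vector_space scale" ..

lemma subspace_sum_list: "subspace W \<Longrightarrow> (\<And>x. x \<in> set xs \<Longrightarrow> x \<in> W) \<Longrightarrow> sum_list xs \<in> W"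
  by (induction xs) (auto simp: subspace_0 subspace_add)

section \<open>Projections and separating functionals\<close>

lemma projection_exists:
  assumes "subspace W"
  obtains p where "lin scale p" "\<And>x. p x \<in> W" "\<And>x. x \<in> W \<Longrightarrow> p x = x"
proof -
  interpret P: vector_space_pair scale scale ..
  have "\<exists>g. g ` UNIV \<subseteq> W \<and> Vector_Spaces.linear scale scale g \<and> (\<forall>v\<in>W. g (id v) = v)"
    by (rule P.linear_exists_left_inverse_on[OF linear_id assms]) simp
  then show thesis using that by (auto simp: lin_iff_linear[OF vector_space_scale, symmetric])
qed

text \<open>With \<open>p\<close> a projection onto \<open>W\<close>, the map \<open>x - p x\<close>
  kills \<open>W\<close> and is injective on \<open>U\<close> because \<open>U\<close> meets
  \<open>W\<close> trivially. Composing it with a left inverse and then \<open>g\<close> gives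
  \<open>f\<close>.\<close>

lemma functional_exists:
  assumes W: "subspace W" and U: "subspace U" and UW: "U \<inter> W \<subseteq> {0}" and g: "lin (*) g"
  obtains f where "lin (*) f" "\<And>u. u \<in> U \<Longrightarrow> f u = g u" "\<And>w. w \<in> W \<Longrightarrow> f w = 0"
proof -
  interpret P: vector_space_pair scale scale ..
  obtain p where p: "lin scale p" "\<And>x. p x \<in> W" "\<And>x. x \<in> W \<Longrightarrow> p x = x"
    by (rule projection_exists[OF W]) blast
  have q: "lin scale (\<lambda>x. x - p x)"
    using p(1) by (auto simp: lin_def algebra_simps)
  have inj: "inj_on (\<lambda>x. x - p x) U"
  proof (rule inj_onI)
    fix x y assume xy: "x \<in> U" "y \<in> U" "x - p x = y - p y"
    then have "x - y = p (x - y)" using p(1) by (simp add: lin_simps algebra_simps)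
    then have "x - y \<in> W" using p(2) by metis
    moreover have "x - y \<in> U" using xy U by (simp add: subspace_diff)
    ultimately show "x = y" using UW by auto
  qed
  obtain h where h: "Vector_Spaces.linear scale scale h" "\<forall>v\<in>U. h (v - p v) = v"
    using P.linear_exists_left_inverse_on[OF _ U inj] q lin_iff_linear[OF vector_space_scale] by auto
  have hl: "lin scale h" using h(1) lin_iff_linear[OF vector_space_scale] by auto
  show thesis
  proof (rule that[of "\<lambda>x. g (h (x - p x))"])
    show "lin (*) (\<lambda>x. g (h (x - p x)))" using g hl q unfolding lin_def by metis
  qed (use h(2) p(3) in \<open>auto simp: lin_0[OF hl] lin_0[OF g]\<close>)
qed

lemma nonzero_functional:
  assumes "x \<noteq> 0" obtains f where "lin (*) f" "f x = 1"
proof -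
  interpret P: vector_space_pair scale "(*)" by (simp add: vector_space_pair_def vector_space_axioms vector_space_field)
  have "independent {x}" using assms by simp
  from P.linear_independent_extend[OF this, of "\<lambda>_. 1"] show thesis
    using that lin_iff_linear[OF vector_space_field] by auto
qed

lemma separating_functional:
  assumes W: "subspace W" and x: "x \<notin> W"
  obtains f where "lin (*) f" "f x = 1" "\<And>w. w \<in> W \<Longrightarrow> f w = 0"
proof -
  have "x \<noteq> 0" using x subspace_0[OF W] by auto
  then obtain g where g: "lin (*) g" "g x = 1" by (rule nonzero_functional)
  have "span {x} \<inter> W \<subseteq> {0}"
  proof
    fix y assume "y \<in> span {x} \<inter> W"
    then obtain c where c: "y = scale c x" "y \<in> W" by (auto simp: span_singleton)
    show "y \<in> {0}"
    proof (rule ccontr)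
      assume "y \<notin> {0}"
      then have "c \<noteq> 0" using c by auto
      then have "x = scale (inverse c) y" using c by simp
      then show False using c(2) x subspace_scale[OF W] by metis
    qed
  qed
  from functional_exists[OF W subspace_span this g(1)] show thesis
    using that g(2) span_superset[of "{x}"] by (metis insert_subset)
qed

text \<open>Stands in for the quotient by \<open>W\<close>: subspace memberships below are proved by
  testing against functionals that vanish on the subspace.\<close>

lemma functional_mem:
  assumes W: "subspace W" and "\<And>f. lin (*) f \<Longrightarrow> (\<And>w. w \<in> W \<Longrightarrow> f w = 0) \<Longrightarrow> f x = 0"
  shows "x \<in> W"
  by (metis separating_functional[OF W, of x] assms(2) zero_neq_one)

lemma functional_eq_0: "(\<And>f. lin (*) f \<Longrightarrow> f x = 0) \<Longrightarrow> x = 0"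
  by (metis nonzero_functional zero_neq_one)

lemma functional_eq: "(\<And>f. lin (*) f \<Longrightarrow> f x = f y) \<Longrightarrow> x = y"
  using functional_eq_0[of "x - y"] by (simp add: lin_diff)

text \<open>Expanding the first slot in a basis that extends a basis of \<open>X\<close> reduces the vanishing of a sum
  of tensors to its images under functionals that vanish on \<open>X\<close>.\<close>

lemma sum_list_eq_0_by_functionals:
  fixes u :: "'w \<Rightarrow> 'a" and F :: "'a \<Rightarrow> 'w \<Rightarrow> 'v::ab_group_add"
  assumes sc: "vector_space sc" and X: "subspace X"
    and F: "\<And>w. lin sc (\<lambda>c. F c w)" and FX: "\<And>c w. c \<in> X \<Longrightarrow> F c w = 0"
    and eq: "\<And>f c. lin (*) f \<Longrightarrow> (\<And>x. x \<in> X \<Longrightarrow> f x = 0) \<Longrightarrow> (\<Sum>w\<leftarrow>l. sc (f (u w)) (F c w)) = 0"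
  shows "(\<Sum>w\<leftarrow>l. F (u w) w) = 0"
proof -
  interpret V: vector_space sc by fact
  obtain bx where bx: "bx \<subseteq> X" "independent bx" "X \<subseteq> span bx" by (rule maximal_independent_subset)
  define bs where "bs = extend_basis bx"
  have bs: "bx \<subseteq> bs" "independent bs" "span bs = UNIV"
    using bx(2) by (auto simp: bs_def extend_basis_superset independent_extend_basis span_extend_basis)
  define r where "r i v = representation bs v i" for i v
  have rl: "lin (*) (r i)" for i
    using bs by (simp add: lin_def r_def representation_add representation_scale)
  define I where "I = (\<Union>w\<in>set l. {i. r i (u w) \<noteq> 0})"
  have I: "finite I" unfolding I_def r_def by (auto simp: finite_representation)
  have IB: "I \<subseteq> bs" unfolding I_def r_def using representation_ne_zero by blast
  have exp: "u w = (\<Sum>i\<in>I. scale (r i (u w)) i)" if "w \<in> set l" for w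
  proof -
    have "u w = (\<Sum>i | r i (u w) \<noteq> 0. scale (r i (u w)) i)"
      unfolding r_def using sum_nonzero_representation_eq[OF bs(2)] bs(3) by auto
    also have "\<dots> = (\<Sum>i\<in>I. scale (r i (u w)) i)"
      by (rule sum.mono_neutral_left[OF I]) (use that in \<open>auto simp: I_def\<close>)
    finally show ?thesis .
  qed
  have "(\<Sum>w\<leftarrow>l. F (u w) w) = (\<Sum>w\<leftarrow>l. \<Sum>i\<in>I. sc (r i (u w)) (F i w))"
  proof (rule arg_cong[where f = sum_list], rule map_cong[OF refl])
    fix w assume "w \<in> set l"
    have "F (u w) w = F (\<Sum>i\<in>I. scale (r i (u w)) i) w" using exp[OF \<open>w \<in> set l\<close>] by simp
    also have "\<dots> = (\<Sum>i\<in>I. sc (r i (u w)) (F i w))"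
      by (subst lin_sum[OF F], rule sum.cong[OF refl], rule lin_scale[OF F])
    finally show "F (u w) w = (\<Sum>i\<in>I. sc (r i (u w)) (F i w))" .
  qed
  also have "\<dots> = (\<Sum>i\<in>I. \<Sum>w\<leftarrow>l. sc (r i (u w)) (F i w))"
    by (induction l) (auto simp: sum.distrib)
  also have "\<dots> = 0"
  proof (rule sum.neutral, rule ballI)
    fix i assume "i \<in> I"
    show "(\<Sum>w\<leftarrow>l. sc (r i (u w)) (F i w)) = 0"
    proof (cases "i \<in> bx")
      case True
      then have "F i w = 0" for w using FX bx by blast
      then show ?thesis by (induction l) auto
    next
      case False
      have "r i x = 0" if "x \<in> X" for x
      proof -
        have "x \<in> span bx" using that bx by blast
        then have "representation bs x = representation bx x" using bs(1) bs(2) representation_extend by blast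
        then show ?thesis using False representation_ne_zero[of bx x i] unfolding r_def by metis
      qed
      then show ?thesis using eq[OF rl] by blast
    qed
  qed
  finally show ?thesis .
qed

lemma finite_span_subspace:
  assumes "finite T" "subspace W" "W \<subseteq> span T"
  obtains A where "finite A" "independent A" "W = span A" "A \<subseteq> W"
proof -
  obtain A where A: "A \<subseteq> W" "independent A" "W \<subseteq> span A" by (rule maximal_independent_subset)
  moreover have "finite A" using independent_span_bound[OF assms(1) A(2)] A(1) assms(3) by auto
  moreover have "span A \<subseteq> W" using A(1) assms(2) by (rule span_minimal)
  ultimately show thesis using that by blast
qed

lemma dim_psubset_finite:
  assumes T: "finite T" "W \<subseteq> span T" and W: "subspace W'" "W' \<subset> W"
  shows "dim W' < dim W"
proof -
  obtain A where A: "A \<subseteq> W'" "independent A" "W' \<subseteq> span A" by (rule maximal_independent_subset)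
  obtain B where B: "A \<subseteq> B" "B \<subseteq> W" "independent B" "W \<subseteq> span B"
    by (rule maximal_independent_subset_extend[OF _ A(2), of W]) (use A W in auto)
  have fB: "finite B" using independent_span_bound[OF T(1) B(3)] B(2) T(2) by auto
  have "A \<noteq> B"
  proof
    assume "A = B"
    then have "W \<subseteq> W'" using B(4) span_minimal[OF A(1) W(1)] by auto
    then show False using W(2) by auto
  qed
  then have "card A < card B" using B(1) fB by (simp add: psubset_card_mono psubset_eq)
  then show ?thesis using basis_card_eq_dim[OF A(1) A(3) A(2)] basis_card_eq_dim[OF B(2) B(4) B(3)] by simp
qed

end

section \<open>Sweedler sums\<close>

definition sweedler :: "('b \<Rightarrow> ('a \<times> 'a) list) \<Rightarrow> ('a \<Rightarrow> 'a \<Rightarrow> 'v::comm_monoid_add) \<Rightarrow> 'b \<Rightarrow> 'v"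
  where "sweedler cop B x = (\<Sum>(a, b)\<leftarrow>cop x. B a b)"

context k_space
begin

definition tri :: "('k \<Rightarrow> 'v::ab_group_add \<Rightarrow> 'v) \<Rightarrow> ('a \<Rightarrow> 'a \<Rightarrow> 'a \<Rightarrow> 'v) \<Rightarrow> bool"
  where "tri sc T \<longleftrightarrow> (\<forall>a. bil sc (T a)) \<and> (\<forall>b c. lin sc (\<lambda>a. T a b c))"

lemma triI:
  "(\<And>x y b c. T (x + y) b c = T x b c + T y b c) \<Longrightarrow> (\<And>r x b c. T (scale r x) b c = sc r (T x b c)) \<Longrightarrow>
   (\<And>x y b c. T b (x + y) c = T b x c + T b y c) \<Longrightarrow> (\<And>r x b c. T b (scale r x) c = sc r (T b x c)) \<Longrightarrow>
   (\<And>x y b c. T b c (x + y) = T b c x + T b c y) \<Longrightarrow> (\<And>r x b c. T b c (scale r x) = sc r (T b c x)) \<Longrightarrow>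
   tri sc T"
  by (simp add: tri_def bil_def lin_def)

lemma tri_bil: "tri sc T \<Longrightarrow> bil sc (T a)" "tri sc T \<Longrightarrow> bil sc (\<lambda>a b. T a b c)"
  by (simp_all add: tri_def bil_def)

lemma tri_lin: "tri sc T \<Longrightarrow> lin sc (\<lambda>a. T a b c)"
  by (simp add: tri_def)

text \<open>A tensor killed by all such \<open>f \<otimes> g\<close> lies in
  \<open>X \<otimes> V + V \<otimes> Z\<close>, where \<open>B\<close> vanishes. The slots are
  treated one at a time: contracting the first with \<open>f\<close> leaves a single vector, which
  lies in \<open>Z\<close> because every \<open>g\<close> vanishing on \<open>Z\<close> kills
  it.\<close>

lemma pair_list_eq_0:
  assumes sc: "vector_space sc" and X: "subspace X" and Z: "subspace Z" and B: "bil sc B"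
    and BX: "\<And>a b. a \<in> X \<Longrightarrow> B a b = 0" and BZ: "\<And>a b. b \<in> Z \<Longrightarrow> B a b = 0"
    and eq: "\<And>f g. lin (*) f \<Longrightarrow> lin (*) g \<Longrightarrow> (\<And>x. x \<in> X \<Longrightarrow> f x = 0) \<Longrightarrow> (\<And>z. z \<in> Z \<Longrightarrow> g z = 0) \<Longrightarrow>
      (\<Sum>(a, b)\<leftarrow>l. f a * g b) = 0"
  shows "(\<Sum>(a, b)\<leftarrow>l. B a b) = 0"
proof -
  have "(\<Sum>w\<leftarrow>l. B (fst w) (snd w)) = 0"
  proof (rule sum_list_eq_0_by_functionals[OF sc X, where u = fst and F = "\<lambda>c w. B c (snd w)"])
    fix f c assume f: "lin (*) f" "\<And>x. x \<in> X \<Longrightarrow> f x = 0"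
    have "(\<Sum>(a, b)\<leftarrow>l. scale (f a) b) \<in> Z"
    proof (rule functional_mem[OF Z])
      fix g assume g: "lin (*) g" "\<And>z. z \<in> Z \<Longrightarrow> g z = 0"
      have "g (\<Sum>(a, b)\<leftarrow>l. scale (f a) b) = (\<Sum>(a, b)\<leftarrow>l. f a * g b)"
        using lin_sum_list[OF g(1), of "map (\<lambda>(a, b). scale (f a) b) l"]
        by (simp add: case_prod_unfold comp_def lin_scale[OF g(1)])
      also have "\<dots> = 0" using eq f g by blast
      finally show "g (\<Sum>(a, b)\<leftarrow>l. scale (f a) b) = 0" .
    qed
    then have "B c (\<Sum>(a, b)\<leftarrow>l. scale (f a) b) = 0" by (rule BZ)
    then show "(\<Sum>w\<leftarrow>l. sc (f (fst w)) (B c (snd w))) = 0"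
      using lin_sum_list[OF bil_lin2[OF B], of c "map (\<lambda>(a, b). scale (f a) b) l"]
      by (simp add: case_prod_unfold comp_def bil_scale2[OF B])
  qed (use BX B in \<open>auto simp: bil_def\<close>)
  then show ?thesis by (simp add: case_prod_unfold)
qed

lemma pair_list_eq_0':
  assumes sc: "vector_space sc" and B: "bil sc B"
    and eq: "\<And>f g. lin (*) f \<Longrightarrow> lin (*) g \<Longrightarrow> (\<Sum>(a, b)\<leftarrow>l. f a * g b) = 0"
  shows "(\<Sum>(a, b)\<leftarrow>l. B a b) = 0"
  by (rule pair_list_eq_0[OF sc subspace_single_0 subspace_single_0 B])
    (use eq in \<open>auto simp: bil_0[OF B]\<close>)

lemma triple_list_eq_0:
  assumes sc: "vector_space sc" and T: "tri sc T"
    and eq: "\<And>f g h. lin (*) f \<Longrightarrow> lin (*) g \<Longrightarrow> lin (*) h \<Longrightarrow>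
      (\<Sum>(a, b, c)\<leftarrow>l. f a * g b * h c) = 0"
  shows "(\<Sum>(a, b, c)\<leftarrow>l. T a b c) = 0"
proof -
  have "(\<Sum>w\<leftarrow>l. T (fst w) (fst (snd w)) (snd (snd w))) = 0"
  proof (rule sum_list_eq_0_by_functionals[OF sc subspace_single_0,
        where u = fst and F = "\<lambda>c w. T c (fst (snd w)) (snd (snd w))"])
    fix f d assume f: "lin (*) f"
    \<comment> \<open>Contracting the first slot with \<open>f\<close> reduces triples to
      pairs.\<close>
    have "(\<Sum>(a, b)\<leftarrow>map (\<lambda>(a, b, c). (scale (f a) b, c)) l. T d a b) = 0"
    proof (rule pair_list_eq_0'[OF sc tri_bil(1)[OF T]])
      fix g h assume "lin (*) g" "lin (*) h"
      then show "(\<Sum>(a, b)\<leftarrow>map (\<lambda>(a, b, c). (scale (f a) b, c)) l. g a * h b) = 0"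
        using eq[OF f] by (simp add: case_prod_unfold comp_def lin_scale)
    qed
    then show "(\<Sum>w\<leftarrow>l. sc (f (fst w)) (T d (fst (snd w)) (snd (snd w)))) = 0"
      by (simp add: case_prod_unfold comp_def bil_scale1[OF tri_bil(1)[OF T]])
  qed (use T in \<open>auto simp: tri_lin lin_0[OF tri_lin[OF T]]\<close>)
  then show ?thesis by (simp add: case_prod_unfold)
qed

end

text \<open>The lists \<open>cop x\<close> are neither additive nor coassociative themselves, only
  the tensors that they represent. Testing on products of scalar functionals avoids quantifying over
  target spaces, which locale assumptions cannot do; \<open>lin_sw\<close> and
  \<open>coassoc\<close> recover the laws for multilinear maps into any vector space.\<close>

locale sweedler_coalgebra = k_space scale
  for scale :: "'k::field \<Rightarrow> 'a::ab_group_add \<Rightarrow> 'a" +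
  fixes cop :: "'a \<Rightarrow> ('a \<times> 'a) list" and \<epsilon> :: "'a \<Rightarrow> 'k"
  assumes cop_add: "lin (*) f \<Longrightarrow> lin (*) g \<Longrightarrow> sweedler cop (\<lambda>a b. f a * g b) (x + y) =
      sweedler cop (\<lambda>a b. f a * g b) x + sweedler cop (\<lambda>a b. f a * g b) y"
    and cop_scale: "lin (*) f \<Longrightarrow> lin (*) g \<Longrightarrow> sweedler cop (\<lambda>a b. f a * g b) (scale c x) =
      c * sweedler cop (\<lambda>a b. f a * g b) x"
    and cop_coassoc: "lin (*) f \<Longrightarrow> lin (*) g \<Longrightarrow> lin (*) h \<Longrightarrow>
      sweedler cop (\<lambda>a b. sweedler cop (\<lambda>p q. f p * g q * h b) a) x =
      sweedler cop (\<lambda>a b. sweedler cop (\<lambda>p q. f a * g p * h q) b) x"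
    and lin_counit: "lin (*) \<epsilon>"
    and cop_counit_left: "sweedler cop (\<lambda>a b. scale (\<epsilon> a) b) x = x"
    and cop_counit_right: "sweedler cop (\<lambda>a b. scale (\<epsilon> b) a) x = x"
begin

abbreviation sw :: "('a \<Rightarrow> 'a \<Rightarrow> 'v::comm_monoid_add) \<Rightarrow> 'a \<Rightarrow> 'v"
  where "sw \<equiv> sweedler cop"

lemma sw_plus: "sw (\<lambda>a b. B a b + B' a b) x = sw B x + sw B' x"
  by (simp add: sweedler_def case_prod_unfold sum_list_addf)

lemma sw_zero: "sw (\<lambda>a b. 0) x = 0"
  by (simp add: sweedler_def case_prod_unfold)

lemma sw_hom: "h 0 = 0 \<Longrightarrow> (\<And>x y. h (x + y) = h x + h y) \<Longrightarrow> h (sw B x) = sw (\<lambda>a b. h (B a b)) x"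
proof -
  assume h: "h 0 = 0" "\<And>x y. h (x + y) = h x + h y"
  have "h (\<Sum>(a, b)\<leftarrow>l. B a b) = (\<Sum>(a, b)\<leftarrow>l. h (B a b))" for l
    by (induction l) (auto simp: h)
  then show ?thesis by (simp add: sweedler_def)
qed

lemma sw_lin: "lin sc h \<Longrightarrow> h (sw B x) = sw (\<lambda>a b. h (B a b)) x"
  by (rule sw_hom) (auto simp: lin_0 lin_add)

lemma sw_minus: "sw (\<lambda>a b. - B a b :: 'v::ab_group_add) x = - sw B x"
  by (rule sw_hom[symmetric]) auto

lemma sw_diff: "sw (\<lambda>a b. B a b - B' a b :: 'v::ab_group_add) x = sw B x - sw B' x"
  using sw_plus[of B "\<lambda>a b. - B' a b" x] by (simp add: sw_minus)

lemma sw_smult: "vector_space sc \<Longrightarrow> sw (\<lambda>a b. sc c (B a b)) x = sc c (sw B x)"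
  by (rule sw_hom[symmetric])
    (simp_all add: vector_space.vector_space_assms(1) module.scale_zero_right module_iff_vector_space)

lemmas sw_scale = sw_smult[OF vector_space_scale]
lemmas sw_mult_left = sw_smult[OF vector_space_field]

lemma sw_smult_fun: "vector_space sc \<Longrightarrow> sw (\<lambda>a b. sc c (B a b)) = (\<lambda>x. sc c (sw B x))"
  by (simp add: fun_eq_iff sw_smult)

text \<open>The unapplied forms also rewrite eta-contracted inner occurrences.\<close>

lemmas sw_funs = sw_plus[abs_def] sw_zero[abs_def] sw_minus[abs_def] sw_diff[abs_def]
  sw_smult_fun[OF vector_space_scale] sw_smult_fun[OF vector_space_field]

lemma sw_swap: "sw (\<lambda>a b. sw (\<lambda>c d. Q a b c d) y) x = sw (\<lambda>c d. sw (\<lambda>a b. Q a b c d) x) y"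
proof -
  have "(\<Sum>(a, b)\<leftarrow>l. sw (\<lambda>c d. Q a b c d) y) = sw (\<lambda>c d. \<Sum>(a, b)\<leftarrow>l. Q a b c d) y" for l
    by (induction l) (auto simp: sw_plus sw_zero)
  then show ?thesis by (simp add: sweedler_def[of cop _ x])
qed

lemma sw_mem: "subspace W \<Longrightarrow> (\<And>a b. B a b \<in> W) \<Longrightarrow> sw B x \<in> W"
  unfolding sweedler_def by (rule subspace_sum_list) auto

text \<open>Appending to \<open>cop (x + y)\<close> the pairs of \<open>cop x\<close> and
  \<open>cop y\<close> with negated first entries gives a list that represents the zero tensor, so
  every bilinear map sums to zero over it. Scalars are treated in the same way.\<close>

lemma lin_sw: assumes sc: "vector_space sc" and B: "bil sc B" shows "lin sc (sw B)"
proof (rule linI)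
  interpret V: vector_space sc by fact
  fix x y c
  have "(\<Sum>(a, b)\<leftarrow>cop (x + y) @ map (\<lambda>(a, b). (- a, b)) (cop x @ cop y). B a b) = 0"
  proof (rule pair_list_eq_0'[OF sc B])
    fix f g assume fg: "lin (*) f" "lin (*) g"
    have "(\<Sum>(a, b)\<leftarrow>map (\<lambda>(a, b). (- a, b)) l. f a * g b) = - (\<Sum>(a, b)\<leftarrow>l. f a * g b)" for l
      by (induction l) (auto simp: lin_minus[OF fg(1)])
    then show "(\<Sum>(a, b)\<leftarrow>cop (x + y) @ map (\<lambda>(a, b). (- a, b)) (cop x @ cop y). f a * g b) = 0"
      using cop_add[OF fg, of x y] by (simp add: sweedler_def)
  qed
  moreover have "(\<Sum>(a, b)\<leftarrow>map (\<lambda>(a, b). (- a, b)) l. B a b) = - (\<Sum>(a, b)\<leftarrow>l. B a b)" for l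
    by (induction l) (auto simp: lin_minus[OF bil_lin1[OF B]])
  ultimately show "sw B (x + y) = sw B x + sw B y"
    by (simp add: sweedler_def algebra_simps)
  have "(\<Sum>(a, b)\<leftarrow>cop (scale c x) @ map (\<lambda>(a, b). (scale (- c) a, b)) (cop x). B a b) = 0"
  proof (rule pair_list_eq_0'[OF sc B])
    fix f g assume fg: "lin (*) f" "lin (*) g"
    have "(\<Sum>(a, b)\<leftarrow>map (\<lambda>(a, b). (scale (- c) a, b)) l. f a * g b) = - c * (\<Sum>(a, b)\<leftarrow>l. f a * g b)" for l
      by (induction l) (auto simp: lin_minus[OF fg(1)] lin_scale[OF fg(1)] algebra_simps)
    then show "(\<Sum>(a, b)\<leftarrow>cop (scale c x) @ map (\<lambda>(a, b). (scale (- c) a, b)) (cop x). f a * g b) = 0"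
      using cop_scale[OF fg, of c x] by (simp add: sweedler_def)
  qed
  moreover have "(\<Sum>(a, b)\<leftarrow>map (\<lambda>(a, b). (scale (- c) a, b)) l. B a b) = sc (- c) (\<Sum>(a, b)\<leftarrow>l. B a b)" for l
    by (induction l) (auto simp: bil_simps[OF B] lin_minus[OF bil_lin1[OF B]] V.scale_right_distrib V.scale_right_diff_distrib)
  ultimately show "sw B (scale c x) = sc c (sw B x)"
    by (simp add: sweedler_def algebra_simps)
qed

lemma coassoc:
  assumes sc: "vector_space sc" and T: "tri sc T"
  shows "sw (\<lambda>a b. sw (\<lambda>p q. T p q b) a) x = sw (\<lambda>a b. sw (\<lambda>p q. T a p q) b) x"
proof -
  \<comment> \<open>\<open>l1\<close> represents the left side and \<open>l2\<close>, with the sign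
    in its first entries, minus the right side, so \<open>l1 @ l2\<close> represents zero.\<close>
  define l1 where "l1 = concat (map (\<lambda>(a, b). map (\<lambda>(p, q). (p, q, b)) (cop a)) (cop x))"
  define l2 where "l2 = concat (map (\<lambda>(a, b). map (\<lambda>(p, q). (- a, p, q)) (cop b)) (cop x))"
  have l1: "(\<Sum>(a, b, c)\<leftarrow>l1. U a b c) = sw (\<lambda>a b. sw (\<lambda>p q. U p q b) a) x"
    for U :: "'a \<Rightarrow> 'a \<Rightarrow> 'a \<Rightarrow> 'w::comm_monoid_add"
  proof -
    have "(\<Sum>(a, b, c)\<leftarrow>concat (map (\<lambda>(a, b). map (\<lambda>(p, q). (p, q, b)) (cop a)) l). U a b c) =
        (\<Sum>(a, b)\<leftarrow>l. sw (\<lambda>p q. U p q b) a)" for l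
      by (induction l) (auto simp: sweedler_def case_prod_unfold comp_def)
    then show ?thesis by (simp add: l1_def sweedler_def)
  qed
  have l2: "(\<Sum>(a, b, c)\<leftarrow>l2. U a b c) = - sw (\<lambda>a b. sw (\<lambda>p q. U a p q) b) x"
    if U: "\<And>a b c. U (- a) b c = - U a b c" for U :: "'a \<Rightarrow> 'a \<Rightarrow> 'a \<Rightarrow> 'w::ab_group_add"
  proof -
    have m: "(\<Sum>(p, q)\<leftarrow>l. - (U a p q)) = - (\<Sum>(p, q)\<leftarrow>l. U a p q)" for l a
      by (induction l) auto
    have "(\<Sum>(a, b, c)\<leftarrow>concat (map (\<lambda>(a, b). map (\<lambda>(p, q). (- a, p, q)) (cop b)) l). U a b c) =
        - (\<Sum>(a, b)\<leftarrow>l. sw (\<lambda>p q. U a p q) b)" for l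
      using m by (induction l) (auto simp: sweedler_def case_prod_unfold comp_def U)
    then show ?thesis by (simp add: l2_def sweedler_def)
  qed
  have "(\<Sum>(a, b, c)\<leftarrow>l1 @ l2. T a b c) = 0"
  proof (rule triple_list_eq_0[OF sc T])
    fix f g h assume fgh: "lin (*) f" "lin (*) g" "lin (*) h"
    have "(\<Sum>(a, b, c)\<leftarrow>l2. f a * g b * h c) = - sw (\<lambda>a b. sw (\<lambda>p q. f a * g p * h q) b) x"
      by (rule l2) (simp add: lin_minus[OF fgh(1)])
    then show "(\<Sum>(a, b, c)\<leftarrow>l1 @ l2. f a * g b * h c) = 0"
      using cop_coassoc[OF fgh, of x] by (simp add: l1)
  qed
  moreover have "(\<Sum>(a, b, c)\<leftarrow>l2. T a b c) = - sw (\<lambda>a b. sw (\<lambda>p q. T a p q) b) x"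
    by (rule l2) (rule lin_minus[OF tri_lin[OF T]])
  ultimately show ?thesis by (simp add: l1)
qed

lemma bil_sw_left:
  assumes sc: "vector_space sc" and T: "tri sc T" shows "bil sc (\<lambda>a b. sw (\<lambda>p q. T p q b) a)"
proof -
  have "lin sc (\<lambda>b. sw (\<lambda>p q. T p q b) a)" for a
    using T by (auto simp: lin_def tri_def bil_def sw_plus sw_smult[OF sc])
  then show ?thesis unfolding bil_def using lin_sw[OF sc tri_bil(2)[OF T]] by simp
qed

lemma bil_sw_right:
  assumes sc: "vector_space sc" and T: "tri sc T" shows "bil sc (\<lambda>a b. sw (\<lambda>p q. T a p q) b)"
proof -
  have "lin sc (\<lambda>a. sw (\<lambda>p q. T a p q) b)" for b
  proof (rule linI)
    have "T (x + y) = (\<lambda>a b. T x a b + T y a b)" for x y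
      using T by (simp add: tri_def lin_def fun_eq_iff)
    then show "sw (T (x + y)) b = sw (T x) b + sw (T y) b" for x y by (simp add: sw_plus)
    have "T (scale c x) = (\<lambda>a b. sc c (T x a b))" for c x
      using T by (simp add: tri_def lin_def fun_eq_iff)
    then show "sw (T (scale c x)) b = sc c (sw (T x) b)" for c x by (simp add: sw_smult[OF sc])
  qed
  then show ?thesis unfolding bil_def using lin_sw[OF sc tri_bil(1)[OF T]] by simp
qed

lemma counit_left: "lin sc f \<Longrightarrow> sw (\<lambda>a b. sc (\<epsilon> a) (f b)) x = f x"
  using sw_lin[of sc f "\<lambda>a b. scale (\<epsilon> a) b" x] by (simp add: cop_counit_left lin_scale)

lemma counit_right: "lin sc f \<Longrightarrow> sw (\<lambda>a b. sc (\<epsilon> b) (f a)) x = f x"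
  using sw_lin[of sc f "\<lambda>a b. scale (\<epsilon> b) a" x] by (simp add: cop_counit_right lin_scale)

section \<open>Actions of the dual algebra, coideals and wedges\<close>

definition Lf :: "('a \<Rightarrow> 'k) \<Rightarrow> 'a \<Rightarrow> 'a"
  where "Lf f = sw (\<lambda>a b. scale (f a) b)"

definition Rf :: "('a \<Rightarrow> 'k) \<Rightarrow> 'a \<Rightarrow> 'a"
  where "Rf f = sw (\<lambda>a b. scale (f b) a)"

definition conv :: "('a \<Rightarrow> 'k) \<Rightarrow> ('a \<Rightarrow> 'k) \<Rightarrow> 'a \<Rightarrow> 'k"
  where "conv f g = sw (\<lambda>a b. f a * g b)"

lemma lin_apply_Lf: "lin sc h \<Longrightarrow> h (Lf f x) = sw (\<lambda>a b. sc (f a) (h b)) x"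
  by (simp add: Lf_def sw_lin lin_scale)

lemma lin_apply_Rf: "lin sc h \<Longrightarrow> h (Rf f x) = sw (\<lambda>a b. sc (f b) (h a)) x"
  by (simp add: Rf_def sw_lin lin_scale)

lemma lin_conv: "lin (*) f \<Longrightarrow> lin (*) g \<Longrightarrow> lin (*) (conv f g)"
  unfolding conv_def by (rule lin_sw[OF vector_space_field], rule bilI) (auto simp: lin_simps algebra_simps)

lemma lin_Lf: "lin (*) f \<Longrightarrow> lin scale (Lf f)"
  unfolding Lf_def by (rule lin_sw[OF vector_space_scale], rule bilI) (auto simp: lin_simps algebra_simps)

lemma lin_Rf: "lin (*) f \<Longrightarrow> lin scale (Rf f)"
  unfolding Rf_def by (rule lin_sw[OF vector_space_scale], rule bilI) (auto simp: lin_simps algebra_simps)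

lemma Lf_counit [simp]: "Lf \<epsilon> x = x" and Rf_counit [simp]: "Rf \<epsilon> x = x"
  by (simp_all add: Lf_def Rf_def cop_counit_left cop_counit_right)

lemma functional_Lf: "lin (*) h \<Longrightarrow> h (Lf f x) = conv f h x"
  by (simp add: lin_apply_Lf conv_def)

lemma functional_Rf: "lin (*) h \<Longrightarrow> h (Rf f x) = conv h f x"
  by (simp add: lin_apply_Rf conv_def mult.commute)

lemma conv_assoc:
  assumes "lin (*) f" "lin (*) g" "lin (*) h"
  shows "conv (conv f g) h x = conv f (conv g h) x"
proof -
  have "conv (conv f g) h x = sw (\<lambda>a b. sw (\<lambda>p q. f p * g q * h b) a) x"
    unfolding conv_def by (subst (2) mult.commute) (simp add: sw_mult_left[symmetric] mult_ac)
  also have "\<dots> = conv f (conv g h) x"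
    unfolding cop_coassoc[OF assms] by (simp add: conv_def sw_funs mult.assoc)
  finally show ?thesis .
qed

text \<open>Both sides are \<open>g(x_1) x_2 f(x_3)\<close>. With the next two lemmas,
  \<open>Rf\<close> is a left and \<open>Lf\<close> a right action of the convolution algebra, and
  the two commute.\<close>

lemma Rf_Lf: assumes "lin (*) f" "lin (*) g" shows "Rf f (Lf g x) = Lf g (Rf f x)"
  by (rule functional_eq) (simp add: functional_Rf functional_Lf assms lin_conv conv_assoc)

lemma Rf_Rf: assumes "lin (*) f" "lin (*) g" shows "Rf f (Rf g x) = Rf (conv f g) x"
  by (rule functional_eq) (simp add: functional_Rf functional_Lf assms lin_conv conv_assoc)

lemma Lf_Lf: assumes "lin (*) f" "lin (*) g" shows "Lf f (Lf g x) = Lf (conv g f) x"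
  by (rule functional_eq) (simp add: functional_Rf functional_Lf assms lin_conv conv_assoc)

text \<open>Stability under all contractions of the second leg amounts to
  \<open>\<Delta> W \<subseteq> W \<otimes> H\<close>.\<close>

definition right_coideal :: "'a set \<Rightarrow> bool"
  where "right_coideal W \<longleftrightarrow> subspace W \<and> (\<forall>f. lin (*) f \<longrightarrow> (\<forall>w\<in>W. Rf f w \<in> W))"

definition left_coideal :: "'a set \<Rightarrow> bool"
  where "left_coideal W \<longleftrightarrow> subspace W \<and> (\<forall>f. lin (*) f \<longrightarrow> (\<forall>w\<in>W. Lf f w \<in> W))"

definition subcoalg :: "'a set \<Rightarrow> bool"
  where "subcoalg D \<longleftrightarrow> right_coideal D \<and> left_coideal D"

text \<open>For subspaces, the preimage of \<open>X \<otimes> H + H \<otimes> Z\<close> under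
  \<open>\<Delta>\<close>, expressed through the functionals that annihilate it.\<close>

definition wedge :: "'a set \<Rightarrow> 'a set \<Rightarrow> 'a set"
  where "wedge X Z = {y. \<forall>f g. lin (*) f \<longrightarrow> lin (*) g \<longrightarrow> (\<forall>x\<in>X. f x = 0) \<longrightarrow> (\<forall>z\<in>Z. g z = 0) \<longrightarrow> conv f g y = 0}"

lemma right_coidealD: "right_coideal W \<Longrightarrow> subspace W" "right_coideal W \<Longrightarrow> lin (*) f \<Longrightarrow> w \<in> W \<Longrightarrow> Rf f w \<in> W"
  by (auto simp: right_coideal_def)

lemma left_coidealD: "left_coideal W \<Longrightarrow> subspace W" "left_coideal W \<Longrightarrow> lin (*) f \<Longrightarrow> w \<in> W \<Longrightarrow> Lf f w \<in> W"
  by (auto simp: left_coideal_def)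

lemma subcoalgD:
  assumes "subcoalg D"
  shows "subspace D" "right_coideal D" "left_coideal D"
    "lin (*) f \<Longrightarrow> w \<in> D \<Longrightarrow> Rf f w \<in> D" "lin (*) f \<Longrightarrow> w \<in> D \<Longrightarrow> Lf f w \<in> D"
  using assms by (auto simp: subcoalg_def right_coideal_def left_coideal_def)

lemma subcoalgI:
  "subspace D \<Longrightarrow> (\<And>f w. lin (*) f \<Longrightarrow> w \<in> D \<Longrightarrow> Rf f w \<in> D) \<Longrightarrow>
   (\<And>f w. lin (*) f \<Longrightarrow> w \<in> D \<Longrightarrow> Lf f w \<in> D) \<Longrightarrow> subcoalg D"
  by (auto simp: subcoalg_def right_coideal_def left_coideal_def)

lemma sw_eq_0_wedge:
  assumes "vector_space sc" "subspace X" "subspace Z" "bil sc B"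
    and "\<And>a b. a \<in> X \<Longrightarrow> B a b = 0" "\<And>a b. b \<in> Z \<Longrightarrow> B a b = 0" and y: "y \<in> wedge X Z"
  shows "sw B y = 0"
  unfolding sweedler_def
  by (rule pair_list_eq_0[OF assms(1-6)]) (use y in \<open>auto simp: wedge_def conv_def sweedler_def\<close>)

text \<open>Licenses rewriting under a Sweedler sum: the summands have to agree only where the first
  leg is in \<open>X\<close> or the second is in \<open>Z\<close>. The congruence rules for coideals
  and subcoalgebras below all come from it.\<close>

lemma sw_cong_wedge:
  assumes sc: "vector_space sc" "subspace X" "subspace Z" "bil sc B" "bil sc B'"
    and eq: "\<And>a b. a \<in> X \<Longrightarrow> B a b = B' a b" "\<And>a b. b \<in> Z \<Longrightarrow> B a b = B' a b" and y: "y \<in> wedge X Z"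
  shows "sw B y = sw B' y"
proof -
  interpret V: vector_space sc by fact
  have "sw (\<lambda>a b. B a b - B' a b) y = 0"
    by (rule sw_eq_0_wedge[OF sc(1-3) _ _ _ y], rule bilI)
      (simp_all add: eq bil_simps[OF sc(4)] bil_simps[OF sc(5)] V.scale_right_diff_distrib)
  then show ?thesis by (simp add: sw_diff)
qed

lemma right_coideal_wedge: "right_coideal X \<Longrightarrow> x \<in> X \<Longrightarrow> x \<in> wedge X {0}"
  by (auto simp: wedge_def functional_Rf[symmetric] right_coidealD)

lemma left_coideal_wedge: "left_coideal X \<Longrightarrow> x \<in> X \<Longrightarrow> x \<in> wedge {0} X"
  by (auto simp: wedge_def functional_Lf[symmetric] left_coidealD)

lemma sw_cong_right_coideal:
  assumes "vector_space sc" "right_coideal X" "x \<in> X" "bil sc B" "bil sc B'" "\<And>a b. a \<in> X \<Longrightarrow> B a b = B' a b"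
  shows "sw B x = sw B' x"
  by (rule sw_cong_wedge[OF assms(1) right_coidealD(1)[OF assms(2)] subspace_single_0 assms(4,5,6)
        _ right_coideal_wedge[OF assms(2,3)]])
     (auto simp: bil_0[OF assms(4)] bil_0[OF assms(5)])

lemma sw_cong_left_coideal:
  assumes "vector_space sc" "left_coideal X" "x \<in> X" "bil sc B" "bil sc B'" "\<And>a b. b \<in> X \<Longrightarrow> B a b = B' a b"
  shows "sw B x = sw B' x"
  by (rule sw_cong_wedge[OF assms(1) subspace_single_0 left_coidealD(1)[OF assms(2)] assms(4,5)
        _ assms(6) left_coideal_wedge[OF assms(2,3)]])
     (auto simp: bil_0[OF assms(4)] bil_0[OF assms(5)])

lemma bil_comp: "bil sc B \<Longrightarrow> lin scale f \<Longrightarrow> lin scale g \<Longrightarrow> bil sc (\<lambda>a b. B (f a) (g b))"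
  by (auto simp: bil_def lin_def)

lemma lin_id: "lin scale (\<lambda>x. x)"
  by (simp add: lin_def)

text \<open>A projection onto \<open>D\<close> can be inserted in one leg at a time, since
  \<open>D\<close> is a coideal on either side; afterwards both legs lie in
  \<open>D\<close>.\<close>

lemma sw_cong_subcoalg:
  assumes sc: "vector_space sc" and D: "subcoalg D" "d \<in> D" and B: "bil sc B" "bil sc B'"
    and eq: "\<And>a b. a \<in> D \<Longrightarrow> b \<in> D \<Longrightarrow> B a b = B' a b"
  shows "sw B d = sw B' d"
proof -
  obtain p where p: "lin scale p" "\<And>x. p x \<in> D" "\<And>x. x \<in> D \<Longrightarrow> p x = x"
    by (rule projection_exists[OF subcoalgD(1)[OF D(1)]]) blast
  have *: "sw C d = sw (\<lambda>a b. C (p a) (p b)) d" if C: "bil sc C" for C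
  proof -
    have "sw C d = sw (\<lambda>a b. C (p a) b) d"
      by (rule sw_cong_right_coideal[OF sc subcoalgD(2)[OF D(1)] D(2) C bil_comp[OF C p(1) lin_id]])
        (simp add: p)
    also have "\<dots> = sw (\<lambda>a b. C (p a) (p b)) d"
      by (rule sw_cong_left_coideal[OF sc subcoalgD(3)[OF D(1)] D(2) bil_comp[OF C p(1) lin_id] bil_comp[OF C p(1) p(1)]])
        (simp add: p)
    finally show ?thesis .
  qed
  show ?thesis unfolding *[OF B(1)] *[OF B(2)] by (simp add: eq p(2))
qed

end

section \<open>Coideals and the coradical\<close>

context sweedler_coalgebra
begin

lemma conv_counit [simp]: "lin (*) k \<Longrightarrow> conv \<epsilon> k x = k x" "lin (*) k \<Longrightarrow> conv k \<epsilon> x = k x"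
  using functional_Lf[of k \<epsilon> x] functional_Rf[of k \<epsilon> x] by simp_all

lemma span_closed:
  assumes "lin scale h" "\<And>s. s \<in> S \<Longrightarrow> h s \<in> span S" "w \<in> span S"
  shows "h w \<in> span S"
  using assms(3)
proof (induction rule: span_induct)
  case base then show ?case using assms(1) by (auto simp: subspace_def lin_simps span_zero span_add span_scale)
next
  case (step x) then show ?case by (rule assms(2))
qed

lemma right_coideal_span:
  "(\<And>f s. lin (*) f \<Longrightarrow> s \<in> S \<Longrightarrow> Rf f s \<in> span S) \<Longrightarrow> right_coideal (span S)"
  unfolding right_coideal_def using span_closed[OF lin_Rf] by auto

lemma subcoalg_span:
  "(\<And>f s. lin (*) f \<Longrightarrow> s \<in> S \<Longrightarrow> Rf f s \<in> span S) \<Longrightarrow>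
   (\<And>f s. lin (*) f \<Longrightarrow> s \<in> S \<Longrightarrow> Lf f s \<in> span S) \<Longrightarrow> subcoalg (span S)"
  by (rule subcoalgI) (auto intro: span_closed[OF lin_Rf] span_closed[OF lin_Lf])

lemma subcoalg_Int: "subcoalg X \<Longrightarrow> subcoalg Y \<Longrightarrow> subcoalg (X \<inter> Y)"
  by (auto simp: subcoalg_def right_coideal_def left_coideal_def subspace_inter)

lemma right_coideal_sums:
  assumes "right_coideal X" "right_coideal Y" shows "right_coideal {x + y | x y. x \<in> X \<and> y \<in> Y}"
  unfolding right_coideal_def
proof (intro conjI allI impI ballI)
  show "subspace {x + y | x y. x \<in> X \<and> y \<in> Y}" using assms by (auto intro!: subspace_sums simp: right_coidealD)
  fix f w assume f: "lin (*) f" and "w \<in> {x + y | x y. x \<in> X \<and> y \<in> Y}"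
  then obtain x y where "w = x + y" "x \<in> X" "y \<in> Y" by auto
  then show "Rf f w \<in> {x + y | x y. x \<in> X \<and> y \<in> Y}"
    using assms f by (auto simp: lin_add[OF lin_Rf[OF f]] intro: right_coidealD)
qed

lemma subcoalg_span_Union: "(\<And>D. D \<in> \<D> \<Longrightarrow> subcoalg D) \<Longrightarrow> subcoalg (span (\<Union>\<D>))"
  by (rule subcoalg_span) (auto intro!: span_base intro: subcoalgD)

text \<open>Commuting with every \<open>Rf f\<close> is the form in which a map of right comodules
  appears here.\<close>

lemma right_coideal_preimage:
  assumes X: "right_coideal X" and M: "right_coideal M" and h: "lin scale h"
    and comm: "\<And>f x. lin (*) f \<Longrightarrow> Rf f (h x) = h (Rf f x)"
  shows "right_coideal {m \<in> M. h m \<in> X}"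
  unfolding right_coideal_def
proof (intro conjI allI impI ballI)
  show "subspace {m \<in> M. h m \<in> X}"
    using right_coidealD(1)[OF X] right_coidealD(1)[OF M] h
    by (auto simp: subspace_def lin_simps)
qed (use assms in \<open>auto simp: right_coidealD comm[symmetric]\<close>)

lemma right_coideal_image:
  assumes M: "right_coideal M" and h: "lin scale h"
    and comm: "\<And>f x. lin (*) f \<Longrightarrow> Rf f (h x) = h (Rf f x)"
  shows "right_coideal (h ` M)"
  unfolding right_coideal_def
proof (intro conjI allI impI ballI)
  interpret L: Vector_Spaces.linear scale scale h using h by (simp add: lin_iff_linear[OF vector_space_scale])
  show "subspace (h ` M)" by (rule L.subspace_image[OF right_coidealD(1)[OF M]])
qed (use assms in \<open>auto simp: right_coidealD comm\<close>)

section \<open>Simple subcoalgebras and simple coideals\<close>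

definition simple_subcoalg :: "'a set \<Rightarrow> bool"
  where "simple_subcoalg D \<longleftrightarrow> subcoalg D \<and> D \<noteq> {0} \<and> (\<forall>E. subcoalg E \<and> E \<subseteq> D \<longrightarrow> E = {0} \<or> E = D)"

definition corad :: "'a set"
  where "corad = span (\<Union>{D. simple_subcoalg D})"

definition simple_coideal :: "'a set \<Rightarrow> bool"
  where "simple_coideal M \<longleftrightarrow> right_coideal M \<and> M \<noteq> {0} \<and>
    (\<forall>Z. right_coideal Z \<and> Z \<subseteq> M \<longrightarrow> Z = {0} \<or> Z = M)"

lemma simple_subcoalgD: "simple_subcoalg D \<Longrightarrow> subcoalg D" "simple_subcoalg D \<Longrightarrow> D \<noteq> {0}"
  "simple_subcoalg D \<Longrightarrow> subcoalg E \<Longrightarrow> E \<subseteq> D \<Longrightarrow> E = {0} \<or> E = D"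
  by (auto simp: simple_subcoalg_def)

lemma simple_le_corad: "simple_subcoalg D \<Longrightarrow> D \<subseteq> corad"
  by (auto simp: corad_def intro: span_base)

lemma subcoalg_corad: "subcoalg corad"
  unfolding corad_def by (rule subcoalg_span_Union) (auto simp: simple_subcoalg_def)

lemma subspace_corad: "subspace corad"
  by (simp add: corad_def)

lemma corad_induct [consumes 1, case_names subspace simple]:
  assumes "x \<in> corad" "subspace {x. P x}" "\<And>C x. simple_subcoalg C \<Longrightarrow> x \<in> C \<Longrightarrow> P x"
  shows "P x"
  using assms(1) unfolding corad_def
  by (induction rule: span_induct) (use assms in auto)

lemma simple_eq: "simple_subcoalg C \<Longrightarrow> simple_subcoalg C' \<Longrightarrow> C' \<inter> C \<noteq> {0} \<Longrightarrow> C' = C"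
  using subcoalg_Int[of C' C] unfolding simple_subcoalg_def by (metis inf_le1 inf_le2)

lemma subspace_nonzero: "subspace W \<Longrightarrow> W \<noteq> {0} \<Longrightarrow> \<exists>w\<in>W. w \<noteq> 0"
  using subspace_0 by fastforce

text \<open>The coefficient space \<open>E\<close> of a simple coideal \<open>M\<close> is a sum of copies of \<open>M\<close>. If \<open>F\<close> is a nonzero
  subcoalgebra of \<open>E\<close> and \<open>W\<close> is a coideal maximal with \<open>W \<inter> F = 0\<close>, then some copy \<open>h M\<close> satisfies
  \<open>h M \<subseteq> W + F\<close> and \<open>h M \<inter> W = 0\<close>, so that functionals vanishing on \<open>F\<close> annihilate \<open>M\<close>.\<close>

lemma simple_coideal_in_simple_subcoalg:
  assumes M: "simple_coideal M"
  obtains E where "simple_subcoalg E" "M \<subseteq> E"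
proof -
  have rM: "right_coideal M" and M0: "M \<noteq> {0}"
    and Ms: "\<And>Z. right_coideal Z \<Longrightarrow> Z \<subseteq> M \<Longrightarrow> Z = {0} \<or> Z = M"
    using M by (auto simp: simple_coideal_def)
  define S where "S = {Lf g m | g m. lin (*) g \<and> m \<in> M}"
  define E where "E = span S"
  have sE: "subcoalg E" unfolding E_def
  proof (rule subcoalg_span)
    fix f s assume f: "lin (*) f" and "s \<in> S"
    then obtain g m where s: "s = Lf g m" "lin (*) g" "m \<in> M" by (auto simp: S_def)
    then show "Rf f s \<in> span S" "Lf f s \<in> span S" using f rM
      by (auto simp: Rf_Lf Lf_Lf S_def intro!: span_base intro: right_coidealD lin_conv)
  qed
  have ME: "M \<subseteq> E"
  proof
    fix m assume "m \<in> M"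
    then have "Lf \<epsilon> m \<in> S" unfolding S_def using lin_counit by blast
    then show "m \<in> E" unfolding E_def using span_base by simp
  qed
  have "F = E" if F: "subcoalg F" "F \<subseteq> E" "F \<noteq> {0}" for F
  proof -
    define \<W> where "\<W> = {W. right_coideal W \<and> W \<inter> F \<subseteq> {0}}"
    have "\<exists>W\<in>\<W>. \<forall>V\<in>\<W>. W \<subseteq> V \<longrightarrow> V = W"
    proof (rule subset_Zorn)
      fix c assume c: "subset.chain \<W> c"
      show "\<exists>U\<in>\<W>. \<forall>X\<in>c. X \<subseteq> U"
      proof (cases "c = {}")
        case True
        have "{0} \<in> \<W>" by (auto simp: \<W>_def right_coideal_def lin_0[OF lin_Rf])
        then show ?thesis using True by auto
      next
        case False
        have cW: "\<And>W. W \<in> c \<Longrightarrow> right_coideal W \<and> W \<inter> F \<subseteq> {0}" using c by (auto simp: \<W>_def subset_chain_def)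
        have "subspace (\<Union>c)" unfolding subspace_def
        proof (intro conjI ballI allI)
          show "0 \<in> \<Union>c" using False cW subspace_0 by (fastforce simp: right_coideal_def)
          fix x y assume "x \<in> \<Union>c" "y \<in> \<Union>c"
          then obtain W V where WV: "W \<in> c" "V \<in> c" "x \<in> W" "y \<in> V" by auto
          then have "W \<subseteq> V \<or> V \<subseteq> W" using c by (auto simp: subset_chain_def)
          then show "x + y \<in> \<Union>c" using WV cW subspace_add by (metis UnionI right_coidealD(1) subsetD)
        next
          fix r x assume "x \<in> \<Union>c" then show "scale r x \<in> \<Union>c"
            using cW subspace_scale by (meson Union_iff right_coidealD(1))
        qed
        then have "\<Union>c \<in> \<W>" using cW unfolding \<W>_def right_coideal_def by blast
        then show ?thesis by blast
      qed
    qed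
    then obtain W where W\<W>: "W \<in> \<W>" and Wmax\<W>: "\<forall>V\<in>\<W>. W \<subseteq> V \<longrightarrow> V = W" by (elim bexE)
    have W: "right_coideal W" "W \<inter> F \<subseteq> {0}" using W\<W> by (auto simp: \<W>_def)
    have Wmax: "V = W" if "right_coideal V" "V \<inter> F \<subseteq> {0}" "W \<subseteq> V" for V
      using Wmax\<W> that by (simp add: \<W>_def)
    have "\<not> S \<subseteq> W"
    proof
      assume "S \<subseteq> W"
      then have "E \<subseteq> W" unfolding E_def by (rule span_minimal) (rule right_coidealD(1)[OF W(1)])
      then have "F \<subseteq> {0}" using F(2) W(2) by blast
      then show False using F(3) subspace_0[OF subcoalgD(1)[OF F(1)]] by auto
    qed
    then obtain g m0 where g: "lin (*) g" "m0 \<in> M" "Lf g m0 \<notin> W" by (auto simp: S_def)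
    define h where "h = Lf g"
    have h: "lin scale h" and hR: "\<And>f x. lin (*) f \<Longrightarrow> Rf f (h x) = h (Rf f x)"
      unfolding h_def using g(1) by (auto simp: lin_Lf Rf_Lf)
    \<comment> \<open>The preimage of \<open>W\<close> in the simple coideal \<open>M\<close> is
      \<open>{0}\<close> or \<open>M\<close>, and \<open>m0\<close> rules out
      \<open>M\<close>.\<close>
    have hW: "m = 0" if "m \<in> M" "h m \<in> W" for m
      using Ms[OF right_coideal_preimage[OF W(1) rM h hR]] that g h_def by auto
    define V where "V = {x + y | x y. x \<in> W \<and> y \<in> h ` M}"
    have V: "right_coideal V" unfolding V_def by (rule right_coideal_sums[OF W(1) right_coideal_image[OF rM h hR]])
    have WV: "W \<subseteq> V" unfolding V_def
    proof
      fix w assume "w \<in> W"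
      moreover have "0 \<in> h ` M" using subspace_0[OF right_coidealD(1)[OF rM]] lin_0[OF h] by force
      moreover have "w = w + 0" by simp
      ultimately show "w \<in> {x + y | x y. x \<in> W \<and> y \<in> h ` M}" by blast
    qed
    have "Lf g m0 \<in> V" unfolding V_def h_def
      using g(2) subspace_0[OF right_coidealD(1)[OF W(1)]] by force
    then have "\<not> V \<inter> F \<subseteq> {0}" using Wmax[OF V _ WV] g(3) by blast
    then obtain u m where um: "u \<in> W" "m \<in> M" "u + h m \<in> F" "u + h m \<noteq> 0" unfolding V_def by blast
    define X where "X = {x + y | x y. x \<in> F \<and> y \<in> W}"
    have X: "right_coideal X" unfolding X_def by (rule right_coideal_sums[OF subcoalgD(2)[OF F(1)] W(1)])
    have "m \<noteq> 0" using um W(2) lin_0[OF h] by force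
    moreover have "h m \<in> X" unfolding X_def
    proof -
      have "h m = (u + h m) + (- u)" "- u \<in> W"
        using um(1) subspace_neg[OF right_coidealD(1)[OF W(1)]] by auto
      then show "h m \<in> {x + y | x y. x \<in> F \<and> y \<in> W}" using um(3) by blast
    qed
    ultimately have "{m \<in> M. h m \<in> X} \<noteq> {0}" using um(2) by blast
    then have hX: "h m \<in> X" if "m \<in> M" for m
      using Ms[OF right_coideal_preimage[OF X rM h hR]] that by blast
    have "M \<subseteq> F"
    proof
      fix m assume m: "m \<in> M"
      show "m \<in> F"
      proof (rule functional_mem[OF subcoalgD(1)[OF F(1)]])
        fix f assume f: "lin (*) f" "\<And>w. w \<in> F \<Longrightarrow> f w = 0"
        obtain x y where xy: "h m = x + y" "x \<in> F" "y \<in> W" using hX[OF m] by (auto simp: X_def)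
        \<comment> \<open>The second leg of \<open>x\<close> stays in \<open>F\<close>, where
          \<open>f\<close> vanishes. So only the part in \<open>W\<close> survives in
          \<open>h (Rf f m)\<close>, and \<open>hW\<close> forces \<open>Rf f m = 0\<close>.\<close>
        have "Rf f x = 0"
        proof (rule functional_eq_0)
          fix k assume "lin (*) k"
          then show "k (Rf f x) = 0"
            using f xy(2) subcoalgD(5)[OF F(1)] by (simp add: functional_Rf functional_Lf[symmetric])
        qed
        then have "h (Rf f m) = Rf f y"
          by (simp add: hR[OF f(1), symmetric] xy(1) lin_add[OF lin_Rf[OF f(1)]])
        then have "h (Rf f m) \<in> W" using xy(3) W(1) f(1) by (auto simp: right_coidealD)
        then have "Rf f m = 0" using hW m rM f(1) by (auto simp: right_coidealD)
        then have "\<epsilon> (Rf f m) = 0" using lin_0[OF lin_counit] by simp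
        then show "f m = 0" using f(1) lin_counit functional_Rf functional_Lf[OF f(1), of \<epsilon> m] by simp
      qed
    qed
    then have "S \<subseteq> F" unfolding S_def using subcoalgD(5)[OF F(1)] by blast
    then have "E \<subseteq> F" unfolding E_def by (rule span_minimal) (rule subcoalgD(1)[OF F(1)])
    then show ?thesis using F(2) by blast
  qed
  moreover have "E \<noteq> {0}" using ME M0 subspace_nonzero[OF right_coidealD(1)[OF rM]] by blast
  ultimately have "simple_subcoalg E" using sE unfolding simple_subcoalg_def by blast
  then show thesis using that ME by blast
qed

section \<open>Local finiteness and the socle\<close>

lemma Rf_in_span: "Rf f z \<in> span (fst ` set (cop z))"
  unfolding Rf_def sweedler_def
  by (rule subspace_sum_list[OF subspace_span]) (force intro!: span_scale[OF span_base])

lemma Lf_in_span: "Lf f z \<in> span (snd ` set (cop z))"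
  unfolding Lf_def sweedler_def
  by (rule subspace_sum_list[OF subspace_span]) (force intro!: span_scale[OF span_base])

lemma finite_right_coideal:
  obtains U T where "right_coideal U" "z \<in> U" "finite T" "U \<subseteq> span T" "\<And>W. right_coideal W \<Longrightarrow> z \<in> W \<Longrightarrow> U \<subseteq> W"
proof
  let ?S = "{Rf f z | f. lin (*) f}"
  show "right_coideal (span ?S)"
    by (rule right_coideal_span) (auto intro!: span_base simp: Rf_Rf intro: lin_conv)
  have "Rf \<epsilon> z \<in> ?S" using lin_counit by blast
  then show "z \<in> span ?S" using span_base by simp
  show "finite (fst ` set (cop z))" by simp
  show "span ?S \<subseteq> span (fst ` set (cop z))" by (rule span_minimal) (auto simp: Rf_in_span)
  show "span ?S \<subseteq> W" if "right_coideal W" "z \<in> W" for W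
    by (rule span_minimal) (use that in \<open>auto intro: right_coidealD\<close>)
qed

text \<open>The elements \<open>Lf g (Rf f z) = g(z_1) z_2 f(z_3)\<close> span a subcoalgebra
  because the two actions commute and compose. They are combinations of middle legs of the iterated
  coproduct of \<open>z\<close>, of which \<open>?T\<close> lists finitely many.\<close>

lemma finite_subcoalg:
  obtains D A where "subcoalg D" "z \<in> D" "finite A" "D = span A" "A \<subseteq> D"
    "\<And>W. subcoalg W \<Longrightarrow> z \<in> W \<Longrightarrow> D \<subseteq> W"
proof -
  let ?S = "{Lf g (Rf f z) | f g. lin (*) f \<and> lin (*) g}"
  let ?T = "\<Union>a \<in> fst ` set (cop z). snd ` set (cop a)"
  have D: "subcoalg (span ?S)"
  proof (rule subcoalg_span; rule span_base)
    fix h s assume h: "lin (*) h" and "s \<in> ?S"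
    then obtain f g where s: "s = Lf g (Rf f z)" and fg: "lin (*) f" "lin (*) g" by blast
    have "Rf h s = Lf g (Rf (conv h f) z)" "Lf h s = Lf (conv g h) (Rf f z)"
      using h fg by (simp_all add: s Rf_Lf Rf_Rf Lf_Lf)
    then show "Rf h s \<in> ?S" "Lf h s \<in> ?S" using lin_conv h fg by blast+
  qed
  have "Lf \<epsilon> (Rf \<epsilon> z) \<in> ?S" using lin_counit by blast
  then have z: "z \<in> span ?S" using span_base by simp
  have "Lf g (Rf f z) \<in> span ?T" if g: "lin (*) g" for f g
    using Rf_in_span[of f z]
  proof (induction rule: span_induct)
    case base show ?case using lin_Lf[OF g] by (auto simp: subspace_def lin_simps span_zero span_add span_scale)
  next
    case (step a) then show ?case using Lf_in_span[of g a] span_mono[of "snd ` set (cop a)" ?T] by blast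
  qed
  then have "span ?S \<subseteq> span ?T" by (intro span_minimal) auto
  then obtain A where A: "finite A" "span ?S = span A" "A \<subseteq> span ?S"
    by (rule finite_span_subspace[rotated 2]) auto
  have "span ?S \<subseteq> W" if "subcoalg W" "z \<in> W" for W
    by (rule span_minimal) (use that in \<open>auto intro: subcoalgD\<close>)
  then show thesis using that D z A by metis
qed

text \<open>A simple subcoalgebra is generated by any of its nonzero elements.\<close>

lemma simple_subcoalg_finite:
  assumes "simple_subcoalg C" obtains A where "finite A" "C = span A" "A \<subseteq> C"
proof -
  obtain c where c: "c \<in> C" "c \<noteq> 0" using subspace_nonzero assms subcoalgD(1) simple_subcoalgD by metis
  obtain D A where D: "subcoalg D" "c \<in> D" "finite A" "D = span A" "A \<subseteq> D"
    "\<And>W. subcoalg W \<Longrightarrow> c \<in> W \<Longrightarrow> D \<subseteq> W" by (rule finite_subcoalg) blast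
  have "D \<subseteq> C" using D(6) c(1) simple_subcoalgD[OF assms] by blast
  then have "D = C" using simple_subcoalgD(3)[OF assms D(1)] D(2) c(2) by blast
  then show thesis using that D by blast
qed

text \<open>A minimal coideal that is not contained in \<open>X\<close> has a simple image under \<open>f(x\<^sub>1) x\<^sub>2\<close> for every
  functional \<open>f\<close> vanishing on \<open>X\<close>. This is the socle of the quotient comodule by \<open>X\<close>.\<close>

lemma wedge_corad_exists:
  assumes X: "right_coideal X" and D: "right_coideal D" and DX: "\<not> D \<subseteq> X"
  obtains y where "y \<in> D" "y \<notin> X" "y \<in> wedge X corad"
proof -
  obtain z where z: "z \<in> D" "z \<notin> X" using DX by blast
  obtain U T where U: "right_coideal U" "z \<in> U" "finite T" "U \<subseteq> span T"
    "\<And>W. right_coideal W \<Longrightarrow> z \<in> W \<Longrightarrow> U \<subseteq> W" by (rule finite_right_coideal) blast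
  \<comment> \<open>Inside the finite-dimensional \<open>U\<close>, least dimension yields a minimal
    coideal outside \<open>X\<close>.\<close>
  define P where "P W \<longleftrightarrow> right_coideal W \<and> W \<subseteq> U \<and> \<not> W \<subseteq> X" for W
  have "P U" using U z unfolding P_def by blast
  from ex_has_least_nat[of P U dim, OF this]
  obtain W where W: "P W" and Wmin: "\<And>V. P V \<Longrightarrow> dim W \<le> dim V" by blast
  have rW: "right_coideal W" and WT: "W \<subseteq> span T" and WX: "\<not> W \<subseteq> X" and WD: "W \<subseteq> D"
    using W U D z unfolding P_def by blast+
  have min: "V = W" if "right_coideal V" "V \<subseteq> W" "\<not> V \<subseteq> X" for V
  proof (rule ccontr)
    assume "V \<noteq> W"
    then have "dim V < dim W" using dim_psubset_finite[OF U(3) WT right_coidealD(1)] that by blast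
    moreover have "P V" using that W unfolding P_def by blast
    ultimately show False using Wmin by fastforce
  qed
  obtain y where y: "y \<in> W" "y \<notin> X" using WX by blast
  have "Lf f y \<in> corad" if f: "lin (*) f" "\<forall>x\<in>X. f x = 0" for f
  proof (cases "Lf f ` W = {0}")
    case True then have "Lf f y = 0" using y(1) by blast
    then show ?thesis by (simp add: subspace_0 subspace_corad)
  next
    case False
    note com = Rf_Lf[OF _ f(1)]
    \<comment> \<open>Since \<open>Lf f\<close> kills \<open>X\<close>, a coideal inside the image
      of \<open>W\<close> pulls back either into \<open>X\<close>, and is then zero, or to all of
      \<open>W\<close> by minimality.\<close>
    have LX: "Lf f x = 0" if "x \<in> X" for x
    proof (rule functional_eq_0)
      fix k assume "lin (*) k"
      then show "k (Lf f x) = 0"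
        using f that X by (simp add: functional_Lf functional_Rf[symmetric] right_coidealD)
    qed
    have "simple_coideal (Lf f ` W)" unfolding simple_coideal_def
    proof (intro conjI allI impI)
      show "right_coideal (Lf f ` W)" by (rule right_coideal_image[OF rW lin_Lf[OF f(1)] com])
      fix Z assume Z: "right_coideal Z \<and> Z \<subseteq> Lf f ` W"
      define V where "V = {w \<in> W. Lf f w \<in> Z}"
      have V: "right_coideal V" unfolding V_def
        by (rule right_coideal_preimage[OF _ rW lin_Lf[OF f(1)] com]) (use Z in auto)
      have LV: "Z = Lf f ` V" using Z unfolding V_def by auto
      show "Z = {0} \<or> Z = Lf f ` W"
      proof (cases "V \<subseteq> X")
        case True
        then have "Z \<subseteq> {0}" using LV LX by auto
        then show ?thesis using Z subspace_0 right_coidealD(1) by blast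
      next
        case False then have "V = W" using min[OF V] V_def by auto
        then show ?thesis using LV by simp
      qed
    qed (rule False)
    then obtain E where "simple_subcoalg E" "Lf f ` W \<subseteq> E" by (rule simple_coideal_in_simple_subcoalg)
    then show ?thesis using simple_le_corad y(1) by blast
  qed
  then have "y \<in> wedge X corad" unfolding wedge_def by (auto simp: functional_Lf[symmetric])
  then show thesis using that y WD by blast
qed

section \<open>Independence of simple subcoalgebras\<close>

lemma subcoalg_sums:
  assumes "subcoalg D" "subcoalg E" shows "subcoalg {x + y | x y. x \<in> D \<and> y \<in> E}"
proof -
  have "{x + y | x y. x \<in> D \<and> y \<in> E} = span (\<Union>{D, E})"
    using span_Un[of D E] subcoalgD(1)[OF assms(1)] subcoalgD(1)[OF assms(2)]
    by (auto simp: span_eq_iff[THEN iffD2])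
  then show ?thesis using subcoalg_span_Union[of "{D, E}"] assms by auto
qed

text \<open>If \<open>C\<close> meets \<open>E\<close> trivially, a functional \<open>f\<close> that
  is the counit on \<open>C\<close> and zero on \<open>E\<close> makes \<open>Lf f\<close> the
  identity on \<open>C\<close> and zero on \<open>E\<close>. Applied to \<open>c = d + e\<close>
  this gives \<open>c = Lf f d\<close>, an element of \<open>D\<close>.\<close>

lemma simple_le_sums:
  assumes C: "simple_subcoalg C" and D: "subcoalg D" and E: "subcoalg E"
    and sub: "C \<subseteq> {x + y | x y. x \<in> D \<and> y \<in> E}"
  shows "C \<subseteq> D \<or> C \<subseteq> E"
proof (rule disjCI)
  assume "\<not> C \<subseteq> E"
  then have "E \<inter> C = {0}" using simple_subcoalgD(3)[OF C subcoalg_Int[OF E simple_subcoalgD(1)[OF C]]] by blast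
  then obtain f where f: "lin (*) f" "\<And>c. c \<in> C \<Longrightarrow> f c = \<epsilon> c" "\<And>e. e \<in> E \<Longrightarrow> f e = 0"
    using functional_exists[OF subcoalgD(1)[OF E] subcoalgD(1)[OF simple_subcoalgD(1)[OF C]] _ lin_counit] by blast
  show "C \<subseteq> D"
  proof
    fix c assume c: "c \<in> C"
    obtain d e where de: "c = d + e" "d \<in> D" "e \<in> E" using sub c by blast
    have Lc: "Lf f c = Lf \<epsilon> c"
    proof (rule functional_eq)
      fix k assume k: "lin (*) k"
      then show "k (Lf f c) = k (Lf \<epsilon> c)"
        using f c subcoalgD(4)[OF simple_subcoalgD(1)[OF C] k c]
          functional_Rf[OF f(1), of k c] functional_Rf[OF lin_counit, of k c]
        by (simp add: functional_Lf del: Lf_counit)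
    qed
    have Le: "Lf f e = 0"
    proof (rule functional_eq_0)
      fix k assume k: "lin (*) k"
      then show "k (Lf f e) = 0"
        using f de(3) subcoalgD(4)[OF E] by (simp add: functional_Lf functional_Rf[symmetric])
    qed
    have "c = Lf f d" using Lc Le de(1) lin_add[OF lin_Lf[OF f(1)], of d e] by simp
    then show "c \<in> D" using de(2) f(1) subcoalgD(5)[OF D] by simp
  qed
qed

text \<open>Induction by absorbing one member \<open>C\<close> into \<open>K\<close>. By
  \<open>simple_le_sums\<close> a remaining member inside \<open>K + C\<close> would lie in
  \<open>K\<close> or equal \<open>C\<close>.\<close>

lemma simple_subcoalgs_independent:
  assumes "finite \<C>" "subcoalg K" "\<And>C. C \<in> \<C> \<Longrightarrow> simple_subcoalg C \<and> \<not> C \<subseteq> K"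
  shows "K \<inter> span (\<Union>\<C>) \<subseteq> {0}"
  using assms
proof (induction arbitrary: K rule: finite_induct)
  case empty then show ?case by simp
next
  case (insert C \<C>)
  have C: "simple_subcoalg C" "\<not> C \<subseteq> K" using insert by auto
  define K' where "K' = {x + y | x y. x \<in> K \<and> y \<in> C}"
  have K': "subcoalg K'" unfolding K'_def by (rule subcoalg_sums) (use insert C in \<open>auto simp: simple_subcoalgD\<close>)
  have "simple_subcoalg C' \<and> \<not> C' \<subseteq> K'" if C': "C' \<in> \<C>" for C'
  proof
    show s: "simple_subcoalg C'" using insert C' by auto
    show "\<not> C' \<subseteq> K'"
    proof
      assume "C' \<subseteq> K'"
      then have "C' \<subseteq> C" using simple_le_sums[OF s insert.prems(1) simple_subcoalgD(1)[OF C(1)]]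
          insert.prems(2) C' unfolding K'_def by blast
      then have "C' = C" using simple_subcoalgD[OF s] simple_subcoalgD(3)[OF C(1)] by blast
      then show False using insert.hyps C' by blast
    qed
  qed
  then have IH: "K' \<inter> span (\<Union>\<C>) \<subseteq> {0}" by (rule insert.IH[OF K'])
  show ?case
  proof
    fix x assume x: "x \<in> K \<inter> span (\<Union>(insert C \<C>))"
    have "span (\<Union>(insert C \<C>)) = {c + y | c y. c \<in> C \<and> y \<in> span (\<Union>\<C>)}"
      using span_Un[of C "\<Union>\<C>"] span_eq_iff[THEN iffD2, OF subcoalgD(1)[OF simple_subcoalgD(1)[OF C(1)]]] by simp
    then obtain c y where cy: "x = c + y" "c \<in> C" "y \<in> span (\<Union>\<C>)" using x by auto
    have "y = x + (- c)" using cy by simp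
    moreover have "- c \<in> C" using cy(2) subspace_neg subcoalgD(1) simple_subcoalgD(1)[OF C(1)] by blast
    ultimately have "y \<in> K'" unfolding K'_def using x by blast
    then have "y = 0" using IH cy(3) by blast
    then have "x \<in> K \<inter> C" using cy x by simp
    moreover have "K \<inter> C = {0}"
      using simple_subcoalgD(3)[OF C(1) subcoalg_Int[OF insert.prems(1) simple_subcoalgD(1)[OF C(1)]]] C(2) by blast
    ultimately show "x \<in> {0}" by blast
  qed
qed

text \<open>The operator \<open>Lf e\<close> will project the coradical into \<open>K\<close> along
  the simple subcoalgebras outside \<open>K\<close>. For \<open>K\<close> spanned by the unit,
  \<open>e\<close> is an invariant functional on the coradical.\<close>

lemma counit_cutoff:
  assumes K: "subcoalg K"
  obtains e where "lin (*) e" "\<And>x. x \<in> K \<Longrightarrow> e x = \<epsilon> x"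
    "\<And>C x. simple_subcoalg C \<Longrightarrow> \<not> C \<subseteq> K \<Longrightarrow> x \<in> C \<Longrightarrow> e x = 0"
proof -
  define \<C> where "\<C> = {C. simple_subcoalg C \<and> \<not> C \<subseteq> K}"
  \<comment> \<open>Independence is known for finite families only, and each element of the span
    involves finitely many members.\<close>
  have fin: "\<exists>\<F>. finite \<F> \<and> \<F> \<subseteq> \<C> \<and> x \<in> span (\<Union>\<F>)" if "x \<in> span (\<Union>\<C>)" for x
    using that
  proof (induction rule: span_induct)
    case base
    show ?case unfolding subspace_def
    proof (intro conjI ballI allI)
      show "0 \<in> {x. \<exists>\<F>. finite \<F> \<and> \<F> \<subseteq> \<C> \<and> x \<in> span (\<Union>\<F>)}" by (auto intro!: exI[of _ "{}"])
      fix x y assume "x \<in> {x. \<exists>\<F>. finite \<F> \<and> \<F> \<subseteq> \<C> \<and> x \<in> span (\<Union>\<F>)}"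
        "y \<in> {x. \<exists>\<F>. finite \<F> \<and> \<F> \<subseteq> \<C> \<and> x \<in> span (\<Union>\<F>)}"
      then obtain F G where FG: "finite F" "F \<subseteq> \<C>" "x \<in> span (\<Union>F)" "finite G" "G \<subseteq> \<C>" "y \<in> span (\<Union>G)" by auto
      have "x + y \<in> span (\<Union>(F \<union> G))"
        using FG(3,6) span_mono[of "\<Union>F" "\<Union>(F \<union> G)"] span_mono[of "\<Union>G" "\<Union>(F \<union> G)"]
        by (intro span_add) auto
      then show "x + y \<in> {x. \<exists>\<F>. finite \<F> \<and> \<F> \<subseteq> \<C> \<and> x \<in> span (\<Union>\<F>)}"
        using FG by (auto intro!: exI[of _ "F \<union> G"])
    qed (auto intro: span_scale)
  next
    case (step x)
    then obtain C where "C \<in> \<C>" "x \<in> C" by auto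
    then show ?case by (intro exI[of _ "{C}"]) (auto intro: span_base)
  qed
  have "K \<inter> span (\<Union>\<C>) \<subseteq> {0}"
  proof
    fix x assume x: "x \<in> K \<inter> span (\<Union>\<C>)"
    then obtain \<F> where "finite \<F>" "\<F> \<subseteq> \<C>" "x \<in> span (\<Union>\<F>)" using fin by blast
    then show "x \<in> {0}" using simple_subcoalgs_independent[of \<F> K] K x unfolding \<C>_def by blast
  qed
  then obtain e where e: "lin (*) e" "\<And>x. x \<in> K \<Longrightarrow> e x = \<epsilon> x" "\<And>x. x \<in> span (\<Union>\<C>) \<Longrightarrow> e x = 0"
    using functional_exists[OF subspace_span subcoalgD(1)[OF K] _ lin_counit] by blast
  show thesis by (rule that[OF e(1,2)], assumption, rule e(3), rule span_base) (auto simp: \<C>_def)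
qed

end

section \<open>The antipode\<close>

text \<open>The product is a parameter on an abelian group instead of the multiplication of a ring
  type, so that the opposite algebra is an instance on the same type.\<close>

locale sweedler_hopf = sweedler_coalgebra scale cop \<epsilon>
  for scale :: "'k::field \<Rightarrow> 'a::ab_group_add \<Rightarrow> 'a" and cop :: "'a \<Rightarrow> ('a \<times> 'a) list" and \<epsilon> :: "'a \<Rightarrow> 'k" +
  fixes mul :: "'a \<Rightarrow> 'a \<Rightarrow> 'a" (infixl "\<odot>" 70) and one :: 'a and S :: "'a \<Rightarrow> 'a"
  assumes mul_add_left: "(x + y) \<odot> z = x \<odot> z + y \<odot> z"
    and mul_add_right: "z \<odot> (x + y) = z \<odot> x + z \<odot> y"
    and mul_scale_left: "scale c x \<odot> y = scale c (x \<odot> y)"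
    and mul_scale_right: "x \<odot> scale c y = scale c (x \<odot> y)"
    and mul_assoc: "x \<odot> y \<odot> z = x \<odot> (y \<odot> z)"
    and mul_one_left [simp]: "one \<odot> x = x"
    and mul_one_right [simp]: "x \<odot> one = x"
    and cop_one: "lin (*) f \<Longrightarrow> lin (*) g \<Longrightarrow> sw (\<lambda>a b. f a * g b) one = f one * g one"
    and cop_mul: "lin (*) f \<Longrightarrow> lin (*) g \<Longrightarrow>
      sw (\<lambda>a b. f a * g b) (x \<odot> y) = sw (\<lambda>a b. sw (\<lambda>c d. f (a \<odot> c) * g (b \<odot> d)) y) x"
    and counit_one [simp]: "\<epsilon> one = 1"
    and counit_mul: "\<epsilon> (x \<odot> y) = \<epsilon> x * \<epsilon> y"
    and lin_antipode: "lin scale S"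
    and antipode_left: "sw (\<lambda>a b. S a \<odot> b) x = scale (\<epsilon> x) one"
    and antipode_right: "sw (\<lambda>a b. a \<odot> S b) x = scale (\<epsilon> x) one"
begin

lemma lin_mul_left: "lin scale (\<lambda>x. x \<odot> y)" and lin_mul_right: "lin scale (\<lambda>x. y \<odot> x)"
  by (simp_all add: lin_def mul_add_left mul_add_right mul_scale_left mul_scale_right)

lemmas mul_simps = lin_simps[OF lin_mul_left] lin_simps[OF lin_mul_right]
lemmas S_simps = lin_simps[OF lin_antipode]
lemmas counit_simps = lin_simps[OF lin_counit]

lemma lin_comp: "lin sc f \<Longrightarrow> lin scale g \<Longrightarrow> lin sc (\<lambda>x. f (g x))"
  by (simp add: lin_def)

lemma sw_one: assumes sc: "vector_space sc" and B: "bil sc B" shows "sw B one = B one one"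
proof -
  have "(\<Sum>(a, b)\<leftarrow>cop one @ [(- one, one)]. B a b) = 0"
  proof (rule pair_list_eq_0'[OF sc B])
    fix f g assume fg: "lin (*) f" "lin (*) g"
    then show "(\<Sum>(a, b)\<leftarrow>cop one @ [(- one, one)]. f a * g b) = 0"
      using cop_one[OF fg] by (simp add: sweedler_def lin_minus)
  qed
  then show ?thesis by (simp add: sweedler_def lin_minus[OF bil_lin1[OF B]])
qed

lemma sw_mul:
  assumes sc: "vector_space sc" and B: "bil sc B"
  shows "sw B (x \<odot> y) = sw (\<lambda>a b. sw (\<lambda>c d. B (a \<odot> c) (b \<odot> d)) y) x"
proof -
  \<comment> \<open>The list represents minus the product of \<open>\<Delta> x\<close> and
    \<open>\<Delta> y\<close>.\<close>
  define l where "l = concat (map (\<lambda>(a, b). map (\<lambda>(c, d). (- (a \<odot> c), b \<odot> d)) (cop y)) (cop x))"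
  have l: "(\<Sum>(a, b)\<leftarrow>l. U a b) = - sw (\<lambda>a b. sw (\<lambda>c d. U (a \<odot> c) (b \<odot> d)) y) x"
    if U: "\<And>a b. U (- a) b = - U a b" for U :: "'a \<Rightarrow> 'a \<Rightarrow> 'w::ab_group_add"
  proof -
    have m: "(\<Sum>(c, d)\<leftarrow>l. - U (a \<odot> c) (b \<odot> d)) = - (\<Sum>(c, d)\<leftarrow>l. U (a \<odot> c) (b \<odot> d))" for l a b
      by (induction l) auto
    have "(\<Sum>(a, b)\<leftarrow>concat (map (\<lambda>(a, b). map (\<lambda>(c, d). (- (a \<odot> c), b \<odot> d)) (cop y)) l). U a b) =
        - (\<Sum>(a, b)\<leftarrow>l. sw (\<lambda>c d. U (a \<odot> c) (b \<odot> d)) y)" for l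
      using m by (induction l) (auto simp: sweedler_def case_prod_unfold comp_def U)
    then show ?thesis by (simp add: l_def sweedler_def)
  qed
  have "(\<Sum>(a, b)\<leftarrow>cop (x \<odot> y) @ l. B a b) = 0"
  proof (rule pair_list_eq_0'[OF sc B])
    fix f g assume fg: "lin (*) f" "lin (*) g"
    have "(\<Sum>(a, b)\<leftarrow>l. f a * g b) = - sw (\<lambda>a b. sw (\<lambda>c d. f (a \<odot> c) * g (b \<odot> d)) y) x"
      by (rule l) (simp add: lin_minus[OF fg(1)])
    then show "(\<Sum>(a, b)\<leftarrow>cop (x \<odot> y) @ l. f a * g b) = 0"
      using cop_mul[OF fg, of x y] by (simp add: sweedler_def)
  qed
  moreover have "(\<Sum>(a, b)\<leftarrow>l. B a b) = - sw (\<lambda>a b. sw (\<lambda>c d. B (a \<odot> c) (b \<odot> d)) y) x"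
    by (rule l) (rule lin_minus[OF bil_lin1[OF B]])
  ultimately show ?thesis by (simp add: sweedler_def)
qed

lemma bil_mul: "lin scale f \<Longrightarrow> lin scale g \<Longrightarrow> bil scale (\<lambda>a b. f a \<odot> g b)"
  by (rule bilI) (simp_all add: lin_simps mul_simps)

lemma S_one [simp]: "S one = one"
  using antipode_left[of one] sw_one[OF vector_space_scale bil_mul[OF lin_antipode lin_id]] by simp

lemma counit_S [simp]: "\<epsilon> (S x) = \<epsilon> x"
proof -
  have "\<epsilon> (sw (\<lambda>a b. S a \<odot> b) x) = \<epsilon> (S x)"
    unfolding sw_lin[OF lin_counit] counit_mul
    using counit_right[OF lin_comp[OF lin_counit lin_antipode], of x] by (simp add: mult.commute)
  then show ?thesis by (simp add: antipode_left counit_simps)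
qed

text \<open>In \<open>B y_1 (y_2 S(y_3))\<close> coassociativity brings the last two legs together,
  where the antipode axiom collapses them to the counit. Read backwards, the rule inserts such a
  pair.\<close>

lemma antipode_cancel_right:
  assumes sc: "vector_space sc" and B: "bil sc B"
  shows "sw (\<lambda>b d. sw (\<lambda>u v. B u (v \<odot> S d)) b) y = B y one"
    and "sw (\<lambda>b d. sw (\<lambda>u v. B u (S v \<odot> d)) b) y = B y one"
proof -
  have "tri sc (\<lambda>u v d. B u (v \<odot> S d))" "tri sc (\<lambda>u v d. B u (S v \<odot> d))"
    by (rule triI; simp add: bil_simps[OF B] mul_simps S_simps)+
  note c = this[THEN coassoc[OF sc]]
  have e: "sw (\<lambda>u v. B b (C u v)) d = B b (sw C d)" for b d C
    by (rule sw_lin[OF bil_lin2[OF B], symmetric])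
  have k: "sw (\<lambda>b d. sc (\<epsilon> d) (B b one)) y = B y one" by (rule counit_right[OF bil_lin1[OF B]])
  show "sw (\<lambda>b d. sw (\<lambda>u v. B u (v \<odot> S d)) b) y = B y one"
    unfolding c e antipode_right by (simp add: bil_simps[OF B] k)
  show "sw (\<lambda>b d. sw (\<lambda>u v. B u (S v \<odot> d)) b) y = B y one"
    unfolding c e antipode_left by (simp add: bil_simps[OF B] k)
qed

lemma antipode_cancel_left:
  assumes B: "bil sc B"
  shows "sw (\<lambda>b d. sw (\<lambda>u v. B (u \<odot> S v) d) b) y = B one y"
    and "sw (\<lambda>b d. sw (\<lambda>u v. B (S u \<odot> v) d) b) y = B one y"
proof -
  have e: "sw (\<lambda>u v. B (C u v) d) b = B (sw C b) d" for b d C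
    by (rule sw_lin[OF bil_lin1[OF B], symmetric])
  have k: "sw (\<lambda>b d. sc (\<epsilon> b) (B one d)) y = B one y" by (rule counit_left[OF bil_lin2[OF B]])
  show "sw (\<lambda>b d. sw (\<lambda>u v. B (u \<odot> S v) d) b) y = B one y"
    unfolding e antipode_right by (simp add: bil_simps[OF B] k)
  show "sw (\<lambda>b d. sw (\<lambda>u v. B (S u \<odot> v) d) b) y = B one y"
    unfolding e antipode_left by (simp add: bil_simps[OF B] k)
qed

text \<open>Both sides are convolution inverses of the product map. Accordingly
  \<open>S(x_1 y_1) x_2 y_2\<close> is inserted in front of \<open>S(y_3) S(x_3)\<close>; then the
  legs of \<open>y\<close> cancel, and after them those of \<open>x\<close>.\<close>

lemma S_mul: "S (x \<odot> y) = S y \<odot> S x"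
proof -
  have "S y \<odot> S x = sw (\<lambda>a c. scale (\<epsilon> a) (S y \<odot> S c)) x"
    by (rule counit_left[symmetric], rule lin_comp[OF lin_mul_right lin_antipode])
  also have "\<dots> = sw (\<lambda>a c. scale (\<epsilon> a) (sw (\<lambda>b d. scale (\<epsilon> b) (S d)) y \<odot> S c)) x"
    by (simp add: counit_left[OF lin_antipode])
  also have "\<dots> = sw (\<lambda>a c. sw (\<lambda>b d. sw (\<lambda>p q. S p \<odot> q) (a \<odot> b) \<odot> (S d \<odot> S c)) y) x"
    unfolding antipode_left counit_mul
    by (simp add: sw_lin[OF lin_mul_left] mul_simps sw_scale[symmetric])
  also have "\<dots> = sw (\<lambda>a c. sw (\<lambda>b d. sw (\<lambda>p q. sw (\<lambda>u v.
      S (p \<odot> u) \<odot> q \<odot> (v \<odot> S d) \<odot> S c) b) a) y) x"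
    unfolding sw_mul[OF vector_space_scale bil_mul[OF lin_antipode lin_id]] sw_lin[OF lin_mul_left]
    by (simp add: mul_assoc)
  also have "\<dots> = sw (\<lambda>a c. sw (\<lambda>p q. sw (\<lambda>b d. sw (\<lambda>u v.
      S (p \<odot> u) \<odot> q \<odot> (v \<odot> S d) \<odot> S c) b) y) a) x"
    by (subst (1) sw_swap) simp
  also have "\<dots> = sw (\<lambda>a c. sw (\<lambda>p q. S (p \<odot> y) \<odot> q \<odot> one \<odot> S c) a) x"
  proof -
    have b: "bil scale (\<lambda>u m. S (p \<odot> u) \<odot> q \<odot> m \<odot> S c)" for p q c
      by (rule bilI) (simp_all add: mul_simps S_simps)
    show ?thesis by (simp only: antipode_cancel_right(1)[OF vector_space_scale b])
  qed
  also have "\<dots> = sw (\<lambda>a c. sw (\<lambda>p q. S (p \<odot> y) \<odot> (q \<odot> S c)) a) x" by (simp add: mul_assoc)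
  also have "\<dots> = S (x \<odot> y) \<odot> one"
  proof (rule antipode_cancel_right(1)[OF vector_space_scale])
    show "bil scale (\<lambda>u m. S (u \<odot> y) \<odot> m)" by (rule bilI) (simp_all add: mul_simps S_simps)
  qed
  finally show ?thesis by simp
qed

text \<open>The map \<open>r \<mapsto> S(r_2) \<otimes> S(r_1)\<close> is a right convolution
  inverse of the coproduct, read through \<open>f \<otimes> g\<close>. In
  \<open>f(r_1 S(r_4)) g(r_2 S(r_3))\<close> the inner pair collapses first.\<close>

lemma antipode_comult_aux:
  assumes f: "lin (*) f" and g: "lin (*) g"
  shows "sw (\<lambda>q b. sw (\<lambda>m n. sw (\<lambda>c d. f (m \<odot> S d) * g (n \<odot> S c)) b) q) r = \<epsilon> r * (f one * g one)"
proof -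
  note simps = lin_simps[OF f] lin_simps[OF g] mul_simps S_simps algebra_simps
  have "tri (*) (\<lambda>n c d. f (m \<odot> S d) * g (n \<odot> S c))" for m
    by (rule triI) (simp_all add: simps)
  note t1 = this
  have b1: "bil (*) (\<lambda>c d. f (m \<odot> S d) * g (n \<odot> S c))" for m n
    by (rule bilI) (simp_all add: simps)
  have "tri (*) (\<lambda>m n b. sw (\<lambda>c d. f (m \<odot> S d) * g (n \<odot> S c)) b)"
    by (rule triI) (simp_all add: simps sw_funs lin_simps[OF lin_sw[OF vector_space_field b1], simplified simps])
  from coassoc[OF vector_space_field this, of r]
  have "sw (\<lambda>q b. sw (\<lambda>m n. sw (\<lambda>c d. f (m \<odot> S d) * g (n \<odot> S c)) b) q) r =
    sw (\<lambda>m q. sw (\<lambda>n b. sw (\<lambda>c d. f (m \<odot> S d) * g (n \<odot> S c)) b) q) r" .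
  also have "\<dots> = sw (\<lambda>m q. sw (\<lambda>h d. sw (\<lambda>n c. f (m \<odot> S d) * g (n \<odot> S c)) h) q) r"
    by (simp only: coassoc[OF vector_space_field t1])
  also have "\<dots> = sw (\<lambda>m q. f (m \<odot> S q) * g one) r"
  proof -
    have b: "bil (*) (\<lambda>z d. f (m \<odot> S d) * g z)" for m by (rule bilI) (simp_all add: simps)
    show ?thesis by (simp only: antipode_cancel_left(1)[OF b, abs_def])
  qed
  also have "\<dots> = f (sw (\<lambda>m q. m \<odot> S q) r) * g one"
    by (simp add: sw_lin[OF f] mult.commute[of _ "g one"] sw_funs)
  finally show ?thesis by (simp add: antipode_right lin_simps[OF f])
qed

text \<open>Dual to \<open>S_mul\<close>: both sides are convolution inverses of the
  coproduct.\<close>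

lemma antipode_comult:
  assumes f: "lin (*) f" and g: "lin (*) g"
  shows "sw (\<lambda>a b. f a * g b) (S x) = sw (\<lambda>a b. f (S b) * g (S a)) x"
proof -
  note simps = lin_simps[OF f] lin_simps[OF g] mul_simps S_simps algebra_simps
  note fld = vector_space_field
  \<comment> \<open>\<open>P p q b\<close> below is the product of \<open>\<Delta> (S p)\<close>,
    \<open>\<Delta> q\<close> and \<open>S(b_2) \<otimes> S(b_1)\<close>, read through
    \<open>f \<otimes> g\<close>. Its two bracketings over the legs of \<open>x\<close> give the two
    sides.\<close>
  define G where "G s t m n b = sw (\<lambda>c d. f (s \<odot> m \<odot> S d) * g (t \<odot> n \<odot> S c)) b" for s t m n b
  define P where "P p q b = sw (\<lambda>s t. sw (\<lambda>m n. G s t m n b) q) (S p)" for p q b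
  have Gadd: "G s t m n (b + b') = G s t m n b + G s t m n b'"
    and Gscale: "G s t m n (scale c b) = c * G s t m n b" for s t m n b b' c
    unfolding G_def by (rule lin_add[OF lin_sw[OF fld]] lin_scale[OF lin_sw[OF fld]],
        rule bilI, simp_all add: simps)+
  have Gb1: "bil (*) (\<lambda>m n. G s t m n b)" and Gb2: "bil (*) (\<lambda>s t. G s t m n b)" for s t b m n
    unfolding G_def by (rule bilI; simp add: simps sw_funs)+
  have Gb3: "bil (*) (\<lambda>s t. sw (\<lambda>m n. G s t m n b) q)" for q b
    by (rule bilI) (simp_all add: bil_simps[OF Gb2] sw_funs)
  have P: "tri (*) P" unfolding P_def
    by (rule triI) (simp_all add: Gadd Gscale sw_funs S_simps lin_simps[OF lin_sw[OF fld Gb3]] lin_simps[OF lin_sw[OF fld Gb1]])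
  have b0: "bil (*) (\<lambda>c d. f (S d) * g (S c))" by (rule bilI) (simp_all add: simps)
  have "sw (\<lambda>a b. f (S b) * g (S a)) x =
    sw (\<lambda>a b. \<epsilon> a * sw (\<lambda>c d. f (S d) * g (S c)) b) x"
    by (rule counit_left[symmetric]) (rule lin_sw[OF fld b0])
  also have "\<dots> = sw (\<lambda>a b. sw (\<lambda>s t. sw (\<lambda>c d. f (s \<odot> S d) * g (t \<odot> S c)) b) (sw (\<lambda>p q. S p \<odot> q) a)) x"
  proof -
    have b: "bil (*) (\<lambda>s t. sw (\<lambda>c d. f (s \<odot> S d) * g (t \<odot> S c)) b)" for b
      by (rule bilI) (simp_all add: simps sw_funs)
    show ?thesis unfolding antipode_left
      by (simp add: lin_scale[OF lin_sw[OF fld b]] sw_one[OF fld b])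
  qed
  also have "\<dots> = sw (\<lambda>a b. sw (\<lambda>p q. P p q b) a) x"
  proof -
    have b: "bil (*) (\<lambda>s t. sw (\<lambda>c d. f (s \<odot> S d) * g (t \<odot> S c)) b)" for b
      by (rule bilI) (simp_all add: simps sw_funs)
    show ?thesis unfolding sw_lin[OF lin_sw[OF fld b]] sw_mul[OF fld b] P_def G_def ..
  qed
  also have "\<dots> = sw (\<lambda>p r. sw (\<lambda>q b. P p q b) r) x" by (rule coassoc[OF fld P])
  also have "\<dots> = sw (\<lambda>p r. sw (\<lambda>s t. sw (\<lambda>q b. sw (\<lambda>m n. G s t m n b) q) r) (S p)) x"
    unfolding P_def by (subst sw_swap) (rule refl)
  also have "\<dots> = sw (\<lambda>p r. sw (\<lambda>s t. \<epsilon> r * (f s * g t)) (S p)) x"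
    unfolding G_def
    using antipode_comult_aux[OF lin_comp[OF f lin_mul_right] lin_comp[OF g lin_mul_right]]
    by (simp add: mul_assoc)
  also have "\<dots> = sw (\<lambda>p r. \<epsilon> r * sw (\<lambda>s t. f s * g t) (S p)) x" by (simp add: sw_funs)
  also have "\<dots> = sw (\<lambda>s t. f s * g t) (S x)"
    by (rule counit_right) (rule lin_comp[OF lin_sw[OF fld bil_functionals[OF f g]] lin_antipode])
  finally show ?thesis ..
qed

lemma conv_S: "lin (*) f \<Longrightarrow> lin (*) g \<Longrightarrow> conv f g (S x) = conv (\<lambda>y. g (S y)) (\<lambda>y. f (S y)) x"
  unfolding conv_def antipode_comult by (simp add: mult.commute)

lemma Lf_S: assumes f: "lin (*) f" shows "Lf f (S x) = S (Rf (\<lambda>y. f (S y)) x)"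
proof (rule functional_eq)
  fix h assume h: "lin (*) h"
  show "h (Lf f (S x)) = h (S (Rf (\<lambda>y. f (S y)) x))"
    using functional_Rf[OF lin_comp[OF h lin_antipode]] by (simp add: functional_Lf h conv_S f)
qed

lemma Rf_S: assumes f: "lin (*) f" shows "Rf f (S x) = S (Lf (\<lambda>y. f (S y)) x)"
proof (rule functional_eq)
  fix h assume h: "lin (*) h"
  show "h (Rf f (S x)) = h (S (Lf (\<lambda>y. f (S y)) x))"
    using functional_Lf[OF lin_comp[OF h lin_antipode]] by (simp add: functional_Rf h conv_S f)
qed

end

section \<open>Stable finiteness and injectivity of the antipode\<close>

context sweedler_hopf
begin

lemma mul_sum_left: "sum f A \<odot> y = (\<Sum>i\<in>A. f i \<odot> y)" and mul_sum_right: "y \<odot> sum f A = (\<Sum>i\<in>A. y \<odot> f i)"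
  by (rule lin_sum[OF lin_mul_left], rule lin_sum[OF lin_mul_right])

section \<open>Noetherian free modules and stable finiteness\<close>

definition left_idl :: "'a set \<Rightarrow> bool"
  where "left_idl I \<longleftrightarrow> 0 \<in> I \<and> (\<forall>x\<in>I. \<forall>y\<in>I. x + y \<in> I) \<and> (\<forall>r. \<forall>x\<in>I. r \<odot> x \<in> I)"

definition left_noeth :: bool
  where "left_noeth \<longleftrightarrow> (\<forall>I :: nat \<Rightarrow> 'a set. (\<forall>n. left_idl (I n)) \<and> (\<forall>n. I n \<subseteq> I (Suc n)) \<longrightarrow>
    (\<exists>N. \<forall>n\<ge>N. I n = I N))"

definition left_submodule :: "('i \<Rightarrow> 'a) set \<Rightarrow> bool"
  where "left_submodule M \<longleftrightarrow> (\<lambda>_. 0) \<in> M \<and> (\<forall>v\<in>M. \<forall>w\<in>M. (\<lambda>i. v i + w i) \<in> M) \<and>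
    (\<forall>r. \<forall>v\<in>M. (\<lambda>i. r \<odot> v i) \<in> M)"

text \<open>Induction on the rank: nested submodules coincide once they have the same image in the
  coordinate \<open>j\<close> and the same elements with vanishing coordinate \<open>j\<close>. The
  images form a chain of left ideals, the kernels a chain of smaller rank.\<close>

lemma free_module_noetherian:
  fixes M :: "nat \<Rightarrow> ('i \<Rightarrow> 'a) set"
  assumes noeth: left_noeth and "finite J"
    and "\<And>n. left_submodule (M n)" "\<And>n. M n \<subseteq> M (Suc n)" "\<And>n v i. v \<in> M n \<Longrightarrow> i \<notin> J \<Longrightarrow> v i = 0"
  shows "\<exists>N. \<forall>n\<ge>N. M n = M N"
  using assms(2-)
proof (induction J arbitrary: M rule: finite_induct)
  case empty
  have "v = (\<lambda>_. 0)" if "v \<in> M n" for v n using empty.prems(3)[OF that] by auto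
  then have "M n = {\<lambda>_. 0}" for n using empty.prems(1)[of n] unfolding left_submodule_def by blast
  then show ?case by auto
next
  case (insert j J)
  note M = insert.prems(1)[unfolded left_submodule_def]
  have mono: "M m \<subseteq> M n" if "m \<le> n" for m n
    using lift_Suc_mono_le[of M, OF insert.prems(2) that] .
  define I where "I n = (\<lambda>v. v j) ` M n" for n
  have "left_idl (I n)" for n
    unfolding left_idl_def
  proof (intro conjI ballI allI)
    show "0 \<in> I n" unfolding I_def using M[of n] by (intro image_eqI[of _ _ "\<lambda>_. 0"]) auto
    fix x assume "x \<in> I n"
    then obtain v where v: "v \<in> M n" "x = v j" by (auto simp: I_def)
    show "r \<odot> x \<in> I n" for r
      unfolding I_def using M[of n] v by (intro image_eqI[of _ _ "\<lambda>i. r \<odot> v i"]) auto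
    fix y assume "y \<in> I n"
    then obtain w where w: "w \<in> M n" "y = w j" by (auto simp: I_def)
    show "x + y \<in> I n"
      unfolding I_def using M[of n] v w by (intro image_eqI[of _ _ "\<lambda>i. v i + w i"]) auto
  qed
  moreover have "I n \<subseteq> I (Suc n)" for n unfolding I_def using insert.prems(2) by blast
  ultimately obtain N1 where N1: "\<And>n. n \<ge> N1 \<Longrightarrow> I n = I N1" using noeth unfolding left_noeth_def by metis
  define M' where "M' n = {v \<in> M n. v j = 0}" for n
  have "\<exists>N. \<forall>n\<ge>N. M' n = M' N"
  proof (rule insert.IH)
    show "left_submodule (M' n)" for n
      unfolding left_submodule_def M'_def using M[of n] by (auto simp: mul_simps)
    show "M' n \<subseteq> M' (Suc n)" for n unfolding M'_def using insert.prems(2) by blast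
    show "v i = 0" if "v \<in> M' n" "i \<notin> J" for n v i
      using that insert.prems(3)[of v n i] unfolding M'_def by auto
  qed
  then obtain N2 where N2: "\<And>n. n \<ge> N2 \<Longrightarrow> M' n = M' N2" by blast
  define N where "N = max N1 N2"
  show ?case
  proof (intro exI[of _ N] allI impI subset_antisym subsetI)
    fix n v assume n: "N \<le> n" and v: "v \<in> M n"
    have "I n = I N" using N1[of n] N1[of N] n by (simp add: N_def)
    moreover have "v j \<in> I n" using v by (simp add: I_def)
    ultimately have "v j \<in> (\<lambda>v. v j) ` M N" by (simp add: I_def)
    then obtain w where w: "w \<in> M N" "w j = v j" by auto
    then have w': "w \<in> M n" using mono n by blast
    define u where "u = (\<lambda>i. v i + (- one) \<odot> w i)"
    have "(\<lambda>i. (- one) \<odot> w i) \<in> M n" using M[of n] w' by blast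
    with v have "u \<in> M n" unfolding u_def
      using M[THEN conjunct2, THEN conjunct1, rule_format, of v n "\<lambda>i. (- one) \<odot> w i"] by blast
    then have "u \<in> M' n" unfolding M'_def u_def using w(2) by (simp add: mul_simps)
    then have "u \<in> M' N" using N2[of n] N2[of N] n by (simp add: N_def)
    then have "u \<in> M N" by (simp add: M'_def)
    then have "(\<lambda>i. u i + w i) \<in> M N" using M[of N] w(1) by blast
    moreover have "(\<lambda>i. u i + w i) = v" by (simp add: u_def mul_simps)
    ultimately show "v \<in> M N" by simp
  qed (use mono in blast)
qed

text \<open>Right multiplication of row vectors by \<open>A\<close> is left linear, and surjective
  because \<open>X A = 1\<close>. The kernels of its powers stabilise at some \<open>N\<close>; an
  element of the kernel is the image of some \<open>u\<close> under the power \<open>N\<close>, so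
  \<open>u\<close> is in the kernel of the next power, hence of the power \<open>N\<close>, and the
  element is zero. Each row of \<open>A X - 1\<close> is in the kernel.\<close>

lemma stably_finite:
  fixes X A :: "'i \<Rightarrow> 'i \<Rightarrow> 'a"
  assumes noeth: left_noeth and J: "finite J"
    and XA: "\<And>i j. i \<in> J \<Longrightarrow> j \<in> J \<Longrightarrow> (\<Sum>k\<in>J. X i k \<odot> A k j) = (if i = j then one else 0)"
    and ij: "i \<in> J" "j \<in> J"
  shows "(\<Sum>k\<in>J. A i k \<odot> X k j) = (if i = j then one else 0)"
proof -
  define \<phi> where "\<phi> v = (\<lambda>j. if j \<in> J then \<Sum>i\<in>J. v i \<odot> A i j else 0)" for v :: "'i \<Rightarrow> 'a"
  have p0: "\<phi> (\<lambda>_. 0) = (\<lambda>_. 0)"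
    and pa: "\<phi> (\<lambda>i. v i + w i) = (\<lambda>i. \<phi> v i + \<phi> w i)"
    and ps: "\<phi> (\<lambda>i. r \<odot> v i) = (\<lambda>i. r \<odot> \<phi> v i)" for v w r
    by (auto simp: \<phi>_def mul_simps sum.distrib mul_assoc mul_sum_right)
  have q0: "(\<phi> ^^ n) (\<lambda>_. 0) = (\<lambda>_. 0)"
    and qa: "(\<phi> ^^ n) (\<lambda>i. v i + w i) = (\<lambda>i. (\<phi> ^^ n) v i + (\<phi> ^^ n) w i)"
    and qs: "(\<phi> ^^ n) (\<lambda>i. r \<odot> v i) = (\<lambda>i. r \<odot> (\<phi> ^^ n) v i)" for v w r n
    by (induction n) (simp_all add: p0 pa ps)
  define M where "M n = {v. (\<forall>i. i \<notin> J \<longrightarrow> v i = 0) \<and> (\<phi> ^^ n) v = (\<lambda>_. 0)}" for n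
  have "\<exists>N. \<forall>n\<ge>N. M n = M N"
  proof (rule free_module_noetherian[OF noeth J])
    show "left_submodule (M n)" for n
      unfolding left_submodule_def M_def by (auto simp: q0 qa qs mul_simps)
    show "M n \<subseteq> M (Suc n)" for n unfolding M_def by (auto simp: p0)
  qed (auto simp: M_def)
  then obtain N where N: "M (Suc N) = M N" by (meson le_SucI order_refl)
  have surj: "\<exists>u. (\<forall>i. i \<notin> J \<longrightarrow> u i = 0) \<and> (\<phi> ^^ n) u = w" if "\<forall>i. i \<notin> J \<longrightarrow> w i = 0" for w n
    using that
  proof (induction n arbitrary: w)
    case 0 then show ?case by auto
  next
    case (Suc n)
    \<comment> \<open>The row \<open>w X\<close> is a preimage of \<open>w\<close>.\<close>
    define u where "u = (\<lambda>l. if l \<in> J then \<Sum>i\<in>J. w i \<odot> X i l else 0)"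
    have "\<phi> u j = w j" for j
    proof (cases "j \<in> J")
      case True
      have "\<phi> u j = (\<Sum>l\<in>J. (\<Sum>i\<in>J. w i \<odot> X i l) \<odot> A l j)" using True by (simp add: \<phi>_def u_def)
      also have "\<dots> = (\<Sum>i\<in>J. w i \<odot> (\<Sum>l\<in>J. X i l \<odot> A l j))"
        unfolding mul_sum_left mul_sum_right mul_assoc by (rule sum.swap)
      also have "\<dots> = (\<Sum>i\<in>J. if i = j then w i else 0)"
        by (rule sum.cong) (use XA True in \<open>auto simp: mul_simps\<close>)
      also have "\<dots> = w j" using J True by simp
      finally show ?thesis .
    qed (use Suc.prems in \<open>simp add: \<phi>_def\<close>)
    then have "\<phi> u = w" by blast
    moreover obtain u' where "\<forall>i. i \<notin> J \<longrightarrow> u' i = 0" "(\<phi> ^^ n) u' = u"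
      using Suc.IH[of u] by (auto simp: u_def)
    ultimately show ?case by (intro exI[of _ u']) simp
  qed
  have inj: "w = (\<lambda>_. 0)" if w: "\<forall>i. i \<notin> J \<longrightarrow> w i = 0" "\<phi> w = (\<lambda>_. 0)" for w
  proof -
    obtain u where u: "\<forall>i. i \<notin> J \<longrightarrow> u i = 0" "(\<phi> ^^ N) u = w" using surj w(1) by blast
    then have "u \<in> M (Suc N)" using w(2) by (simp add: M_def)
    then have "u \<in> M N" using N by simp
    then show ?thesis using u(2) by (simp add: M_def)
  qed
  \<comment> \<open>Row \<open>i\<close> of \<open>A X - 1\<close>; it is killed because
    \<open>(A X - 1) A = A (X A) - A\<close>.\<close>
  define w where "w l = (if l \<in> J then (\<Sum>k\<in>J. A i k \<odot> X k l) - (if i = l then one else 0) else 0)" for l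
  have "w = (\<lambda>_. 0)"
  proof (rule inj)
    show "\<forall>i. i \<notin> J \<longrightarrow> w i = 0" by (simp add: w_def)
    have "(\<Sum>l\<in>J. w l \<odot> A l m) = 0" if m: "m \<in> J" for m
    proof -
      have "(\<Sum>l\<in>J. w l \<odot> A l m) = (\<Sum>l\<in>J. (\<Sum>k\<in>J. A i k \<odot> X k l) \<odot> A l m) - (\<Sum>l\<in>J. if i = l then A l m else 0)"
        by (simp add: w_def mul_simps sum_subtractf[symmetric] if_distrib cong: if_cong sum.cong)
          (rule sum.cong, auto simp: mul_simps)
      also have "(\<Sum>l\<in>J. (\<Sum>k\<in>J. A i k \<odot> X k l) \<odot> A l m) = (\<Sum>k\<in>J. A i k \<odot> (\<Sum>l\<in>J. X k l \<odot> A l m))"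
        unfolding mul_sum_left mul_sum_right mul_assoc by (rule sum.swap)
      also have "\<dots> = (\<Sum>k\<in>J. if k = m then A i k else 0)"
        by (rule sum.cong) (use XA m in \<open>auto simp: mul_simps\<close>)
      also have "\<dots> = A i m" using J m by simp
      also have "(\<Sum>l\<in>J. if i = l then A l m else 0) = A i m" using J ij(1) by simp
      finally show ?thesis by simp
    qed
    then show "\<phi> w = (\<lambda>_. 0)" by (auto simp: \<phi>_def)
  qed
  then have "w j = 0" by simp
  then show ?thesis using ij(2) by (simp add: w_def split: if_splits)
qed

section \<open>Injectivity of the antipode\<close>

lemma sw_sum: "sw (\<lambda>a b. \<Sum>j\<in>J. B j a b) x = (\<Sum>j\<in>J. sw (B j) x)"
  by (induction J rule: infinite_finite_induct) (simp_all add: sw_plus sw_zero)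

text \<open>The sum is \<open>x_1 S(x_2) f(x_3)\<close>. With coordinate functionals for
  \<open>f\<close> it says that applying \<open>S\<close> entrywise to a comodule matrix gives a
  right inverse.\<close>

lemma mul_antipode_Rf:
  assumes f: "lin (*) f" shows "sw (\<lambda>a b. a \<odot> S (Rf f b)) x = scale (f x) one"
proof -
  have "tri scale (\<lambda>a u v. scale (f v) (a \<odot> S u))"
    by (rule triI) (simp_all add: mul_simps S_simps lin_simps[OF f] algebra_simps)
  note c = coassoc[OF vector_space_scale this]
  have b: "bil scale (\<lambda>z d. scale (f d) z)"
    by (rule bilI) (simp_all add: lin_simps[OF f] algebra_simps)
  have "sw (\<lambda>a b. a \<odot> S (Rf f b)) x = sw (\<lambda>a b. sw (\<lambda>u v. scale (f v) (a \<odot> S u)) b) x"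
    by (simp only: lin_apply_Rf[OF lin_comp[OF lin_mul_right lin_antipode]])
  also have "\<dots> = scale (f x) one" unfolding c[symmetric] by (rule antipode_cancel_left(1)[OF b])
  finally show ?thesis .
qed

text \<open>For a comodule matrix \<open>x\<close> of a finite-dimensional subcoalgebra, in a basis adapted to the kernel
  \<open>N\<close> of the antipode, \<open>S x\<close> is the inverse of \<open>x\<close> and is block triangular. Over a stably finite
  ring the inverse of a block triangular matrix is block triangular, hence \<open>N\<close> is a left coideal.
  The counit vanishes on it, so it is zero.\<close>

theorem antipode_injective:
  assumes noeth: left_noeth and n0: "S n0 = 0"
  shows "n0 = 0"
proof -
  obtain D A where D: "subcoalg D" "n0 \<in> D" "finite A" "D = span A" by (rule finite_subcoalg[of n0]) blast
  define N where "N = {c \<in> D. S c = 0}"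
  have sN: "subspace N" unfolding N_def using subcoalgD(1)[OF D(1)] by (auto simp: subspace_def S_simps)
  obtain BN where BN: "BN \<subseteq> N" "independent BN" "N \<subseteq> span BN" by (rule maximal_independent_subset)
  obtain BD where BD: "BN \<subseteq> BD" "BD \<subseteq> D" "independent BD" "D \<subseteq> span BD"
    by (rule maximal_independent_subset_extend[OF _ BN(2), of D]) (use BN N_def in auto)
  have fin: "finite BD" using independent_span_bound[OF D(3) BD(3)] BD(2) D(4) by blast
  define bs where "bs = extend_basis BD"
  have bs: "BD \<subseteq> bs" "independent bs" "span bs = UNIV"
    using BD(3) by (auto simp: bs_def extend_basis_superset independent_extend_basis span_extend_basis)
  define r where "r j v = representation bs v j" for j v
  have lr: "lin (*) (r j)" for j
    using bs by (simp add: lin_def r_def representation_add representation_scale)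
  have rij: "r j i = (if i = j then 1 else 0)" if "i \<in> BD" for i j
    unfolding r_def using representation_basis[OF bs(2), of i] that bs(1) by auto
  have rN: "r j v = 0" if "v \<in> N" "j \<notin> BN" for v j
  proof -
    have "representation bs v = representation BN v"
      using BD(1) BN(3) bs that by (intro representation_extend) auto
    then show ?thesis unfolding r_def using representation_ne_zero[of BN v j] that by metis
  qed
  have exp: "(\<Sum>j\<in>BD. scale (r j v) j) = v" if "v \<in> D" for v
  proof -
    have "representation bs v = representation BD v"
      using BD bs that by (intro representation_extend) auto
    then show ?thesis unfolding r_def
      using sum_representation_eq[OF BD(3) _ fin order_refl, of v] BD(4) that by auto
  qed
  \<comment> \<open>The comodule matrix: \<open>\<Delta> i\<close> is the sum of
    \<open>x i j \<otimes> j\<close> over \<open>j\<close> in \<open>BD\<close>.\<close>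
  define x where "x i j = Rf (r j) i" for i j
  have sw_x: "sw B i = (\<Sum>j\<in>BD. B (x i j) j)" if i: "i \<in> D" and B: "bil scale B" for i B
  proof -
    have "sw B i = sw (\<lambda>a b. \<Sum>j\<in>BD. scale (r j b) (B a j)) i"
    proof (rule sw_cong_left_coideal[OF vector_space_scale subcoalgD(3)[OF D(1)] i B])
      show "bil scale (\<lambda>a b. \<Sum>j\<in>BD. scale (r j b) (B a j))"
        by (rule bilI) (simp_all add: bil_simps[OF B] lin_simps[OF lr] scale_sum_right sum.distrib algebra_simps)
      fix a b assume "b \<in> D"
      then have "B a b = B a (\<Sum>j\<in>BD. scale (r j b) j)" by (simp add: exp)
      then show "B a b = (\<Sum>j\<in>BD. scale (r j b) (B a j))"
        by (simp add: lin_sum[OF bil_lin2[OF B]] bil_scale2[OF B])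
    qed
    then show ?thesis by (simp add: sw_sum x_def lin_apply_Rf[OF bil_lin1[OF B]])
  qed
  have xS: "(\<Sum>k\<in>BD. x i k \<odot> S (x k j)) = (if i = j then one else 0)" if "i \<in> BD" for i j
  proof -
    have "bil scale (\<lambda>a b. a \<odot> S (Rf (r j) b))"
      by (rule bil_mul[OF lin_id lin_comp[OF lin_antipode lin_Rf[OF lr]]])
    from sw_x[OF _ this, of i] have "(\<Sum>k\<in>BD. x i k \<odot> S (x k j)) = sw (\<lambda>a b. a \<odot> S (Rf (r j) b)) i"
      using that BD(2) unfolding x_def by auto
    then show ?thesis using mul_antipode_Rf[OF lr, of j i] rij[OF that] by auto
  qed
  define J where "J = BD - BN"
  \<comment> \<open>The element \<open>?Z\<close> lies in \<open>N\<close> because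
    \<open>S ?Z\<close> is a contraction of \<open>S k = 0\<close>. Its coordinate at
    \<open>j\<close> is \<open>h (S (x k j))\<close>, and coordinates outside \<open>BN\<close>
    vanish on \<open>N\<close>.\<close>
  have Sx0: "S (x k j) = 0" if k: "k \<in> BN" and j: "j \<in> J" for k j
  proof (rule functional_eq_0)
    fix h assume h: "lin (*) h"
    let ?Z = "Lf (\<lambda>y. h (S y)) k"
    have kN: "k \<in> N" using k BN(1) by blast
    have "S ?Z = 0" unfolding Rf_S[OF h, symmetric] using kN by (simp add: N_def lin_0[OF lin_Rf[OF h]])
    moreover have "?Z \<in> D"
      using kN subcoalgD(5)[OF D(1) lin_comp[OF h lin_antipode]] by (simp add: N_def)
    ultimately have "?Z \<in> N" by (simp add: N_def)
    then have "r j ?Z = 0" using rN j by (simp add: J_def)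
    then show "h (S (x k j)) = 0" unfolding x_def
      using functional_Lf[OF lr, of j "\<lambda>y. h (S y)" k] functional_Rf[OF lin_comp[OF h lin_antipode], of "r j" k] by simp
  qed
  have split: "(\<Sum>k\<in>BD. x i k \<odot> S (x k j)) = (\<Sum>k\<in>J. x i k \<odot> S (x k j))" if "j \<in> J" for i j
    by (rule sum.mono_neutral_right[OF fin]) (use that Sx0 in \<open>auto simp: J_def mul_simps\<close>)
  \<comment> \<open>The vanishing block restricts \<open>x S(x) = 1\<close> to \<open>J\<close>, but
    gives no such restriction of \<open>S(x) x = 1\<close>. This is the place of stable
    finiteness.\<close>
  have Sx: "(\<Sum>k\<in>J. S (x i k) \<odot> x k j) = (if i = j then one else 0)" if "i \<in> J" "j \<in> J" for i j
  proof (rule stably_finite[OF noeth _ _ that])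
    show "(\<Sum>k\<in>J. x i k \<odot> S (x k j)) = (if i = j then one else 0)" if "i \<in> J" "j \<in> J" for i j
      using split[OF that(2), of i] xS[of i j] that(1) by (simp add: J_def)
  qed (simp add: fin J_def)
  \<comment> \<open>Multiply the row of \<open>x\<close> at \<open>i\<close> by
    \<open>S(x) x = 1\<close> on \<open>J\<close>: its product with \<open>S(x)\<close> consists of
    entries of the identity matrix off the diagonal.\<close>
  have x0: "x i l = 0" if i: "i \<in> BN" and l: "l \<in> J" for i l
  proof -
    have "x i l = (\<Sum>k\<in>J. if k = l then x i k else 0)" using fin l by (simp add: J_def)
    also have "\<dots> = (\<Sum>k\<in>J. x i k \<odot> (\<Sum>j\<in>J. S (x k j) \<odot> x j l))"
      by (rule sum.cong) (use Sx l in \<open>auto simp: mul_simps\<close>)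
    also have "\<dots> = (\<Sum>j\<in>J. (\<Sum>k\<in>J. x i k \<odot> S (x k j)) \<odot> x j l)"
      unfolding mul_sum_left mul_sum_right mul_assoc by (rule sum.swap)
    also have "\<dots> = (\<Sum>j\<in>J. 0)"
    proof (rule sum.cong[OF refl])
      fix j assume j: "j \<in> J"
      then have "i \<in> BD" "i \<noteq> j" using i BD(1) by (auto simp: J_def)
      then show "(\<Sum>k\<in>J. x i k \<odot> S (x k j)) \<odot> x j l = 0"
        using split[OF j, of i] xS[of i j] by (simp add: mul_simps)
    qed
    finally show ?thesis by simp
  qed
  have "BN = {}"
  proof (rule ccontr)
    assume "BN \<noteq> {}"
    then obtain i where i: "i \<in> BN" by blast
    have b: "bil scale (\<lambda>a b. scale (\<epsilon> b) a)" by (rule bilI) (simp_all add: counit_simps algebra_simps)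
    have "i = (\<Sum>j\<in>BD. scale (\<epsilon> j) (x i j))"
      using sw_x[OF _ b, of i] i BD cop_counit_right[of i] by auto
    also have "\<dots> = 0"
    proof (rule sum.neutral, rule ballI)
      fix j assume "j \<in> BD"
      show "scale (\<epsilon> j) (x i j) = 0"
      proof (cases "j \<in> BN")
        case True
        then have "S j = 0" using BN(1) by (auto simp: N_def)
        then have "\<epsilon> j = 0" using counit_S[of j] counit_simps(3) by metis
        then show ?thesis by simp
      next
        case False then show ?thesis using x0[OF i, of j] \<open>j \<in> BD\<close> by (simp add: J_def)
      qed
    qed
    finally show False using i BN(2) dependent_zero by blast
  qed
  then show "n0 = 0" using BN(3) n0 D(2) by (auto simp: N_def)
qed

end

section \<open>Hopf algebras with the dual Chevalley property\<close>

context sweedler_coalgebra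
begin

lemma sw_mem_subcoalg:
  assumes D: "subcoalg D" "d \<in> D" and B: "bil scale B" and W: "subspace W"
    and BW: "\<And>a b. a \<in> D \<Longrightarrow> b \<in> D \<Longrightarrow> B a b \<in> W"
  shows "sw B d \<in> W"
proof -
  obtain p where p: "lin scale p" "\<And>x. p x \<in> D" "\<And>x. x \<in> D \<Longrightarrow> p x = x"
    by (rule projection_exists[OF subcoalgD(1)[OF D(1)]]) blast
  have "sw B d = sw (\<lambda>a b. B (p a) (p b)) d"
    by (rule sw_cong_subcoalg[OF vector_space_scale D B bil_comp[OF B p(1) p(1)]]) (simp add: p(3))
  then show ?thesis using sw_mem[OF W, of "\<lambda>a b. B (p a) (p b)"] BW p(2) by simp
qed

lemma wedge_mono: "Z \<subseteq> Z' \<Longrightarrow> wedge X Z \<subseteq> wedge X Z'"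
  unfolding wedge_def by blast

lemma Rf_wedge:
  assumes Z: "right_coideal Z" and y: "y \<in> wedge X Z" and h: "lin (*) h"
  shows "Rf h y \<in> wedge X Z"
  unfolding wedge_def
proof (intro CollectI allI impI)
  fix f g assume fg: "lin (*) f" "lin (*) g" "\<forall>x\<in>X. f x = 0" "\<forall>z\<in>Z. g z = 0"
  have "conv g h z = 0" if "z \<in> Z" for z
    using fg(4) that Z h by (simp add: functional_Rf[OF fg(2), symmetric] right_coidealD)
  then have "conv f (conv g h) y = 0" using y fg lin_conv[OF fg(2) h] unfolding wedge_def by blast
  then show "conv f g (Rf h y) = 0"
    using conv_assoc[OF fg(1,2) h] functional_Rf[OF lin_conv[OF fg(1,2)]] by simp
qed

lemma subspace_wedge: "subspace (wedge X Z)"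
  unfolding wedge_def subspace_def
  by (auto simp: lin_simps[OF lin_conv])

lemma wedge_superset: "right_coideal X \<Longrightarrow> X \<subseteq> wedge X Z"
  by (auto simp: wedge_def functional_Rf[symmetric] right_coidealD)

end

locale dual_chevalley_hopf = sweedler_hopf scale cop \<epsilon> mul one S
  for scale :: "'k::field \<Rightarrow> 'a::ab_group_add \<Rightarrow> 'a" and cop :: "'a \<Rightarrow> ('a \<times> 'a) list" and \<epsilon> :: "'a \<Rightarrow> 'k"
    and mul :: "'a \<Rightarrow> 'a \<Rightarrow> 'a" (infixl "\<odot>" 70) and one :: 'a and S :: "'a \<Rightarrow> 'a" +
  assumes noeth: left_noeth
    and corad_one: "one \<in> corad"
    and corad_mul: "x \<in> corad \<Longrightarrow> y \<in> corad \<Longrightarrow> x \<odot> y \<in> corad"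
begin

section \<open>Hopf subalgebras and the antipode on the coradical\<close>

definition subalg :: "'a set \<Rightarrow> bool"
  where "subalg K \<longleftrightarrow> subspace K \<and> one \<in> K \<and> (\<forall>x\<in>K. \<forall>y\<in>K. x \<odot> y \<in> K)"

definition hopf_sub :: "'a set \<Rightarrow> bool"
  where "hopf_sub K \<longleftrightarrow> subalg K \<and> subcoalg K \<and> (\<forall>x\<in>K. S x \<in> K)"

lemma hopf_subD:
  assumes "hopf_sub K"
  shows "subspace K" "one \<in> K" "x \<in> K \<Longrightarrow> y \<in> K \<Longrightarrow> x \<odot> y \<in> K" "subcoalg K" "x \<in> K \<Longrightarrow> S x \<in> K"
  using assms by (auto simp: hopf_sub_def subalg_def)

lemma antipode_eq_iff [simp]: "S x = S y \<longleftrightarrow> x = y"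
  using antipode_injective[OF noeth, of "x - y"] by (auto simp: S_simps)

text \<open>An injective linear map has a linear left inverse, through which functionals can be
  transported.\<close>

lemma functional_on_antipode:
  assumes "lin (*) f" obtains g where "lin (*) g" "\<And>x. g (S x) = f x"
proof -
  interpret P: vector_space_pair scale scale ..
  obtain T where T: "Vector_Spaces.linear scale scale T" "\<forall>v. T (S v) = v"
    using P.linear_exists_left_inverse_on[of S UNIV] lin_antipode
    by (auto simp: lin_iff_linear[OF vector_space_scale] inj_on_def)
  have "lin (*) (\<lambda>x. f (T x))"
    by (rule lin_comp[OF assms]) (simp add: T lin_iff_linear[OF vector_space_scale])
  then show thesis using that T by auto
qed

lemma subcoalg_antipode: assumes C: "subcoalg C" shows "subcoalg (S ` C)"
proof (rule subcoalgI)
  interpret L: Vector_Spaces.linear scale scale S using lin_antipode by (simp add: lin_iff_linear[OF vector_space_scale])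
  show "subspace (S ` C)" by (rule L.subspace_image[OF subcoalgD(1)[OF C]])
qed (auto simp: Rf_S Lf_S intro!: imageI subcoalgD(4,5)[OF C] lin_comp[OF _ lin_antipode])

text \<open>A subcoalgebra \<open>E\<close> of the image is pulled back to \<open>C\<close>. Writing
  a functional as \<open>g\<close> after \<open>S\<close> turns its contractions on \<open>C\<close>
  into contractions by \<open>g\<close> on \<open>S C\<close>, with the legs exchanged, so the
  pullback is again a subcoalgebra.\<close>

lemma simple_antipode: assumes C: "simple_subcoalg C" shows "simple_subcoalg (S ` C)"
  unfolding simple_subcoalg_def
proof (intro conjI allI impI)
  note sC = simple_subcoalgD(1)[OF C]
  show "subcoalg (S ` C)" by (rule subcoalg_antipode[OF sC])
  obtain c where "c \<in> C" "c \<noteq> 0" using subspace_nonzero[OF subcoalgD(1)[OF sC] simple_subcoalgD(2)[OF C]] by blast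
  then show "S ` C \<noteq> {0}" using antipode_injective[OF noeth, of c] by blast
  fix E assume E: "subcoalg E \<and> E \<subseteq> S ` C"
  then have sE: "subcoalg E" by simp
  define F where "F = {c \<in> C. S c \<in> E}"
  have EF: "E = S ` F" using E unfolding F_def by auto
  have "subcoalg F"
  proof (rule subcoalgI)
    show "subspace F" unfolding F_def
      using subcoalgD(1)[OF sC] subcoalgD(1)[OF sE] by (auto simp: subspace_def S_simps)
    fix f w assume f: "lin (*) f" and w: "w \<in> F"
    obtain g where g: "lin (*) g" "\<And>x. g (S x) = f x" by (rule functional_on_antipode[OF f]) blast
    have "S (Rf f w) = Lf g (S w)" "S (Lf f w) = Rf g (S w)"
      using Lf_S[OF g(1)] Rf_S[OF g(1)] by (simp_all add: g(2))
    then show "Rf f w \<in> F" "Lf f w \<in> F"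
      using f g w subcoalgD[OF sC] subcoalgD[OF sE] by (auto simp: F_def)
  qed
  then have "F = {0} \<or> F = C" using simple_subcoalgD(3)[OF C] F_def by auto
  then show "E = {0} \<or> E = S ` C" using EF S_simps(3) by auto
qed

lemma corad_antipode: "x \<in> corad \<Longrightarrow> S x \<in> corad"
proof (induction rule: corad_induct)
  case subspace
  show ?case using subspace_corad by (auto simp: subspace_def S_simps)
next
  case (simple C x) then show ?case using simple_le_corad[OF simple_antipode] by blast
qed

lemma hopf_sub_corad: "hopf_sub corad"
  using corad_one corad_mul corad_antipode subspace_corad subcoalg_corad
  by (simp add: hopf_sub_def subalg_def)

lemma Lf_one: "lin (*) f \<Longrightarrow> Lf f one = scale (f one) one"
  and Rf_one: "lin (*) f \<Longrightarrow> Rf f one = scale (f one) one"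
  by (rule functional_eq; simp add: functional_Lf functional_Rf conv_def cop_one lin_scale)+

lemma hopf_sub_unit: "hopf_sub (span {one})"
proof -
  have "subcoalg (span {one})"
    by (rule subcoalg_span) (auto simp: Lf_one Rf_one span_singleton)
  then show ?thesis
    unfolding hopf_sub_def subalg_def
    by (auto simp: span_singleton S_simps mul_simps intro: exI[of _ 1] subspace_span[of "{one}", unfolded span_singleton])
     (metis rangeI scale_one subspace_span)+
qed

text \<open>Insert \<open>y\<^sub>2 S(y\<^sub>3)\<close>.\<close>

lemma translate_functional:
  assumes f: "lin (*) f"
  shows "Lf (\<lambda>z. f (z \<odot> y)) x = sw (\<lambda>g v. Lf f (x \<odot> g) \<odot> S v) y"
proof -
  define B where "B u m = sw (\<lambda>a b. scale (f (a \<odot> u)) (b \<odot> m)) x" for u m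
  have B: "bil scale B" unfolding B_def
    by (rule bilI) (simp_all add: lin_simps[OF f] mul_simps sw_funs algebra_simps sw_scale[symmetric])
  have b: "bil scale (\<lambda>a b. scale (f a) b)"
    by (rule bilI) (simp_all add: lin_simps[OF f] algebra_simps)
  have "Lf (\<lambda>z. f (z \<odot> y)) x = B y one" by (simp add: B_def Lf_def)
  also have "\<dots> = sw (\<lambda>g v. sw (\<lambda>c d. B c (d \<odot> S v)) g) y"
    by (rule antipode_cancel_right(1)[OF vector_space_scale B, symmetric])
  also have "\<dots> = sw (\<lambda>g v. sw (\<lambda>a b. sw (\<lambda>c d. scale (f (a \<odot> c)) (b \<odot> d)) g) x \<odot> S v) y"
  proof -
    have "sw (\<lambda>c d. B c (d \<odot> S v)) g = sw (\<lambda>a b. sw (\<lambda>c d. scale (f (a \<odot> c)) (b \<odot> d)) g) x \<odot> S v" for g v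
      unfolding B_def by (subst sw_swap) (simp add: sw_lin[OF lin_mul_left] mul_simps mul_assoc)
    then show ?thesis by simp
  qed
  finally show ?thesis unfolding Lf_def sw_mul[OF vector_space_scale b] .
qed

lemma counit_Lf: "lin (*) f \<Longrightarrow> \<epsilon> (Lf f x) = f x"
  by (simp add: functional_Lf lin_counit)

lemma lin_functional_mul: "lin (*) f \<Longrightarrow> lin (*) (\<lambda>z. f (z \<odot> y))" "lin (*) f \<Longrightarrow> lin (*) (\<lambda>z. f (y \<odot> z))"
  by (rule lin_comp, assumption, rule lin_mul_left) (rule lin_comp, assumption, rule lin_mul_right)

definition cutoff :: "'a set \<Rightarrow> ('a \<Rightarrow> 'k) \<Rightarrow> bool"
  where "cutoff K e \<longleftrightarrow> lin (*) e \<and> (\<forall>x\<in>K. e x = \<epsilon> x) \<and>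
    (\<forall>C. simple_subcoalg C \<longrightarrow> \<not> C \<subseteq> K \<longrightarrow> (\<forall>x\<in>C. e x = 0))"

lemma cutoffD:
  assumes "cutoff K e"
  shows "lin (*) e" "x \<in> K \<Longrightarrow> e x = \<epsilon> x" "simple_subcoalg C \<Longrightarrow> \<not> C \<subseteq> K \<Longrightarrow> x \<in> C \<Longrightarrow> e x = 0"
  using assms by (auto simp: cutoff_def)

lemma cutoff_exists: "subcoalg K \<Longrightarrow> \<exists>e. cutoff K e"
  unfolding cutoff_def by (erule counit_cutoff) blast

text \<open>By \<open>h (Lf e x) = e (Rf h x)\<close> the functional \<open>e\<close> is evaluated
  only inside a subcoalgebra containing \<open>x\<close>, where it is the counit or zero.\<close>

lemma Lf_cutoff:
  assumes K: "subcoalg K" and cut: "cutoff K e"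
  shows "x \<in> K \<Longrightarrow> Lf e x = x" and "simple_subcoalg C \<Longrightarrow> \<not> C \<subseteq> K \<Longrightarrow> x \<in> C \<Longrightarrow> Lf e x = 0"
    and "x \<in> corad \<Longrightarrow> Lf e x \<in> K"
proof -
  note e = cutoffD[OF cut]
  show 1: "Lf e x = x" if "x \<in> K" for x
  proof (rule functional_eq)
    fix h assume h: "lin (*) h"
    have "h (Lf e x) = e (Rf h x)" by (simp add: functional_Lf functional_Rf h e(1))
    also have "\<dots> = \<epsilon> (Rf h x)" using subcoalgD(4)[OF K h that] by (rule e(2))
    also have "\<dots> = h x" by (simp add: functional_Rf lin_counit h)
    finally show "h (Lf e x) = h x" .
  qed
  show 2: "Lf e x = 0" if C: "simple_subcoalg C" "\<not> C \<subseteq> K" "x \<in> C" for C x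
  proof (rule functional_eq_0)
    fix h assume h: "lin (*) h"
    have "h (Lf e x) = e (Rf h x)" by (simp add: functional_Lf functional_Rf h e(1))
    also have "\<dots> = 0" using subcoalgD(4)[OF simple_subcoalgD(1)[OF C(1)] h C(3)] by (rule e(3)[OF C(1,2)])
    finally show "h (Lf e x) = 0" .
  qed
  show "Lf e x \<in> K" if "x \<in> corad"
    using that
  proof (induction rule: corad_induct)
    case subspace show ?case using subcoalgD(1)[OF K] by (auto simp: subspace_def lin_simps[OF lin_Lf[OF e(1)]])
  next
    case (simple C x)
    then show ?case using 1[of x] 2[of C x] subspace_0[OF subcoalgD(1)[OF K]] by (cases "C \<subseteq> K") auto
  qed
qed

text \<open>For the cutoff \<open>l\<close> at the unit, \<open>translate_functional\<close> turns
  \<open>l(x_1 y) x_2\<close>, an element of \<open>C\<close>, into \<open>l(x y_1) S(y_2)\<close>,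
  an element of \<open>S (S C)\<close> when \<open>y\<close> is in \<open>S C\<close>. Its counit is
  \<open>l(x y)\<close>, so for suitable \<open>x\<close> and \<open>y\<close> it is nonzero, and
  simple subcoalgebras with nonzero intersection coincide.\<close>

lemma antipode_antipode_simple:
  assumes C: "simple_subcoalg C" shows "S ` S ` C = C"
proof (rule simple_eq[OF C simple_antipode[OF simple_antipode[OF C]]])
  note sC = simple_subcoalgD(1)[OF C]
  note K = hopf_subD(4)[OF hopf_sub_unit]
  obtain l where cut: "cutoff (span {one}) l" using cutoff_exists[OF K] by blast
  note l = cutoffD[OF cut]
  have inv: "Lf l x = scale (l x) one" if "x \<in> corad" for x
  proof -
    have "Lf l x \<in> span {one}" by (rule Lf_cutoff(3)[OF K cut]) (rule \<open>x \<in> corad\<close>)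
    then obtain c where "Lf l x = scale c one" by (auto simp: span_singleton)
    moreover from this have "l x = c" using counit_Lf[OF l(1), of x] by (simp add: counit_simps)
    ultimately show ?thesis by simp
  qed
  have "\<exists>x\<in>C. \<exists>y\<in>S ` C. l (x \<odot> y) \<noteq> 0"
  proof (rule ccontr)
    assume "\<not> ?thesis"
    then have 0: "l (x \<odot> S y) = 0" if "x \<in> C" "y \<in> C" for x y using that by blast
    obtain z where z: "z \<in> C" "z \<noteq> 0" using subspace_nonzero[OF subcoalgD(1)[OF sC] simple_subcoalgD(2)[OF C]] by blast
    \<comment> \<open>Apply \<open>l\<close> to \<open>z_1 S(z_2) = \<epsilon>(z) 1\<close>, where
      \<open>l 1 = 1\<close>.\<close>
    have eps0: "\<epsilon> z = 0" if "z \<in> C" for z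
    proof -
      have "l (sw (\<lambda>a b. a \<odot> S b) z) = sw (\<lambda>a b. l (a \<odot> S b)) z" by (rule sw_lin[OF l(1)])
      also have "\<dots> = sw (\<lambda>a b. 0) z"
        by (rule sw_cong_subcoalg[OF vector_space_field sC that _ _ 0]; (rule bilI)?)
          (simp_all add: lin_simps[OF l(1)] mul_simps S_simps)
      finally have "\<epsilon> z * l one = 0" by (simp add: antipode_right lin_simps[OF l(1)] sw_zero)
      moreover have "l one = 1" using l(2)[of one] by (simp add: span_base)
      ultimately show ?thesis by simp
    qed
    have "z = 0"
    proof (rule functional_eq_0)
      fix h assume h: "lin (*) h"
      have "h z = \<epsilon> (Rf h z)" by (simp add: functional_Rf h lin_counit)
      then show "h z = 0" using eps0 subcoalgD(4)[OF sC h z(1)] by simp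
    qed
    then show False using z by simp
  qed
  then obtain x y where xy: "x \<in> C" "y \<in> S ` C" "l (x \<odot> y) \<noteq> 0" by blast
  have corad: "x \<in> corad" "y \<in> corad"
    using xy simple_le_corad[OF C] simple_le_corad[OF simple_antipode[OF C]] by auto
  define w where "w = Lf (\<lambda>z. l (z \<odot> y)) x"
  have "w \<in> C" unfolding w_def by (rule subcoalgD(5)[OF sC lin_functional_mul(1)[OF l(1)] xy(1)])
  moreover have "w \<noteq> 0" using counit_Lf[OF lin_functional_mul(1)[OF l(1)], of y x] xy(3) counit_simps(3)
    by (auto simp: w_def)
  moreover have "w \<in> S ` S ` C"
  proof -
    have "w = sw (\<lambda>g v. Lf l (x \<odot> g) \<odot> S v) y" unfolding w_def by (rule translate_functional[OF l(1)])
    also have "\<dots> = sw (\<lambda>g v. scale (l (x \<odot> g)) (S v)) y"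
    proof (rule sw_cong_right_coideal[OF vector_space_scale subcoalgD(2)[OF subcoalg_corad] corad(2)])
      show "bil scale (\<lambda>g v. Lf l (x \<odot> g) \<odot> S v)"
        by (rule bil_mul[OF lin_comp[OF lin_Lf[OF l(1)] lin_mul_right] lin_antipode])
      show "bil scale (\<lambda>g v. scale (l (x \<odot> g)) (S v))"
        by (rule bilI) (simp_all add: lin_simps[OF l(1)] mul_simps S_simps algebra_simps)
      show "Lf l (x \<odot> g) \<odot> S v = scale (l (x \<odot> g)) (S v)" if "g \<in> corad" for g v
        using inv[OF corad_mul[OF corad(1) that]] by (simp add: mul_simps)
    qed
    also have "\<dots> = S (Lf (\<lambda>g. l (x \<odot> g)) y)" by (simp add: lin_apply_Lf[OF lin_antipode])
    finally have "w = S (Lf (\<lambda>g. l (x \<odot> g)) y)" .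
    then show ?thesis
      using subcoalgD(5)[OF subcoalg_antipode[OF sC] lin_functional_mul(2)[OF l(1)] xy(2)] by blast
  qed
  ultimately show "S ` S ` C \<inter> C \<noteq> {0}" by blast
qed

section \<open>Projections below the coradical and stability above it\<close>

definition right_projection :: "'a set \<Rightarrow> ('a \<Rightarrow> 'a) \<Rightarrow> bool"
  where "right_projection K p \<longleftrightarrow> lin scale p \<and> (\<forall>x. p x \<in> K) \<and> (\<forall>x. \<forall>k\<in>K. p (x \<odot> k) = p x \<odot> k) \<and> p one = one"

text \<open>The projection is \<open>Lf e\<close> for the cutoff \<open>e\<close> at
  \<open>K\<close>. It is \<open>K\<close>-linear because
  \<open>e (x k) = e x \<epsilon>(k)\<close>; for \<open>x\<close> in a simple \<open>C\<close>
  outside \<open>K\<close> the point is that \<open>e(x_1 k) x_2\<close> lies in both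
  \<open>C\<close> and \<open>K\<close>.\<close>

lemma cosemisimple_projection:
  assumes K: "hopf_sub K" and KC: "K \<subseteq> corad"
  obtains p where "lin scale p" "\<And>x. x \<in> corad \<Longrightarrow> p x \<in> K"
    "\<And>x k. x \<in> corad \<Longrightarrow> k \<in> K \<Longrightarrow> p (x \<odot> k) = p x \<odot> k" "p one = one"
proof -
  note cK = hopf_subD(4)[OF K]
  obtain e where cut: "cutoff K e" using cutoff_exists[OF cK] by blast
  note e = cutoffD[OF cut] and L = Lf_cutoff[OF cK cut]
  have mult: "e (x \<odot> k) = e x * \<epsilon> k" if "x \<in> corad" "k \<in> K" for x k
    using that(1)
  proof (induction rule: corad_induct)
    case subspace show ?case by (auto simp: subspace_def mul_simps lin_simps[OF e(1)] algebra_simps)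
  next
    case (simple C x)
    show ?case
    proof (cases "C \<subseteq> K")
      case True
      then show ?thesis using e(2) simple that(2) hopf_subD(3)[OF K] by (auto simp: counit_mul)
    next
      case False
      define w where "w = Lf (\<lambda>z. e (z \<odot> k)) x"
      have xc: "x \<in> corad" using simple simple_le_corad by blast
      have "w \<in> C" unfolding w_def
        by (rule subcoalgD(5)[OF simple_subcoalgD(1)[OF simple(1)] lin_functional_mul(1)[OF e(1)] simple(2)])
      \<comment> \<open>In the form \<open>Lf e (x k_1) S(k_2)\<close> both factors lie in
        \<open>K\<close>.\<close>
      moreover have "w \<in> K" unfolding w_def translate_functional[OF e(1)]
      proof (rule sw_mem_subcoalg[OF cK that(2) _ hopf_subD(1)[OF K]])
        show "bil scale (\<lambda>g v. Lf e (x \<odot> g) \<odot> S v)"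
          by (rule bil_mul[OF lin_comp[OF lin_Lf[OF e(1)] lin_mul_right] lin_antipode])
        fix g v assume "g \<in> K" "v \<in> K"
        then show "Lf e (x \<odot> g) \<odot> S v \<in> K"
          using L(3)[OF corad_mul[OF xc]] KC hopf_subD(3,5)[OF K] by blast
      qed
      moreover have "K \<inter> C = {0}"
        using simple_subcoalgD(3)[OF simple(1) subcoalg_Int[OF cK simple_subcoalgD(1)[OF simple(1)]]] False by blast
      ultimately have "w = 0" by blast
      then have "e (x \<odot> k) = 0"
        using counit_Lf[OF lin_functional_mul(1)[OF e(1)], of k x] by (simp add: w_def counit_simps)
      then show ?thesis using e(3)[OF simple(1) False simple(2)] by simp
    qed
  qed
  have b: "bil scale (\<lambda>a b. scale (e a) b)"
    by (rule bilI) (simp_all add: lin_simps[OF e(1)] algebra_simps)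
  have "Lf e (x \<odot> k) = Lf e x \<odot> k" if x: "x \<in> corad" and k: "k \<in> K" for x k
  proof -
    have "Lf e (x \<odot> k) = sw (\<lambda>a b. sw (\<lambda>c d. scale (e (a \<odot> c)) (b \<odot> d)) k) x"
      unfolding Lf_def sw_mul[OF vector_space_scale b] ..
    also have "\<dots> = sw (\<lambda>a b. scale (e a) (b \<odot> k)) x"
    proof (rule sw_cong_right_coideal[OF vector_space_scale subcoalgD(2)[OF subcoalg_corad] x])
      show "bil scale (\<lambda>a b. sw (\<lambda>c d. scale (e (a \<odot> c)) (b \<odot> d)) k)"
        by (rule bilI) (simp_all add: lin_simps[OF e(1)] mul_simps sw_funs algebra_simps sw_scale[symmetric])
      show "bil scale (\<lambda>a b. scale (e a) (b \<odot> k))"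
        by (rule bilI) (simp_all add: lin_simps[OF e(1)] mul_simps algebra_simps)
      fix a b assume a: "a \<in> corad"
      have "sw (\<lambda>c d. scale (e (a \<odot> c)) (b \<odot> d)) k = sw (\<lambda>c d. scale (\<epsilon> c) (scale (e a) (b \<odot> d))) k"
        by (rule sw_cong_right_coideal[OF vector_space_scale subcoalgD(2)[OF cK] k]; (rule bilI)?)
          (simp_all add: lin_simps[OF e(1)] mul_simps counit_simps algebra_simps mult[OF a])
      also have "\<dots> = scale (e a) (b \<odot> k)"
        by (rule counit_left) (simp add: lin_def mul_simps algebra_simps)
      finally show "sw (\<lambda>c d. scale (e (a \<odot> c)) (b \<odot> d)) k = scale (e a) (b \<odot> k)" .
    qed
    also have "\<dots> = Lf e x \<odot> k" by (simp add: Lf_def sw_lin[OF lin_mul_left] mul_simps)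
    finally show ?thesis .
  qed
  then show thesis using that[of "Lf e"] lin_Lf[OF e(1)] L hopf_subD(2)[OF K] by blast
qed

text \<open>For \<open>y\<close> with \<open>\<Delta> y \<in> X \<otimes> H + K \<otimes> corad\<close> the sum \<open>S(y\<^sub>1) y\<^sub>2 S(y\<^sub>3)\<close> is \<open>S y\<close> modulo \<open>K\<close> by
  one bracketing and lies in \<open>K\<close> by the other.\<close>

lemma antipode_stable:
  assumes K: "subalg K" "subcoalg K" and CK: "corad \<subseteq> K" and x: "x \<in> K"
  shows "S x \<in> K"
proof -
  have Ks: "subspace K" and Km: "\<And>x y. x \<in> K \<Longrightarrow> y \<in> K \<Longrightarrow> x \<odot> y \<in> K" using K(1) by (auto simp: subalg_def)
  \<comment> \<open>The largest right coideal in \<open>K\<close> that \<open>S\<close> maps into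
    \<open>K\<close>. If it were smaller than \<open>K\<close>, some \<open>y\<close> in
    \<open>K\<close> outside it would lie in \<open>wedge X corad\<close>.\<close>
  define X where "X = {x \<in> K. \<forall>h. lin (*) h \<longrightarrow> S (Rf h x) \<in> K}"
  have X: "right_coideal X"
    unfolding right_coideal_def
  proof (intro conjI allI impI ballI)
    show "subspace X" unfolding X_def using Ks
      by (auto simp: subspace_def lin_simps[OF lin_Rf] S_simps)
    fix f w assume f: "lin (*) f" and w: "w \<in> X"
    then show "Rf f w \<in> X" unfolding X_def using subcoalgD(4)[OF K(2)] by (simp add: Rf_Rf lin_conv)
  qed
  have SX: "S x \<in> K" if "x \<in> X" for x
    using that lin_counit unfolding X_def by (metis (mono_tags, lifting) Rf_counit mem_Collect_eq)
  have XK: "X \<subseteq> K" by (auto simp: X_def)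
  have main: "S y \<in> K" if y: "y \<in> K" "y \<in> wedge X corad" for y
  proof (rule functional_mem[OF Ks])
    fix f assume f: "lin (*) f" "\<And>w. w \<in> K \<Longrightarrow> f w = 0"
    \<comment> \<open>The retractions make \<open>T\<close> trilinear on all of \<open>H\<close>
      while keeping its arguments in \<open>K\<close> and in the coradical. They are undone wherever
      the legs are known to lie there.\<close>
    obtain p where p: "lin scale p" "\<And>x. p x \<in> K" "\<And>x. x \<in> K \<Longrightarrow> p x = x"
      by (rule projection_exists[OF Ks]) blast
    obtain q where q: "lin scale q" "\<And>x. q x \<in> corad" "\<And>x. x \<in> corad \<Longrightarrow> q x = x"
      by (rule projection_exists[OF subspace_corad]) blast
    note simps = lin_simps[OF f(1)] lin_simps[OF p(1)] lin_simps[OF q(1)] mul_simps S_simps counit_simps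
    define T where "T a b c = f (S (p a) \<odot> p b \<odot> S (q c))" for a b c
    have T: "tri (*) T" unfolding T_def by (rule triI) (simp_all add: simps)
    have SqK: "S (q c) \<in> K" for c using corad_antipode[OF q(2)] CK by blast
    have "sw (\<lambda>a b. sw (\<lambda>u v. T a u v) b) y = sw (\<lambda>a b. \<epsilon> b * f (S (p a))) y"
    proof (rule sw_cong_wedge[OF vector_space_field right_coidealD(1)[OF X] subspace_corad _ _ _ _ y(2)])
      show "bil (*) (\<lambda>a b. sw (\<lambda>u v. T a u v) b)" by (rule bil_sw_right[OF vector_space_field T])
      show "bil (*) (\<lambda>a b. \<epsilon> b * f (S (p a)))" by (rule bilI) (simp_all add: simps algebra_simps)
      fix a b
      show "sw (\<lambda>u v. T a u v) b = \<epsilon> b * f (S (p a))" if "a \<in> X"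
      proof -
        have a: "p a = a" "S a \<in> K" using p(3) XK SX that by auto
        have "T a u v = 0" for u v unfolding T_def a(1) by (intro f(2) Km a(2) p(2) SqK)
        then show ?thesis using f(2)[OF a(2)] by (simp add: a(1) sw_zero)
      qed
      show "sw (\<lambda>u v. T a u v) b = \<epsilon> b * f (S (p a))" if b: "b \<in> corad"
      proof -
        have "sw (\<lambda>u v. T a u v) b = sw (\<lambda>u v. f (S (p a) \<odot> (u \<odot> S v))) b"
        proof (rule sw_cong_subcoalg[OF vector_space_field subcoalg_corad b tri_bil(1)[OF T]])
          show "bil (*) (\<lambda>u v. f (S (p a) \<odot> (u \<odot> S v)))" by (rule bilI) (simp_all add: simps)
        qed (use p(3) q(3) CK in \<open>auto simp: T_def mul_assoc\<close>)
        also have "\<dots> = f (S (p a) \<odot> sw (\<lambda>u v. u \<odot> S v) b)"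
          by (simp only: sw_lin[OF lin_comp[OF f(1) lin_mul_right]])
        finally show ?thesis by (simp add: antipode_right simps)
      qed
    qed
    also have "\<dots> = f (S y)"
      using counit_right[OF lin_comp[OF f(1) lin_comp[OF lin_antipode p(1)]]] p(3)[OF y(1)] by simp
    finally have 1: "sw (\<lambda>a b. sw (\<lambda>u v. T a u v) b) y = f (S y)" .
    have "sw (\<lambda>a b. sw (\<lambda>u v. T u v b) a) y = sw (\<lambda>a b. 0) y"
    proof (rule sw_cong_right_coideal[OF vector_space_field subcoalgD(2)[OF K(2)] y(1) bil_sw_left[OF vector_space_field T]])
      fix a b assume a: "a \<in> K"
      have "sw (\<lambda>u v. T u v b) a = sw (\<lambda>u v. f (S u \<odot> v \<odot> S (q b))) a"
      proof (rule sw_cong_subcoalg[OF vector_space_field K(2) a tri_bil(2)[OF T]])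
        show "bil (*) (\<lambda>u v. f (S u \<odot> v \<odot> S (q b)))" by (rule bilI) (simp_all add: simps)
      qed (use p(3) in \<open>auto simp: T_def\<close>)
      also have "\<dots> = f (sw (\<lambda>u v. S u \<odot> v) a \<odot> S (q b))"
        by (simp only: sw_lin[OF lin_comp[OF f(1) lin_mul_left]])
      also have "\<dots> = 0" using f(2)[OF SqK, of b] by (simp add: antipode_left simps)
      finally show "sw (\<lambda>u v. T u v b) a = 0" .
    qed (simp add: bil_def lin_def)
    then show "f (S y) = 0" using 1 coassoc[OF vector_space_field T, of y] by (simp add: sw_zero)
  qed
  have "K \<subseteq> X"
  proof (rule ccontr)
    assume "\<not> K \<subseteq> X"
    then obtain y where y: "y \<in> K" "y \<notin> X" "y \<in> wedge X corad"
      by (rule wedge_corad_exists[OF X subcoalgD(2)[OF K(2)]])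
    have "y \<in> X" unfolding X_def
      using y main subcoalgD(4)[OF K(2)] Rf_wedge[OF subcoalgD(2)[OF subcoalg_corad] y(3)] by blast
    then show False using y(2) by simp
  qed
  then show ?thesis using SX x by blast
qed

end

section \<open>Projections onto Hopf subalgebras\<close>

context sweedler_hopf
begin

text \<open>In \<open>T (a k_1) (b_1 k_2) (b_2 k_3)\<close> the legs \<open>k_1 S(k_2)\<close>
  cancel. Adding and subtracting \<open>p(a S(b_1) b_2) k\<close> then splits off the defect
  \<open>p(a k) - p(a) k\<close>, which a correction built from \<open>T\<close> can remove.\<close>

lemma cocycle_average:
  assumes p: "lin scale p"
  defines "T \<equiv> \<lambda>a b c. p (a \<odot> S b \<odot> c) - p (a \<odot> S b) \<odot> c"
  shows "tri scale T"
    and "sw (\<lambda>c d. sw (T (a \<odot> c)) (b \<odot> d)) k = sw (T a) b \<odot> k + scale (\<epsilon> b) (p (a \<odot> k) - p a \<odot> k)"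
proof -
  note simps = lin_simps[OF p] mul_simps S_simps
  show T: "tri scale T" unfolding T_def by (rule triI) (simp_all add: simps algebra_simps)
  define V where "V b1 b2 z w = p (a \<odot> z \<odot> S b1 \<odot> b2 \<odot> w) - p (a \<odot> z \<odot> S b1) \<odot> b2 \<odot> w" for b1 b2 z w
  have V: "bil scale (V b1 b2)" for b1 b2 unfolding V_def by (rule bilI) (simp_all add: simps algebra_simps)
  have TV: "T (a \<odot> c) (b1 \<odot> d1) (b2 \<odot> d2) = V b1 b2 (c \<odot> S d1) d2" for c b1 b2 d1 d2
    by (simp add: T_def V_def S_mul mul_assoc)
  have t: "tri scale (\<lambda>c d1 d2. V b1 b2 (c \<odot> S d1) d2)" for b1 b2
    by (rule triI) (simp_all add: bil_simps[OF V] simps)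
  have Vone: "sw (\<lambda>c d. sw (\<lambda>d1 d2. V b1 b2 (c \<odot> S d1) d2) d) k = V b1 b2 one k" for b1 b2
    unfolding coassoc[OF vector_space_scale t, symmetric] by (rule antipode_cancel_left(1)[OF V])
  have lf: "lin scale (\<lambda>z. p (a \<odot> z \<odot> k) - p (a \<odot> z) \<odot> k)"
    by (rule linI) (simp_all add: simps algebra_simps)
  have "sw (\<lambda>c d. sw (T (a \<odot> c)) (b \<odot> d)) k =
      sw (\<lambda>c d. sw (\<lambda>b1 b2. sw (\<lambda>d1 d2. V b1 b2 (c \<odot> S d1) d2) d) b) k"
    unfolding sw_mul[OF vector_space_scale tri_bil(1)[OF T]] TV ..
  also have "\<dots> = sw (\<lambda>b1 b2. V b1 b2 one k) b"
    by (subst sw_swap) (simp only: Vone)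
  also have "\<dots> = sw (\<lambda>b1 b2. T a b1 b2 \<odot> k + (p (a \<odot> (S b1 \<odot> b2) \<odot> k) - p (a \<odot> (S b1 \<odot> b2)) \<odot> k)) b"
    by (simp add: V_def T_def simps mul_assoc)
  also have "\<dots> = sw (T a) b \<odot> k + (p (a \<odot> sw (\<lambda>b1 b2. S b1 \<odot> b2) b \<odot> k) - p (a \<odot> sw (\<lambda>b1 b2. S b1 \<odot> b2) b) \<odot> k)"
    by (simp only: sw_plus sw_lin[OF lin_mul_left] sw_lin[OF lf])
  finally show "sw (\<lambda>c d. sw (T (a \<odot> c)) (b \<odot> d)) k = sw (T a) b \<odot> k + scale (\<epsilon> b) (p (a \<odot> k) - p a \<odot> k)"
    by (simp add: antipode_left simps scale_right_diff_distrib)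
qed

end

context dual_chevalley_hopf
begin

text \<open>Multiplication by \<open>k\<close> moves both legs by elements of \<open>K\<close>, and
  both \<open>X\<close> and \<open>K\<close> are stable under that.\<close>

lemma wedge_mul:
  assumes K: "hopf_sub K" and XK: "\<And>x k. x \<in> X \<Longrightarrow> k \<in> K \<Longrightarrow> x \<odot> k \<in> X" and X: "subspace X"
    and y: "y \<in> wedge X K" and k: "k \<in> K"
  shows "y \<odot> k \<in> wedge X K"
  unfolding wedge_def
proof (intro CollectI allI impI)
  fix f g assume fg: "lin (*) f" "lin (*) g" "\<forall>x\<in>X. f x = 0" "\<forall>z\<in>K. g z = 0"
  note simps = lin_simps[OF fg(1)] lin_simps[OF fg(2)] mul_simps algebra_simps
  have b: "bil (*) (\<lambda>c d. f (a \<odot> c) * g (b \<odot> d))" for a b by (rule bilI) (simp_all add: simps)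
  have z: "sw (\<lambda>c d. f (a \<odot> c) * g (b \<odot> d)) k = sw (\<lambda>c d. 0) k" if "a \<in> X \<or> b \<in> K" for a b
  proof (rule sw_cong_subcoalg[OF vector_space_field hopf_subD(4)[OF K] k b])
    show "bil (*) (\<lambda>c d. 0)" by (simp add: bil_def lin_def)
    show "f (a \<odot> c) * g (b \<odot> d) = 0" if "c \<in> K" "d \<in> K" for c d
      using that fg(3,4) XK hopf_subD(3)[OF K] \<open>a \<in> X \<or> b \<in> K\<close> by auto
  qed
  have "conv f g (y \<odot> k) = sw (\<lambda>a b. sw (\<lambda>c d. f (a \<odot> c) * g (b \<odot> d)) k) y"
    unfolding conv_def by (rule sw_mul[OF vector_space_field bil_functionals[OF fg(1,2)]])
  also have "\<dots> = 0"
    by (rule sw_eq_0_wedge[OF vector_space_field X hopf_subD(1)[OF K] _ _ _ y])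
      ((rule bilI)?; simp add: simps sw_funs z)+
  finally show "conv f g (y \<odot> k) = 0" .
qed

text \<open>The failure \<open>p (y k) - p y k\<close> of an arbitrary linear extension to be \<open>K\<close>-linear vanishes on \<open>X\<close>,
  so it descends to the Hopf module \<open>wedge X K / X\<close>. There it is a coboundary by the averaging
  of the fundamental theorem of Hopf modules.\<close>

lemma extend_projection:
  assumes K: "hopf_sub K" and X: "right_coideal X" and XK: "\<And>x k. x \<in> X \<Longrightarrow> k \<in> K \<Longrightarrow> x \<odot> k \<in> X"
    and p: "lin scale p" "\<And>x. p x \<in> K" "\<And>x k. x \<in> X \<Longrightarrow> k \<in> K \<Longrightarrow> p (x \<odot> k) = p x \<odot> k"
  obtains p' where "lin scale p'" "\<And>x. p' x \<in> K" "\<And>x. x \<in> X \<Longrightarrow> p' x = p x"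
    "\<And>y k. y \<in> wedge X K \<Longrightarrow> k \<in> K \<Longrightarrow> p' (y \<odot> k) = p' y \<odot> k"
proof -
  note cK = hopf_subD(4)[OF K] and sc = vector_space_scale
  obtain q where q: "lin scale q" "\<And>x. q x \<in> K" "\<And>x. x \<in> K \<Longrightarrow> q x = x"
    by (rule projection_exists[OF hopf_subD(1)[OF K]]) blast
  note simps = lin_simps[OF p(1)] lin_simps[OF q(1)] mul_simps S_simps counit_simps
  define T0 where "T0 a b c = p (a \<odot> S b \<odot> c) - p (a \<odot> S b) \<odot> c" for a b c
  have T0: "tri scale T0"
    and av: "\<And>a b k. sw (\<lambda>c d. sw (T0 (a \<odot> c)) (b \<odot> d)) k = sw (T0 a) b \<odot> k + scale (\<epsilon> b) (p (a \<odot> k) - p a \<odot> k)"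
    using cocycle_average[OF p(1)] unfolding T0_def by blast+
  \<comment> \<open>Retracting the last two arguments to \<open>K\<close> makes \<open>T\<close>
    vanish for \<open>a\<close> in \<open>X\<close> whatever the other legs are, and take values in
    \<open>K\<close>. On legs in \<open>K\<close> nothing changes.\<close>
  define T where "T a b c = T0 a (q b) (q c)" for a b c
  have T: "tri scale T" unfolding T_def T0_def by (rule triI) (simp_all add: simps algebra_simps)
  define B where "B a b = sw (T a) b" for a b
  have B: "bil scale B" unfolding B_def by (rule bil_sw_right[OF sc T])
  have B0: "bil scale (\<lambda>a b. sw (T0 a) b)" by (rule bil_sw_right[OF sc T0])
  have TX: "T a b c = 0" if "a \<in> X" for a b c
    unfolding T_def T0_def using p(3)[OF XK[OF that hopf_subD(5)[OF K q(2)]] q(2)] by simp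
  then have "T a = (\<lambda>b c. 0)" if "a \<in> X" for a using that by blast
  then have BX: "B a b = 0" if "a \<in> X" for a b
    using that by (simp add: B_def sw_zero)
  have BK: "B a b = sw (T0 a) b" if "b \<in> K" for a b
    unfolding B_def by (rule sw_cong_subcoalg[OF sc cK that tri_bil(1)[OF T] tri_bil(1)[OF T0]]) (simp add: T_def q(3))
  have TK: "T a b c \<in> K" for a b c
    unfolding T_def T0_def by (intro subspace_diff hopf_subD(1,3)[OF K] p(2) q(2))
  define r where "r = sw B"
  have r: "lin scale r" unfolding r_def by (rule lin_sw[OF sc B])
  have rK: "r x \<in> K" for x
    unfolding r_def B_def by (intro sw_mem[OF hopf_subD(1)[OF K]] TK)
  have rX: "r x = 0" if "x \<in> X" for x
  proof -
    have "r x = sw (\<lambda>a b. 0) x" unfolding r_def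
      by (rule sw_cong_right_coideal[OF sc X that B _ BX]) (simp add: bil_def lin_def)
    then show ?thesis by (simp add: sw_zero)
  qed
  have rmul: "r (y \<odot> k) = r y \<odot> k + (p (y \<odot> k) - p y \<odot> k)" if y: "y \<in> wedge X K" and k: "k \<in> K" for y k
  proof -
    define D where "D a b = B a b \<odot> k + scale (\<epsilon> b) (p (a \<odot> k) - p a \<odot> k)" for a b
    have bD: "bil scale D" unfolding D_def
      by (rule bilI) (simp_all add: bil_simps[OF B] simps algebra_simps)
    have bc: "bil scale (\<lambda>c d. B (a \<odot> c) (b \<odot> d))" for a b
      by (rule bilI) (simp_all add: bil_simps[OF B] simps)
    have "r (y \<odot> k) = sw (\<lambda>a b. sw (\<lambda>c d. B (a \<odot> c) (b \<odot> d)) k) y"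
      unfolding r_def by (rule sw_mul[OF sc B])
    also have "\<dots> = sw D y"
    proof (rule sw_cong_wedge[OF sc right_coidealD(1)[OF X] hopf_subD(1)[OF K] _ bD _ _ y])
      show "bil scale (\<lambda>a b. sw (\<lambda>c d. B (a \<odot> c) (b \<odot> d)) k)"
        by (rule bilI) (simp_all add: bil_simps[OF B] simps sw_funs)
      fix a b
      show "sw (\<lambda>c d. B (a \<odot> c) (b \<odot> d)) k = D a b" if a: "a \<in> X"
      proof -
        have "sw (\<lambda>c d. B (a \<odot> c) (b \<odot> d)) k = sw (\<lambda>c d. 0) k"
        proof (rule sw_cong_subcoalg[OF sc cK k bc])
          show "bil scale (\<lambda>c d. 0)" by (simp add: bil_def lin_def)
        qed (use BX XK[OF a] in auto)
        then show ?thesis using p(3)[OF a k] BX[OF a] by (simp add: D_def sw_zero simps)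
      qed
      show "sw (\<lambda>c d. B (a \<odot> c) (b \<odot> d)) k = D a b" if b: "b \<in> K"
      proof -
        have "sw (\<lambda>c d. B (a \<odot> c) (b \<odot> d)) k = sw (\<lambda>c d. sw (T0 (a \<odot> c)) (b \<odot> d)) k"
        proof (rule sw_cong_subcoalg[OF sc cK k bc])
          show "bil scale (\<lambda>c d. sw (T0 (a \<odot> c)) (b \<odot> d))"
            by (rule bilI) (simp_all add: bil_simps[OF B0] simps)
        qed (use BK hopf_subD(3)[OF K b] in auto)
        then show ?thesis unfolding av D_def BK[OF b] .
      qed
    qed
    also have "\<dots> = r y \<odot> k + (p (y \<odot> k) - p y \<odot> k)"
    proof -
      have "lin scale (\<lambda>a. p (a \<odot> k) - p a \<odot> k)" by (rule linI) (simp_all add: simps algebra_simps)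
      from counit_right[OF this] show ?thesis
        unfolding D_def r_def by (simp add: sw_plus sw_lin[OF lin_mul_left])
    qed
    finally show ?thesis .
  qed
  show thesis
  \<comment> \<open>By \<open>rmul\<close> the map \<open>r\<close> has the same defect from
    \<open>K\<close>-linearity as \<open>p\<close> on the wedge, and it vanishes on
    \<open>X\<close>.\<close>
  proof (rule that[of "\<lambda>x. p x - r x"])
    show "lin scale (\<lambda>x. p x - r x)" by (rule linI) (simp_all add: simps lin_simps[OF r] algebra_simps)
    show "p x - r x \<in> K" for x using subspace_diff[OF hopf_subD(1)[OF K] p(2) rK] .
    show "p x - r x = p x" if "x \<in> X" for x using rX[OF that] by simp
    show "p (y \<odot> k) - r (y \<odot> k) = (p y - r y) \<odot> k" if "y \<in> wedge X K" "k \<in> K" for y k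
      using rmul[OF that] by (simp add: simps)
  qed
qed

text \<open>Graphs of the right \<open>K\<close>-linear maps into \<open>K\<close> that are defined
  on right coideals containing \<open>K\<close> and extend its identity. As graphs they are ordered
  by inclusion; the clause on \<open>(0, z)\<close> is single-valuedness.\<close>

definition partial_projections :: "'a set \<Rightarrow> ('a \<times> 'a) set set"
  where "partial_projections K = {G. (\<forall>k\<in>K. (k, k) \<in> G) \<and>
    (\<forall>x z x' z'. (x, z) \<in> G \<longrightarrow> (x', z') \<in> G \<longrightarrow> (x + x', z + z') \<in> G) \<and>
    (\<forall>x z c. (x, z) \<in> G \<longrightarrow> (scale c x, scale c z) \<in> G) \<and>
    (\<forall>x z k. (x, z) \<in> G \<longrightarrow> k \<in> K \<longrightarrow> (x \<odot> k, z \<odot> k) \<in> G) \<and>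
    (\<forall>x z. (x, z) \<in> G \<longrightarrow> z \<in> K) \<and>
    (\<forall>z. (0, z) \<in> G \<longrightarrow> z = 0) \<and>
    (\<forall>x z f. (x, z) \<in> G \<longrightarrow> lin (*) f \<longrightarrow> (\<exists>z'. (Rf f x, z') \<in> G))}"

lemma partial_projectionsD:
  assumes "G \<in> partial_projections K"
  shows "k \<in> K \<Longrightarrow> (k, k) \<in> G"
    and "(x, z) \<in> G \<Longrightarrow> (x', z') \<in> G \<Longrightarrow> (x + x', z + z') \<in> G"
    and "(x, z) \<in> G \<Longrightarrow> (scale c x, scale c z) \<in> G"
    and "(x, z) \<in> G \<Longrightarrow> k \<in> K \<Longrightarrow> (x \<odot> k, z \<odot> k) \<in> G"
    and "(x, z) \<in> G \<Longrightarrow> z \<in> K"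
    and "(0, z) \<in> G \<Longrightarrow> z = 0"
    and "(x, z) \<in> G \<Longrightarrow> lin (*) f \<Longrightarrow> \<exists>z'. (Rf f x, z') \<in> G"
  using assms unfolding partial_projections_def by (simp_all, blast)

text \<open>A maximal partial projection with domain \<open>X\<close> extends to
  \<open>wedge X K\<close>. Since \<open>K\<close> contains the coradical, that wedge is strictly
  larger than \<open>X\<close> unless \<open>X\<close> is everything.\<close>

lemma projection_onto_hopf_sub:
  assumes K: "hopf_sub K" and CK: "corad \<subseteq> K"
  obtains p where "right_projection K p"
proof -
  let ?G = "partial_projections K"
  have "\<exists>M\<in>?G. \<forall>V\<in>?G. M \<subseteq> V \<longrightarrow> V = M"
  proof (rule subset_Zorn)
    fix c assume c: "subset.chain ?G c"
    show "\<exists>U\<in>?G. \<forall>X\<in>c. X \<subseteq> U"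
    proof (cases "c = {}")
      case True
      have "{(k, k) | k. k \<in> K} \<in> ?G"
        unfolding partial_projections_def
        using hopf_subD[OF K] subspace_add subspace_scale subcoalgD(4)[OF hopf_subD(4)[OF K]] by auto
      then show ?thesis using True by blast
    next
      case False
      then obtain G0 where G0: "G0 \<in> c" by blast
      have cG: "\<And>G. G \<in> c \<Longrightarrow> G \<in> ?G" using c by (auto simp: subset_chain_def)
      have "\<Union>c \<in> ?G" unfolding partial_projections_def
      proof (intro CollectI conjI allI impI ballI)
        show "(k, k) \<in> \<Union>c" if "k \<in> K" for k
          using partial_projectionsD(1)[OF cG[OF G0] that] G0 by blast
        fix x z x' z' assume "(x, z) \<in> \<Union>c" "(x', z') \<in> \<Union>c"
        then obtain G G' where G: "G \<in> c" "G' \<in> c" "(x, z) \<in> G" "(x', z') \<in> G'" by blast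
        then have "G \<subseteq> G' \<or> G' \<subseteq> G" using c by (auto simp: subset_chain_def)
        then obtain G'' where "G'' \<in> c" "(x, z) \<in> G''" "(x', z') \<in> G''" using G by blast
        then show "(x + x', z + z') \<in> \<Union>c" using partial_projectionsD(2)[OF cG] by blast
      next
        fix x z r assume "(x, z) \<in> \<Union>c"
        then obtain G where "G \<in> c" "(x, z) \<in> G" by blast
        then show "(scale r x, scale r z) \<in> \<Union>c" using partial_projectionsD(3)[OF cG] by blast
      next
        fix x z k assume "(x, z) \<in> \<Union>c" "k \<in> K"
        then obtain G where "G \<in> c" "(x, z) \<in> G" by blast
        then show "(x \<odot> k, z \<odot> k) \<in> \<Union>c"
          using partial_projectionsD(4)[OF cG] \<open>k \<in> K\<close> by blast
      next
        fix x z assume "(x, z) \<in> \<Union>c"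
        then obtain G where "G \<in> c" "(x, z) \<in> G" by blast
        then show "z \<in> K" using partial_projectionsD(5)[OF cG] by blast
      next
        fix z assume "(0, z) \<in> \<Union>c"
        then obtain G where "G \<in> c" "(0, z) \<in> G" by blast
        then show "z = 0" using partial_projectionsD(6)[OF cG] by blast
      next
        fix x z f assume "(x, z) \<in> \<Union>c" "lin (*) f"
        then obtain G where "G \<in> c" "(x, z) \<in> G" by blast
        then show "\<exists>z'. (Rf f x, z') \<in> \<Union>c"
          using partial_projectionsD(7)[OF cG] \<open>lin (*) f\<close> by blast
      qed
      then show ?thesis by blast
    qed
  qed
  then obtain G where GG: "G \<in> ?G" and max: "\<And>V. V \<in> ?G \<Longrightarrow> G \<subseteq> V \<Longrightarrow> V = G" by blast
  note Gk = partial_projectionsD(1)[OF GG] and Ga = partial_projectionsD(2)[OF GG]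
    and Gs = partial_projectionsD(3)[OF GG] and Gm = partial_projectionsD(4)[OF GG]
    and GK = partial_projectionsD(5)[OF GG] and G0 = partial_projectionsD(6)[OF GG]
    and GR = partial_projectionsD(7)[OF GG]
  have Gu: "z = z'" if "(x, z) \<in> G" "(x, z') \<in> G" for x z z'
    using G0[of "z - z'"] Ga[OF that(1) Gs[OF that(2), of "- 1"]] by simp
  define X where "X = fst ` G"
  have XG: "x \<in> X \<longleftrightarrow> (\<exists>z. (x, z) \<in> G)" for x unfolding X_def by force
  have sX: "subspace X" unfolding subspace_def XG
  proof (intro conjI ballI allI)
    show "\<exists>z. (0, z) \<in> G" using Gk[OF subspace_0[OF hopf_subD(1)[OF K]]] by (rule exI)
    show "\<exists>z. (x + y, z) \<in> G" if "x \<in> X" "y \<in> X" for x y using that Ga unfolding XG by blast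
    show "\<exists>z. (scale c x, z) \<in> G" if "x \<in> X" for c x using that Gs unfolding XG by blast
  qed
  have X: "right_coideal X" unfolding right_coideal_def
  proof (intro conjI allI impI ballI sX)
    fix f w assume "lin (*) f" "w \<in> X"
    then show "Rf f w \<in> X" using GR unfolding XG by blast
  qed
  have XK: "x \<odot> k \<in> X" if "x \<in> X" "k \<in> K" for x k using that Gm unfolding XG by blast
  define u where "u x = (THE z. (x, z) \<in> G)" for x
  have u: "(x, u x) \<in> G" if "x \<in> X" for x
  proof -
    obtain z where z: "(x, z) \<in> G" using XG \<open>x \<in> X\<close> by blast
    show ?thesis unfolding u_def by (rule theI[of "\<lambda>z. (x, z) \<in> G", OF z]) (rule Gu[OF _ z])
  qed
  have uI: "u x = z" if "(x, z) \<in> G" for x z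
    by (rule Gu[OF u that]) (use that in \<open>force simp: X_def\<close>)
  \<comment> \<open>\<open>extend_projection\<close> starts from a map on all of \<open>H\<close>,
    so the partial map is first extended linearly.\<close>
  obtain e where e: "lin scale e" "\<And>x. e x \<in> X" "\<And>x. x \<in> X \<Longrightarrow> e x = x"
    by (rule projection_exists[OF sX]) blast
  define p where "p x = u (e x)" for x
  have p: "lin scale p"
    unfolding p_def by (rule linI) (auto simp: lin_simps[OF e(1)] intro!: uI Ga Gs u e(2))
  have pK: "p x \<in> K" for x unfolding p_def using GK[OF u[OF e(2)]] .
  have pm: "p (x \<odot> k) = p x \<odot> k" if "x \<in> X" "k \<in> K" for x k
    unfolding p_def e(3)[OF that(1)] e(3)[OF XK[OF that]] by (rule uI[OF Gm[OF u[OF that(1)] that(2)]])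
  obtain p' where p': "lin scale p'" "\<And>x. p' x \<in> K" "\<And>x. x \<in> X \<Longrightarrow> p' x = p x"
    "\<And>y k. y \<in> wedge X K \<Longrightarrow> k \<in> K \<Longrightarrow> p' (y \<odot> k) = p' y \<odot> k"
    by (rule extend_projection[OF K X XK p pK pm]) blast+
  define V where "V = {(y, p' y) | y. y \<in> wedge X K}"
  have XW: "X \<subseteq> wedge X K" by (rule wedge_superset[OF X])
  have KX: "K \<subseteq> X" using Gk XG by blast
  have pG: "p' x = z" if "(x, z) \<in> G" for x z
  proof -
    have "x \<in> X" using that by (force simp: X_def)
    then show ?thesis using p'(3) e(3) uI[OF that] by (simp add: p_def)
  qed
  have "V \<in> ?G" unfolding partial_projections_def
  proof (intro CollectI conjI allI impI ballI)
    show "(k, k) \<in> V" if "k \<in> K" for k using that KX XW pG[OF Gk[OF that]] by (auto simp: V_def)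
  qed (use p' subspace_wedge[of X K] Rf_wedge[OF subcoalgD(2)[OF hopf_subD(4)[OF K]]] wedge_mul[OF K XK sX]
      in \<open>auto simp: V_def lin_simps[OF p'(1)] subspace_add subspace_scale\<close>)
  moreover have "G \<subseteq> V"
  proof
    fix w assume w: "w \<in> G"
    then have "fst w \<in> X" by (simp add: X_def)
    with w have "fst w \<in> wedge X K" "snd w = p' (fst w)" using XW pG[of "fst w" "snd w"] by auto
    then show "w \<in> V" unfolding V_def by (metis (mono_tags, lifting) mem_Collect_eq prod.collapse)
  qed
  ultimately have VG: "V = G" by (rule max)
  have "UNIV \<subseteq> X"
  proof (rule ccontr)
    assume n: "\<not> UNIV \<subseteq> X"
    obtain y where y: "y \<notin> X" "y \<in> wedge X corad"
      by (rule wedge_corad_exists[OF X _ n]) (auto simp: right_coideal_def)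
    have "(y, p' y) \<in> V" using y(2) wedge_mono[OF CK, of X] by (auto simp: V_def)
    then show False using VG y(1) XG by blast
  qed
  then have XU: "x \<in> X" for x by blast
  then have "right_projection K p" unfolding right_projection_def
    using p pK pm[OF XU] uI[OF Gk[OF hopf_subD(2)[OF K]]] e(3)[OF XU] by (auto simp: p_def[of one])
  then show thesis using that by blast
qed

text \<open>For \<open>K\<close> inside the coradical, project onto the coradical and then within it
  onto \<open>K\<close>; both maps are linear over \<open>K\<close>.\<close>

lemma hopf_sub_projection:
  assumes K: "hopf_sub K" and "K \<subseteq> corad \<or> corad \<subseteq> K"
  obtains p where "right_projection K p"
proof (cases "corad \<subseteq> K")
  case True then show ?thesis using projection_onto_hopf_sub[OF K] that by blast
next
  case False
  then have KC: "K \<subseteq> corad" using assms(2) by blast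
  obtain p where p: "right_projection corad p" by (rule projection_onto_hopf_sub[OF hopf_sub_corad order_refl])
  obtain q where q: "lin scale q" "\<And>x. x \<in> corad \<Longrightarrow> q x \<in> K"
    "\<And>x k. x \<in> corad \<Longrightarrow> k \<in> K \<Longrightarrow> q (x \<odot> k) = q x \<odot> k" "q one = one"
    by (rule cosemisimple_projection[OF K KC]) blast
  have "right_projection K (\<lambda>x. q (p x))"
    using p q KC lin_comp[OF q(1), of p] unfolding right_projection_def by auto
  then show ?thesis by (rule that)
qed

section \<open>The left ideals \<open>H K^+\<close>, with \<open>K^+\<close> the kernel of the
  counit on \<open>K\<close>, and the chain condition\<close>

definition augmentation_left_ideal :: "'a set \<Rightarrow> 'a set"
  where "augmentation_left_ideal K = \<Inter>{I. left_idl I \<and> (\<forall>k\<in>K. \<epsilon> k = 0 \<longrightarrow> k \<in> I)}"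

lemma augmentation_left_idealI: "k \<in> K \<Longrightarrow> \<epsilon> k = 0 \<Longrightarrow> k \<in> augmentation_left_ideal K"
  by (simp add: augmentation_left_ideal_def)

lemma left_idl_augmentation: "left_idl (augmentation_left_ideal K)"
  unfolding augmentation_left_ideal_def left_idl_def by blast

lemma augmentation_left_ideal_mono: "K \<subseteq> L \<Longrightarrow> augmentation_left_ideal K \<subseteq> augmentation_left_ideal L"
  unfolding augmentation_left_ideal_def by blast

text \<open>The map \<open>F g = p(g\<^sub>1) S(g\<^sub>2)\<close> satisfies \<open>F (g k) = \<epsilon>(k) F g\<close> for \<open>k\<close> in \<open>K\<close>, so \<open>F = \<epsilon>\<close> on \<open>D\<close> and
  \<open>g = \<epsilon>(g\<^sub>1) g\<^sub>2 = p(g\<^sub>1) S(g\<^sub>2) g\<^sub>3 = p g\<close>.\<close>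

lemma subcoalg_le_by_augmentation:
  assumes K: "hopf_sub K" and p: "right_projection K p" and D: "subcoalg D"
    and aug: "\<And>g. g \<in> D \<Longrightarrow> g - scale (\<epsilon> g) one \<in> augmentation_left_ideal K"
  shows "D \<subseteq> K"
proof
  have pl: "lin scale p" and pK: "\<And>x. p x \<in> K" and pm: "\<And>x k. k \<in> K \<Longrightarrow> p (x \<odot> k) = p x \<odot> k"
    and p1: "p one = one" using p by (auto simp: right_projection_def)
  note sc = vector_space_scale and simps = lin_simps[OF pl] mul_simps S_simps counit_simps
  define F where "F = sw (\<lambda>a b. p a \<odot> S b)"
  have b: "bil scale (\<lambda>a b. p a \<odot> S b)" by (rule bil_mul[OF pl lin_antipode])
  have F: "lin scale F" unfolding F_def by (rule lin_sw[OF sc b])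
  have Fm: "F (g \<odot> k) = scale (\<epsilon> k) (F g)" if k: "k \<in> K" for g k
  proof -
    have "F (g \<odot> k) = sw (\<lambda>a b. sw (\<lambda>c d. p (a \<odot> c) \<odot> S (b \<odot> d)) k) g"
      unfolding F_def by (rule sw_mul[OF sc b])
    also have "\<dots> = sw (\<lambda>a b. sw (\<lambda>c d. p a \<odot> (c \<odot> S d) \<odot> S b) k) g"
    proof -
      have "sw (\<lambda>c d. p (a \<odot> c) \<odot> S (b \<odot> d)) k = sw (\<lambda>c d. p a \<odot> (c \<odot> S d) \<odot> S b) k" for a b
        by (rule sw_cong_subcoalg[OF sc hopf_subD(4)[OF K] k]; (rule bilI)?)
          (simp_all add: simps pm S_mul mul_assoc)
      then show ?thesis by simp
    qed
    also have "\<dots> = sw (\<lambda>a b. p a \<odot> sw (\<lambda>c d. c \<odot> S d) k \<odot> S b) g"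
      by (simp add: sw_lin[OF lin_mul_left] sw_lin[OF lin_mul_right])
    also have "\<dots> = scale (\<epsilon> k) (F g)" by (simp add: antipode_right simps sw_funs F_def)
    finally show ?thesis .
  qed
  \<comment> \<open>The largest left ideal on which \<open>F\<close> vanishes; it contains
    \<open>K^+\<close>, hence \<open>H K^+\<close>.\<close>
  define Z where "Z = {z. \<forall>h. F (h \<odot> z) = 0}"
  have "left_idl Z" unfolding left_idl_def Z_def
    by (auto simp: simps lin_simps[OF F] mul_assoc[symmetric])
  moreover have "k \<in> Z" if "k \<in> K" "\<epsilon> k = 0" for k using Fm[OF that(1)] that(2) by (simp add: Z_def)
  ultimately have Z: "augmentation_left_ideal K \<subseteq> Z" unfolding augmentation_left_ideal_def by blast
  have FD: "F g = scale (\<epsilon> g) one" if "g \<in> D" for g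
  proof -
    have "F (one \<odot> (g - scale (\<epsilon> g) one)) = 0" using aug[OF that] Z unfolding Z_def by blast
    moreover have "F one = one" unfolding F_def using sw_one[OF sc b] p1 by simp
    ultimately show ?thesis by (simp add: lin_simps[OF F])
  qed
  fix g assume g: "g \<in> D"
  have "p g = sw (\<lambda>a d. sw (\<lambda>u v. p u \<odot> (S v \<odot> d)) a) g"
    using antipode_cancel_right(2)[OF sc bil_mul[OF pl lin_id], of g] by simp
  also have "\<dots> = sw (\<lambda>a d. F a \<odot> d) g" by (simp add: F_def sw_lin[OF lin_mul_left] mul_assoc)
  also have "\<dots> = sw (\<lambda>a d. scale (\<epsilon> a) d) g"
    by (rule sw_cong_right_coideal[OF sc subcoalgD(2)[OF D] g bil_mul[OF F lin_id]]; (rule bilI)?)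
      (simp_all add: FD simps algebra_simps)
  also have "\<dots> = g" by (rule cop_counit_left)
  finally show "g \<in> K" using pK[of g] by simp
qed

lemma maximal_left_idl:
  assumes "\<I> \<noteq> {}" and L: "\<And>I. I \<in> \<I> \<Longrightarrow> left_idl I"
  shows "\<exists>I\<in>\<I>. \<forall>J\<in>\<I>. I \<subseteq> J \<longrightarrow> J = I"
proof (rule ccontr)
  assume "\<not> ?thesis"
  then have "\<exists>J\<in>\<I>. I \<subset> J" if "I \<in> \<I>" for I using that by blast
  then have "\<exists>f. \<forall>n. f n \<in> \<I> \<and> f n \<subset> f (Suc n)"
    using assms(1) by (intro dependent_nat_choice) blast+
  then obtain f where f: "\<And>n. f n \<in> \<I>" "\<And>n. f n \<subset> f (Suc n)" by blast
  then have "\<exists>N. \<forall>n\<ge>N. f n = f N"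
    using noeth L unfolding left_noeth_def by (metis psubset_imp_subset)
  then obtain N where "\<And>n. n \<ge> N \<Longrightarrow> f n = f N" by blast
  then show False using f(2)[of N] by (metis le_SucI order_refl psubset_eq)
qed

text \<open>Choose \<open>K\<close> with \<open>H K^+\<close> maximal. A member above
  \<open>K\<close> has the same ideal, so the projection onto \<open>K\<close> forces it back into
  \<open>K\<close>; directedness makes the maximal member greatest.\<close>

lemma greatest_hopf_sub:
  assumes \<Phi>: "\<Phi> \<noteq> {}" "\<And>K. K \<in> \<Phi> \<Longrightarrow> hopf_sub K \<and> (K \<subseteq> corad \<or> corad \<subseteq> K)"
    and dir: "\<And>K L. K \<in> \<Phi> \<Longrightarrow> L \<in> \<Phi> \<Longrightarrow> \<exists>M\<in>\<Phi>. K \<subseteq> M \<and> L \<subseteq> M"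
  shows "\<exists>K\<in>\<Phi>. \<forall>L\<in>\<Phi>. L \<subseteq> K"
proof -
  have "\<exists>I \<in> augmentation_left_ideal ` \<Phi>. \<forall>J \<in> augmentation_left_ideal ` \<Phi>. I \<subseteq> J \<longrightarrow> J = I"
    by (rule maximal_left_idl) (use \<Phi> left_idl_augmentation in auto)
  then obtain K where K: "K \<in> \<Phi>"
    and max: "\<And>M. M \<in> \<Phi> \<Longrightarrow> augmentation_left_ideal K \<subseteq> augmentation_left_ideal M \<Longrightarrow>
      augmentation_left_ideal M = augmentation_left_ideal K"
    by auto
  obtain p where p: "right_projection K p" using hopf_sub_projection \<Phi>(2)[OF K] by blast
  have "L \<subseteq> K" if "L \<in> \<Phi>" for L
  proof -
    obtain M where M: "M \<in> \<Phi>" "K \<subseteq> M" "L \<subseteq> M" using dir[OF K \<open>L \<in> \<Phi>\<close>] by blast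
    have eq: "augmentation_left_ideal M = augmentation_left_ideal K"
      by (rule max[OF M(1) augmentation_left_ideal_mono[OF M(2)]])
    have hM: "hopf_sub M" using \<Phi>(2)[OF M(1)] by blast
    have "M \<subseteq> K"
    proof (rule subcoalg_le_by_augmentation[OF _ p hopf_subD(4)[OF hM]])
      show "hopf_sub K" using \<Phi>(2)[OF K] by blast
      fix g assume g: "g \<in> M"
      have "g - scale (\<epsilon> g) one \<in> M"
        using g hopf_subD(1,2)[OF hM] by (simp add: subspace_diff subspace_scale)
      moreover have "\<epsilon> (g - scale (\<epsilon> g) one) = 0" by (simp add: counit_simps)
      ultimately show "g - scale (\<epsilon> g) one \<in> augmentation_left_ideal K"
        unfolding eq[symmetric] by (rule augmentation_left_idealI)
    qed
    then show ?thesis using M(3) by blast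
  qed
  then show ?thesis using K by blast
qed

section \<open>Generated subalgebras and finite generation\<close>

abbreviation alg :: "'a set \<Rightarrow> 'a set"
  where "alg A \<equiv> subalg hull A"

lemma subalg_alg: "subalg (alg A)"
  by (rule hull_in) (auto simp: subalg_def subspace_Inter)

lemma alg_superset: "A \<subseteq> alg A"
  by (rule hull_subset)

lemma alg_minimal: "A \<subseteq> B \<Longrightarrow> subalg B \<Longrightarrow> alg A \<subseteq> B"
  by (rule hull_minimal)

lemma alg_mono: "A \<subseteq> B \<Longrightarrow> alg A \<subseteq> alg B"
  by (rule hull_mono)

lemma span_le_alg: "span A \<subseteq> alg A"
  by (rule span_minimal[OF alg_superset]) (use subalg_alg in \<open>simp add: subalg_def\<close>)

text \<open>The elements of \<open>A\<close> whose contractions on either side remain in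
  \<open>A\<close> form a subalgebra, because the coproduct is multiplicative. It contains
  \<open>C\<close>, so it is all of \<open>A\<close>.\<close>

lemma subcoalg_alg:
  assumes C: "subcoalg C" shows "subcoalg (alg C)"
proof -
  define A where "A = alg C"
  have A: "subspace A" "one \<in> A" "\<And>x y. x \<in> A \<Longrightarrow> y \<in> A \<Longrightarrow> x \<odot> y \<in> A"
    using subalg_alg unfolding A_def subalg_def by auto
  define Q where "Q = {x \<in> A. \<forall>f. lin (*) f \<longrightarrow> Rf f x \<in> A \<and> Lf f x \<in> A}"
  have QR: "x \<in> wedge A {0}" if "x \<in> Q" for x
    using that unfolding Q_def wedge_def by (auto simp: functional_Rf[symmetric])
  have QL: "x \<in> wedge {0} A" if "x \<in> Q" for x
    using that unfolding Q_def wedge_def by (auto simp: functional_Lf[symmetric])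
  have "subalg Q" unfolding subalg_def
  proof (intro conjI ballI)
    show "subspace Q" unfolding Q_def using A(1)
      by (auto simp: subspace_def lin_simps[OF lin_Rf] lin_simps[OF lin_Lf])
    show "one \<in> Q" unfolding Q_def using A by (simp add: Rf_one Lf_one subspace_scale)
    fix x y assume xy: "x \<in> Q" "y \<in> Q"
    have R: "Rf f (x \<odot> y) \<in> A" if f: "lin (*) f" for f
    proof (rule functional_mem[OF A(1)])
      fix k assume k: "lin (*) k" "\<And>w. w \<in> A \<Longrightarrow> k w = 0"
      note simps = lin_simps[OF f] lin_simps[OF k(1)] mul_simps algebra_simps
      have z: "sw (\<lambda>c d. k (a \<odot> c) * f (b \<odot> d)) y = 0" if "a \<in> A" for a b
        by (rule sw_eq_0_wedge[OF vector_space_field A(1) subspace_single_0 _ _ _ QR[OF xy(2)]]; (rule bilI)?)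
          (simp_all add: simps k(2)[OF A(3)[OF that]])
      have "k (Rf f (x \<odot> y)) = sw (\<lambda>a b. sw (\<lambda>c d. k (a \<odot> c) * f (b \<odot> d)) y) x"
        unfolding functional_Rf[OF k(1)] conv_def by (rule sw_mul[OF vector_space_field bil_functionals[OF k(1) f]])
      also have "\<dots> = 0"
        by (rule sw_eq_0_wedge[OF vector_space_field A(1) subspace_single_0 _ z _ QR[OF xy(1)]]; (rule bilI)?)
          (simp_all add: simps sw_funs)
      finally show "k (Rf f (x \<odot> y)) = 0" .
    qed
    have L: "Lf f (x \<odot> y) \<in> A" if f: "lin (*) f" for f
    proof (rule functional_mem[OF A(1)])
      fix k assume k: "lin (*) k" "\<And>w. w \<in> A \<Longrightarrow> k w = 0"
      note simps = lin_simps[OF f] lin_simps[OF k(1)] mul_simps algebra_simps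
      have z: "sw (\<lambda>c d. f (a \<odot> c) * k (b \<odot> d)) y = 0" if "b \<in> A" for a b
        by (rule sw_eq_0_wedge[OF vector_space_field subspace_single_0 A(1) _ _ _ QL[OF xy(2)]]; (rule bilI)?)
          (simp_all add: simps k(2)[OF A(3)[OF that]])
      have "k (Lf f (x \<odot> y)) = sw (\<lambda>a b. sw (\<lambda>c d. f (a \<odot> c) * k (b \<odot> d)) y) x"
        unfolding functional_Lf[OF k(1)] conv_def by (rule sw_mul[OF vector_space_field bil_functionals[OF f k(1)]])
      also have "\<dots> = 0"
        by (rule sw_eq_0_wedge[OF vector_space_field subspace_single_0 A(1) _ _ z QL[OF xy(1)]]; (rule bilI)?)
          (simp_all add: simps sw_funs)
      finally show "k (Lf f (x \<odot> y)) = 0" .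
    qed
    show "x \<odot> y \<in> Q" using R L A(3) xy unfolding Q_def by simp
  qed
  moreover have "C \<subseteq> Q" unfolding Q_def A_def using alg_superset subcoalgD(4,5)[OF C] by blast
  ultimately have "A \<subseteq> Q" unfolding A_def by (intro alg_minimal)
  then show ?thesis unfolding A_def[symmetric]
    by (intro subcoalgI A(1)) (auto simp: Q_def)
qed

lemma hopf_sub_alg:
  assumes "subcoalg C" "\<And>x. x \<in> C \<Longrightarrow> S x \<in> C"
  shows "hopf_sub (alg C)"
proof -
  have "alg C \<subseteq> {x \<in> alg C. S x \<in> alg C}"
  proof (rule alg_minimal)
    show "C \<subseteq> {x \<in> alg C. S x \<in> alg C}" using assms(2) alg_superset by blast
    show "subalg {x \<in> alg C. S x \<in> alg C}"
      using subalg_alg[of C] unfolding subalg_def by (auto simp: subspace_def S_simps S_mul)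
  qed
  then show ?thesis unfolding hopf_sub_def using subalg_alg subcoalg_alg[OF assms(1)] by blast
qed

text \<open>The finite families of simple subcoalgebras stable under \<open>S\<close> are directed
  under union and cover every simple subcoalgebra; a greatest algebra generated by such a family is
  therefore the coradical.\<close>

lemma corad_finitely_generated:
  obtains A where "finite A" "corad = alg A"
proof -
  define P where "P \<F> \<longleftrightarrow> finite \<F> \<and> (\<forall>C\<in>\<F>. simple_subcoalg C \<and> S ` C \<in> \<F>)" for \<F>
  define U where "U \<F> = span (\<Union>\<F>)" for \<F> :: "'a set set"
  have U: "hopf_sub (alg (U \<F>))" "alg (U \<F>) \<subseteq> corad" if "P \<F>" for \<F>
  proof -
    show "hopf_sub (alg (U \<F>))"
    proof (rule hopf_sub_alg)
      show "subcoalg (U \<F>)" unfolding U_def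
        by (rule subcoalg_span_Union) (use that in \<open>auto simp: P_def simple_subcoalgD\<close>)
      show "S x \<in> U \<F>" if "x \<in> U \<F>" for x
        using that unfolding U_def
        by (rule span_closed[OF lin_antipode, rotated]) (use \<open>P \<F>\<close> in \<open>auto simp: P_def intro!: span_base\<close>)
    qed
    have "U \<F> \<subseteq> corad" unfolding U_def
      by (rule span_minimal[OF _ subspace_corad]) (use that simple_le_corad in \<open>auto simp: P_def\<close>)
    then show "alg (U \<F>) \<subseteq> corad"
      by (rule alg_minimal) (use hopf_sub_corad in \<open>simp add: hopf_sub_def\<close>)
  qed
  have "\<exists>K\<in>{alg (U \<F>) | \<F>. P \<F>}. \<forall>L\<in>{alg (U \<F>) | \<F>. P \<F>}. L \<subseteq> K"
  proof (rule greatest_hopf_sub)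
    have "P {}" by (simp add: P_def)
    then show "{alg (U \<F>) | \<F>. P \<F>} \<noteq> {}" by blast
    show "hopf_sub K \<and> (K \<subseteq> corad \<or> corad \<subseteq> K)" if "K \<in> {alg (U \<F>) | \<F>. P \<F>}" for K
      using that U by blast
    fix K L assume "K \<in> {alg (U \<F>) | \<F>. P \<F>}" "L \<in> {alg (U \<F>) | \<F>. P \<F>}"
    then obtain \<F> \<G> where "P \<F>" "K = alg (U \<F>)" "P \<G>" "L = alg (U \<G>)" by blast
    moreover from this have "P (\<F> \<union> \<G>)" by (auto simp: P_def)
    moreover have "alg (U \<F>) \<subseteq> alg (U (\<F> \<union> \<G>))" "alg (U \<G>) \<subseteq> alg (U (\<F> \<union> \<G>))"
      unfolding U_def by (intro alg_mono span_mono; auto)+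
    ultimately show "\<exists>M\<in>{alg (U \<F>) | \<F>. P \<F>}. K \<subseteq> M \<and> L \<subseteq> M" by blast
  qed
  then obtain K where K: "K \<in> {alg (U \<F>) | \<F>. P \<F>}" "\<And>L. L \<in> {alg (U \<F>) | \<F>. P \<F>} \<Longrightarrow> L \<subseteq> K"
    by blast
  then obtain \<F> where \<F>: "P \<F>" "K = alg (U \<F>)" by blast
  have "C \<subseteq> K" if C: "simple_subcoalg C" for C
  proof -
    \<comment> \<open>Here \<open>S (S C) = C\<close> closes the orbit after two steps.\<close>
    have "P {C, S ` C}"
      using C simple_antipode[OF C] antipode_antipode_simple[OF C] by (simp add: P_def)
    then have "alg (U {C, S ` C}) \<subseteq> K" using K(2) by blast
    moreover have "C \<subseteq> U {C, S ` C}" unfolding U_def by (auto intro: span_base)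
    ultimately show ?thesis using alg_superset by blast
  qed
  then have "corad \<subseteq> K" unfolding corad_def
    by (intro span_minimal) (use \<F> hopf_subD(1)[OF U(1)] in auto)
  then have KC: "corad = K" using U(2) \<F> by blast
  have "\<forall>C\<in>\<F>. \<exists>A. finite A \<and> C = span A"
    using \<F>(1) simple_subcoalg_finite unfolding P_def by metis
  then obtain a where a: "\<And>C. C \<in> \<F> \<Longrightarrow> finite (a C) \<and> C = span (a C)" by metis
  define A where "A = (\<Union>C\<in>\<F>. a C)"
  have "U \<F> \<subseteq> span A" unfolding U_def
  proof (rule span_minimal)
    show "\<Union>\<F> \<subseteq> span A"
    proof
      fix x assume "x \<in> \<Union>\<F>"
      then obtain C where C: "C \<in> \<F>" "x \<in> C" by blast
      then have "x \<in> span (a C)" using a by blast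
      then show "x \<in> span A" using span_mono[of "a C" A] C(1) A_def by blast
    qed
  qed simp
  then have "alg (U \<F>) \<subseteq> alg A" using span_le_alg[of A] subalg_alg by (intro alg_minimal) blast
  moreover have "alg A \<subseteq> alg (U \<F>)"
  proof (rule alg_mono, unfold A_def U_def, rule subsetI)
    fix x assume "x \<in> (\<Union>C\<in>\<F>. a C)"
    then obtain C where C: "C \<in> \<F>" "x \<in> a C" by blast
    then have "x \<in> C" using a[OF C(1)] span_superset by blast
    then show "x \<in> span (\<Union>\<F>)" using C(1) by (intro span_base) blast
  qed
  ultimately have "corad = alg A" unfolding KC \<F>(2) by (rule subset_antisym)
  moreover have "finite A" unfolding A_def using \<F>(1) a by (auto simp: P_def)
  ultimately show thesis by (rule that[rotated])
qed

text \<open>Adjoining finite-dimensional subcoalgebras to the coradical gives a directed family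
  whose members are stable under \<open>S\<close> by \<open>antipode_stable\<close>. Every element
  lies in a finite-dimensional subcoalgebra, so the greatest member is \<open>H\<close>.\<close>

theorem finitely_generated:
  obtains A where "finite A" "alg A = UNIV"
proof -
  obtain A where A: "finite A" "corad = alg A" by (rule corad_finitely_generated)
  define P where "P D \<longleftrightarrow> subcoalg D \<and> (\<exists>B. finite B \<and> D = span B)" for D
  define U where "U D = span (\<Union>{corad, D})" for D
  have sup: "corad \<subseteq> U D" "D \<subseteq> U D" for D unfolding U_def by (auto intro: span_base)
  have U: "hopf_sub (alg (U D))" "corad \<subseteq> alg (U D)" if "P D" for D
  proof -
    have "subcoalg (U D)" unfolding U_def
      by (rule subcoalg_span_Union) (use that subcoalg_corad in \<open>auto simp: P_def\<close>)
    from subcoalg_alg[OF this] have s: "subcoalg (alg (U D))" .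
    show c: "corad \<subseteq> alg (U D)" using alg_superset[of "U D"] sup(1)[of D] by (rule order_trans[rotated])
    show "hopf_sub (alg (U D))"
      unfolding hopf_sub_def using s subalg_alg antipode_stable[OF subalg_alg s c] by blast
  qed
  have zero: "P {0}"
  proof -
    have "subcoalg {0}" by (rule subcoalgI) (auto simp: lin_0[OF lin_Rf] lin_0[OF lin_Lf])
    moreover have "{0} = span ({} :: 'a set)" by simp
    ultimately show ?thesis unfolding P_def by blast
  qed
  have "\<exists>K\<in>{alg (U D) | D. P D}. \<forall>L\<in>{alg (U D) | D. P D}. L \<subseteq> K"
  proof (rule greatest_hopf_sub)
    show "{alg (U D) | D. P D} \<noteq> {}" using zero by blast
    show "hopf_sub K \<and> (K \<subseteq> corad \<or> corad \<subseteq> K)" if "K \<in> {alg (U D) | D. P D}" for K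
      using that U by blast
    fix K L assume "K \<in> {alg (U D) | D. P D}" "L \<in> {alg (U D) | D. P D}"
    then obtain D E where DE: "P D" "K = alg (U D)" "P E" "L = alg (U E)" by blast
    then obtain B C where BC: "finite B" "D = span B" "finite C" "E = span C" by (auto simp: P_def)
    have "span (\<Union>{D, E}) = span (B \<union> C)"
    proof (rule span_eq[THEN iffD2], rule conjI)
      show "\<Union>{D, E} \<subseteq> span (B \<union> C)"
        using BC span_mono[of B "B \<union> C"] span_mono[of C "B \<union> C"] by auto
      show "B \<union> C \<subseteq> span (\<Union>{D, E})"
        using BC span_superset[of B] span_superset[of C] by (auto intro!: span_base)
    qed
    then have PDE: "P (span (\<Union>{D, E}))"
      unfolding P_def using BC subcoalg_span_Union[of "{D, E}"] DE by (auto simp: P_def)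
    have "U D \<subseteq> U (span (\<Union>{D, E}))" "U E \<subseteq> U (span (\<Union>{D, E}))"
      unfolding U_def using span_superset[of "\<Union>{D, E}"] by (intro span_mono; auto)+
    then have "K \<subseteq> alg (U (span (\<Union>{D, E})))" "L \<subseteq> alg (U (span (\<Union>{D, E})))"
      using DE(2,4) alg_mono by simp_all
    then show "\<exists>M\<in>{alg (U D) | D. P D}. K \<subseteq> M \<and> L \<subseteq> M"
      using PDE by (intro bexI[of _ "alg (U (span (\<Union>{D, E})))"]) auto
  qed
  then obtain K where K: "K \<in> {alg (U D) | D. P D}" "\<And>L. L \<in> {alg (U D) | D. P D} \<Longrightarrow> L \<subseteq> K"
    by blast
  have "x \<in> K" for x
  proof -
    obtain D B where D: "subcoalg D" "x \<in> D" "finite B" "D = span B" by (rule finite_subcoalg[of x]) blast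
    then have "alg (U D) \<subseteq> K" using K(2) unfolding P_def by blast
    then show ?thesis using D(2) sup(2) alg_superset by blast
  qed
  then have univ: "K = UNIV" by blast
  obtain D B where D: "K = alg (U D)" "finite B" "D = span B" using K(1) unfolding P_def by blast
  have "U D \<subseteq> alg (A \<union> B)" unfolding U_def
  proof (rule span_minimal)
    show "\<Union>{corad, D} \<subseteq> alg (A \<union> B)"
      using A(2) D(3) alg_mono[of A "A \<union> B"] span_le_alg[of B] alg_mono[of B "A \<union> B"] by auto
  qed (use subalg_alg in \<open>simp add: subalg_def\<close>)
  then have "K \<subseteq> alg (A \<union> B)" unfolding D(1) by (rule alg_minimal[OF _ subalg_alg])
  then have "alg (A \<union> B) = UNIV" using univ by blast
  moreover have "finite (A \<union> B)" using A D by simp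
  ultimately show thesis using that by blast
qed

end

section \<open>Comparison with formal tensors\<close>

lemma sweedler_swap: "sweedler (\<lambda>x. map prod.swap (cop x)) B x = sweedler cop (\<lambda>a b. B b a) x"
  by (simp add: sweedler_def case_prod_unfold comp_def)

text \<open>Reversing the product and the coproduct together keeps \<open>S\<close> as antipode;
  reversing just one of them would call for an inverse of \<open>S\<close>.\<close>

lemma (in sweedler_hopf) opposite:
  "sweedler_hopf scale (\<lambda>x. map prod.swap (cop x)) \<epsilon> (\<lambda>x y. y \<odot> x) one S"
proof (unfold_locales, unfold sweedler_swap)
  fix f g h x y c assume f: "lin (*) f" and g: "lin (*) g"
  show "sw (\<lambda>a b. f b * g a) (x + y) = sw (\<lambda>a b. f b * g a) x + sw (\<lambda>a b. f b * g a) y"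
    using cop_add[OF g f, of x y] by (simp add: mult.commute)
  show "sw (\<lambda>a b. f b * g a) (scale c x) = c * sw (\<lambda>a b. f b * g a) x"
    using cop_scale[OF g f, of c x] by (simp add: mult.commute)
  show "sw (\<lambda>a b. f b * g a) one = f one * g one"
    using cop_one[OF g f] by (simp add: mult.commute)
  show "sw (\<lambda>a b. f b * g a) (y \<odot> x) = sw (\<lambda>a b. sw (\<lambda>c d. f (d \<odot> b) * g (c \<odot> a)) y) x"
    using cop_mul[OF g f, of y x] by (subst sw_swap) (simp add: mult.commute)
  assume h: "lin (*) h"
  show "sw (\<lambda>a b. sw (\<lambda>p q. f q * g p * h a) b) x = sw (\<lambda>a b. sw (\<lambda>p q. f b * g q * h p) a) x"
    using cop_coassoc[OF h g f, of x] by (simp add: mult.commute mult.left_commute)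
qed (simp_all add: lin_counit cop_counit_left cop_counit_right mul_add_left mul_add_right mul_scale_left
      mul_scale_right mul_assoc counit_mul mult.commute lin_antipode antipode_left antipode_right)

section \<open>Evaluation of formal linear combinations\<close>

lemma lin_ext_superset:
  assumes "vector_space sc" "finite A" "Poly_Mapping.keys t \<subseteq> A"
  shows "lin_ext sc f t = (\<Sum>i\<in>A. sc (Poly_Mapping.lookup t i) (f i))"
proof -
  interpret vector_space sc by fact
  show ?thesis unfolding lin_ext_def
    by (rule sum.mono_neutral_left) (use assms in \<open>auto simp: in_keys_iff\<close>)
qed

lemma lin_ext_add:
  assumes "vector_space sc" shows "lin_ext sc f (s + t) = lin_ext sc f s + lin_ext sc f t"
proof -
  interpret vector_space sc by fact
  let ?A = "Poly_Mapping.keys s \<union> Poly_Mapping.keys t"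
  have "finite ?A" "Poly_Mapping.keys (s + t) \<subseteq> ?A" by (auto dest: Poly_Mapping.keys_add[THEN subsetD])
  then show ?thesis
    by (simp add: lin_ext_superset[OF assms, of ?A] lookup_add scale_left_distrib sum.distrib)
qed

lemma lin_ext_fscale:
  assumes "vector_space sc" shows "lin_ext sc f (fscale c t) = sc c (lin_ext sc f t)"
proof -
  interpret vector_space sc by fact
  let ?A = "Poly_Mapping.keys t"
  have "finite ?A" "Poly_Mapping.keys (fscale c t) \<subseteq> ?A" by (auto simp: in_keys_iff)
  then show ?thesis
    by (simp add: lin_ext_superset[OF assms, of ?A] scale_sum_right)
qed

lemma lin_ext_0 [simp]: "lin_ext sc f 0 = 0"
  by (simp add: lin_ext_def)

lemma lin_ext_diff:
  assumes "vector_space sc" shows "lin_ext sc f (s - t) = lin_ext sc f s - lin_ext sc f t"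
  using lin_ext_add[OF assms, of f "s - t" t] by simp

lemma lin_ext_single:
  assumes "vector_space sc" shows "lin_ext sc f (Poly_Mapping.single i c) = sc c (f i)"
proof -
  interpret vector_space sc by fact
  show ?thesis by (simp add: lin_ext_superset[OF assms, of "{i}"])
qed

lemma lin_ext_sum:
  assumes "vector_space sc" shows "lin_ext sc f (\<Sum>i\<in>A. g i) = (\<Sum>i\<in>A. lin_ext sc f (g i))"
  by (induction A rule: infinite_finite_induct) (simp_all add: lin_ext_add[OF assms])

lemma lin_ext_lin_ext:
  assumes "vector_space sc"
  shows "lin_ext sc G (lin_ext fscale F t) = lin_ext sc (\<lambda>i. lin_ext sc G (F i)) t"
  unfolding lin_ext_def[of fscale] lin_ext_sum[OF assms] lin_ext_fscale[OF assms] by (simp add: lin_ext_def)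

lemma lin_ext_pure:
  fixes t :: "'i \<Rightarrow>\<^sub>0 'k::field" shows "lin_ext fscale (\<lambda>i. pure_tensor i) t = t"
proof (rule poly_mapping_eqI)
  fix k
  have s: "Poly_Mapping.lookup (\<Sum>i\<in>A. g i) k = (\<Sum>i\<in>A. Poly_Mapping.lookup (g i) k)"
    for A and g :: "'i \<Rightarrow> 'i \<Rightarrow>\<^sub>0 'k"
    by (induction A rule: infinite_finite_induct) (simp_all add: lookup_add)
  show "Poly_Mapping.lookup (lin_ext fscale (\<lambda>i. pure_tensor i) t) k = Poly_Mapping.lookup t k"
    by (simp add: lin_ext_def s lookup_single when_def in_keys_iff)
qed

context k_space
begin

text \<open>Bilinear maps factor through the tensor square, so their values depend only on the class
  of a formal combination.\<close>

lemma lin_ext_bilinear_relators: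
  assumes sc: "vector_space sc" and B: "bil sc B" and t: "t \<in> formal.span (bilinear_relators scale)"
  shows "lin_ext sc (\<lambda>(a, b). B a b) t = 0"
  using t
proof (induction rule: formal.span_induct)
  case base
  interpret V: vector_space sc by fact
  show ?case by (auto simp: formal.subspace_def lin_ext_add[OF sc] lin_ext_fscale[OF sc])
next
  case (step t)
  interpret V: vector_space sc by fact
  show ?case using step
    by (cases rule: bilinear_relators.cases)
      (simp_all add: lin_ext_diff[OF sc] lin_ext_fscale[OF sc] lin_ext_single[OF sc] bil_simps[OF B])
qed

lemma lin_ext_trilinear_relators:
  assumes sc: "vector_space sc" and T: "tri sc T" and t: "t \<in> formal.span (trilinear_relators scale)"
  shows "lin_ext sc (\<lambda>(a, b, c). T a b c) t = 0"
  using t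
proof (induction rule: formal.span_induct)
  case base
  interpret V: vector_space sc by fact
  show ?case by (auto simp: formal.subspace_def lin_ext_add[OF sc] lin_ext_fscale[OF sc])
next
  case (step t)
  interpret V: vector_space sc by fact
  note simps = lin_simps[OF tri_lin[OF T]] bil_simps[OF tri_bil(1)[OF T]]
  show ?case using step
    by (cases rule: trilinear_relators.cases)
      (simp_all add: lin_ext_diff[OF sc] lin_ext_fscale[OF sc] lin_ext_single[OF sc] simps)
qed

end

context coalgebra
begin

section \<open>From formal coproducts to Sweedler sums\<close>

interpretation k_space scale ..

definition rep :: "'a \<Rightarrow> ('a \<times> 'a \<Rightarrow>\<^sub>0 'k)"
  where "rep x = (SOME t. t \<in> \<Delta> x)"

lemma rep: "rep x \<in> \<Delta> x"
proof -
  obtain t where "\<Delta> x = tensor_class2 scale t" using comult_tensor by blast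
  then have "t \<in> \<Delta> x" by (simp add: tensor_class2_def formal.span_zero)
  then show ?thesis unfolding rep_def by (rule someI)
qed

lemma comult_diff: "s \<in> \<Delta> x \<Longrightarrow> t \<in> \<Delta> x \<Longrightarrow> s - t \<in> formal.span (bilinear_relators scale)"
proof -
  obtain u where u: "\<Delta> x = tensor_class2 scale u" using comult_tensor by blast
  assume "s \<in> \<Delta> x" "t \<in> \<Delta> x"
  then have "s - u \<in> formal.span (bilinear_relators scale)" "t - u \<in> formal.span (bilinear_relators scale)"
    by (simp_all add: u tensor_class2_def)
  from formal.span_diff[OF this] show ?thesis by simp
qed

lemma comult_memI: "s \<in> \<Delta> x \<Longrightarrow> t - s \<in> formal.span (bilinear_relators scale) \<Longrightarrow> t \<in> \<Delta> x"
proof -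
  obtain u where u: "\<Delta> x = tensor_class2 scale u" using comult_tensor by blast
  assume "s \<in> \<Delta> x" "t - s \<in> formal.span (bilinear_relators scale)"
  then have "s - u \<in> formal.span (bilinear_relators scale)" by (simp add: u tensor_class2_def)
  from formal.span_add[OF \<open>t - s \<in> _\<close> this] show ?thesis by (simp add: u tensor_class2_def)
qed

lemma lin_ext_comult:
  assumes sc: "vector_space sc" and B: "bil sc B" and t: "s \<in> \<Delta> x" "t \<in> \<Delta> x"
  shows "lin_ext sc (\<lambda>(a, b). B a b) s = lin_ext sc (\<lambda>(a, b). B a b) t"
  using lin_ext_bilinear_relators[OF sc B comult_diff[OF t]] by (simp add: lin_ext_diff[OF sc])

text \<open>The list of pairs has no place for coefficients, so they are absorbed into the first
  entries. For this reason \<open>sweedler_cop\<close> asks for homogeneity in the first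
  argument.\<close>

definition cop :: "'a \<Rightarrow> ('a \<times> 'a) list"
  where "cop x = map (\<lambda>(a, b). (scale (Poly_Mapping.lookup (rep x) (a, b)) a, b))
    (SOME l. set l = Poly_Mapping.keys (rep x) \<and> distinct l)"

lemma sweedler_cop:
  assumes B: "\<And>c a b. B (scale c a) b = sc c (B a b)"
  shows "sweedler cop B x = lin_ext sc (\<lambda>(a, b). B a b) (rep x)"
proof -
  define l where "l = (SOME l. set l = Poly_Mapping.keys (rep x) \<and> distinct l)"
  have l: "set l = Poly_Mapping.keys (rep x) \<and> distinct l"
    unfolding l_def by (rule someI_ex[OF finite_distinct_list[OF finite_keys]])
  have "sweedler cop B x = (\<Sum>i\<leftarrow>l. sc (Poly_Mapping.lookup (rep x) i) (case i of (a, b) \<Rightarrow> B a b))"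
    by (simp add: sweedler_def cop_def l_def[symmetric] case_prod_unfold comp_def B)
  also have "\<dots> = lin_ext sc (\<lambda>(a, b). B a b) (rep x)"
    unfolding lin_ext_def using l by (simp add: sum_list_distinct_conv_sum_set)
  finally show ?thesis .
qed

lemma sweedler_cop_eq:
  assumes "vector_space sc" "bil sc B" "t \<in> \<Delta> x"
  shows "sweedler cop B x = lin_ext sc (\<lambda>(a, b). B a b) t"
  using sweedler_cop[of B sc x] lin_ext_comult[OF assms(1,2) rep assms(3)] bil_scale1[OF assms(2)] by simp

lemma sweedler_coalgebra_cop: "sweedler_coalgebra scale cop \<epsilon>"
proof
  note fld = vector_space_field
  fix f g h x y c assume f: "lin (*) f" and g: "lin (*) g"
  note b = bil_functionals[OF f g]
  show "sweedler cop (\<lambda>a b. f a * g b) (x + y) = sweedler cop (\<lambda>a b. f a * g b) x + sweedler cop (\<lambda>a b. f a * g b) y"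
    using sweedler_cop_eq[OF fld b comult_add[OF rep[of x] rep[of y]]]
    by (simp add: sweedler_cop_eq[OF fld b rep[of x]] sweedler_cop_eq[OF fld b rep[of y]] lin_ext_add[OF fld])
  show "sweedler cop (\<lambda>a b. f a * g b) (scale c x) = c * sweedler cop (\<lambda>a b. f a * g b) x"
    using sweedler_cop_eq[OF fld b comult_scale[OF rep[of x], of c]]
    by (simp add: sweedler_cop_eq[OF fld b rep[of x]] lin_ext_fscale[OF fld])
  assume h: "lin (*) h"
  define T where "T p q r = f p * g q * h r" for p q r
  have T: "tri (*) T" unfolding T_def by (rule triI) (simp_all add: lin_simps[OF f] lin_simps[OF g] lin_simps[OF h] algebra_simps)
  have 1: "sweedler cop (\<lambda>p q. T p q b) a = lin_ext (*) (\<lambda>(p, q). T p q b) (rep a)" for a b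
    by (rule sweedler_cop_eq[OF fld tri_bil(2)[OF T] rep])
  have 2: "sweedler cop (\<lambda>p q. T a p q) b = lin_ext (*) (\<lambda>(p, q). T a p q) (rep b)" for a b
    by (rule sweedler_cop_eq[OF fld tri_bil(1)[OF T] rep])
  let ?l = "lin_ext fscale (\<lambda>(a, b). lin_ext fscale (\<lambda>(p, q). pure_tensor (p, q, b)) (rep a)) (rep x)"
  let ?r = "lin_ext fscale (\<lambda>(a, b). lin_ext fscale (\<lambda>(p, q). pure_tensor (a, p, q)) (rep b)) (rep x)"
  have "tensor_class3 scale ?l = tensor_class3 scale ?r" by (rule coassoc[OF rep rep])
  moreover have "?l \<in> tensor_class3 scale ?l" by (simp add: tensor_class3_def formal.span_zero)
  ultimately have "?l - ?r \<in> formal.span (trilinear_relators scale)" by (simp add: tensor_class3_def)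
  from lin_ext_trilinear_relators[OF fld T this]
  have eq: "lin_ext (*) (\<lambda>(a, b, c). T a b c) ?l = lin_ext (*) (\<lambda>(a, b, c). T a b c) ?r"
    by (simp add: lin_ext_diff[OF fld])
  have "sweedler cop (\<lambda>a b. sweedler cop (\<lambda>p q. T p q b) a) x =
      lin_ext (*) (\<lambda>(a, b). lin_ext (*) (\<lambda>(p, q). T p q b) (rep a)) (rep x)"
  proof -
    have "sweedler cop (\<lambda>p q. T p q b) (scale c a) = c * sweedler cop (\<lambda>p q. T p q b) a" for c a b
      using sweedler_cop_eq[OF fld tri_bil(2)[OF T] comult_scale[OF rep[of a], of c], of b]
      by (simp add: 1 lin_ext_fscale[OF fld])
    from sweedler_cop[of "\<lambda>a b. sweedler cop (\<lambda>p q. T p q b) a" "(*)" x, OF this]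
    show ?thesis by (simp add: 1)
  qed
  also have "\<dots> = lin_ext (*) (\<lambda>(a, b, c). T a b c) ?l"
    by (simp add: lin_ext_lin_ext[OF fld] case_prod_unfold lin_ext_single[OF fld])
  also note eq
  also have "lin_ext (*) (\<lambda>(a, b, c). T a b c) ?r =
      lin_ext (*) (\<lambda>(a, b). lin_ext (*) (\<lambda>(p, q). T a p q) (rep b)) (rep x)"
    by (simp add: lin_ext_lin_ext[OF fld] case_prod_unfold lin_ext_single[OF fld])
  also have "\<dots> = sweedler cop (\<lambda>a b. sweedler cop (\<lambda>p q. T a p q) b) x"
  proof -
    have "sweedler cop (\<lambda>p q. T (scale c a) p q) b = c * sweedler cop (\<lambda>p q. T a p q) b" for c a b
      unfolding 2 lin_ext_def
      by (simp add: T_def lin_simps[OF f] sum_distrib_left case_prod_unfold mult_ac)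
    from sweedler_cop[of "\<lambda>a b. sweedler cop (\<lambda>p q. T a p q) b" "(*)" x, OF this]
    show ?thesis by (simp add: 2)
  qed
  finally show "sweedler cop (\<lambda>a b. sweedler cop (\<lambda>p q. f p * g q * h b) a) x =
      sweedler cop (\<lambda>a b. sweedler cop (\<lambda>p q. f a * g p * h q) b) x"
    by (simp add: T_def)
next
  show "lin (*) \<epsilon>" by (simp add: lin_def counit_add counit_scale)
  fix x
  show "sweedler cop (\<lambda>a b. scale (\<epsilon> a) b) x = x"
    using sweedler_cop[of "\<lambda>a b. scale (\<epsilon> a) b" scale x] counit_left[OF rep, of x] by (simp add: counit_scale)
  show "sweedler cop (\<lambda>a b. scale (\<epsilon> b) a) x = x"
    using sweedler_cop[of "\<lambda>a b. scale (\<epsilon> b) a" scale x] counit_right[OF rep, of x] by (simp add: mult.commute)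
qed

interpretation sweedler_coalgebra scale cop \<epsilon>
  by (rule sweedler_coalgebra_cop)

text \<open>A representative supported on \<open>D \<times> D\<close> has all its contractions in
  \<open>D\<close>. Conversely, applying a projection onto \<open>D\<close> to both entries of
  \<open>rep d\<close> leaves its class unchanged by \<open>sw_cong_subcoalg\<close>, taken for the
  universal bilinear map.\<close>

lemma subcoalgebra_iff: "subcoalgebra D \<longleftrightarrow> subcoalg D"
proof
  assume D: "subcoalgebra D"
  then have sD: "subspace D" by (simp add: subcoalgebra_def)
  have "Rf f d \<in> D \<and> Lf f d \<in> D" if f: "lin (*) f" and d: "d \<in> D" for f d
  proof -
    obtain t where t: "t \<in> \<Delta> d" "Poly_Mapping.keys t \<subseteq> D \<times> D" using D d by (auto simp: subcoalgebra_def)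
    have b: "bil scale (\<lambda>a b. scale (f a) b)" "bil scale (\<lambda>a b. scale (f b) a)"
      by (rule bilI; simp add: lin_simps[OF f] algebra_simps)+
    show ?thesis
      unfolding Rf_def Lf_def sweedler_cop_eq[OF vector_space_scale b(1) t(1)]
        sweedler_cop_eq[OF vector_space_scale b(2) t(1)] lin_ext_def
      using t(2) sD by (auto intro!: subspace_sum subspace_scale)
  qed
  then show "subcoalg D" using sD by (auto intro: subcoalgI)
next
  assume D: "subcoalg D"
  have "\<exists>t\<in>\<Delta> d. Poly_Mapping.keys t \<subseteq> D \<times> D" if d: "d \<in> D" for d
  proof -
    let ?R = "formal.span (bilinear_relators scale)"
    interpret F: k_space fscale ..
    obtain q where q: "F.lin fscale q" "\<And>u. q u \<in> ?R" "\<And>u. u \<in> ?R \<Longrightarrow> q u = u"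
      by (rule F.projection_exists[OF formal.subspace_span]) blast
    \<comment> \<open>The kernel of \<open>\<rho>\<close> is exactly the span of the relators, so
      its range serves as the tensor square, and \<open>B\<close> below as the universal bilinear
      map into it.\<close>
    define \<rho> where "\<rho> u = u - q u" for u
    have \<rho>: "F.lin fscale \<rho>" unfolding \<rho>_def using q(1) by (auto simp: F.lin_def formal.scale_right_diff_distrib)
    have \<rho>R: "\<rho> u = 0 \<longleftrightarrow> u \<in> ?R" for u unfolding \<rho>_def using q(2)[of u] q(3)[of u] by auto
    obtain p where p: "lin scale p" "\<And>x. p x \<in> D" "\<And>x. x \<in> D \<Longrightarrow> p x = x"
      by (rule projection_exists[OF subcoalgD(1)[OF D]]) blast
    define B where "B a b = \<rho> (pure_tensor (a, b))" for a b
    have rel: "\<rho> u = 0" if "u \<in> bilinear_relators scale" for u using that \<rho>R formal.span_base by blast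
    have B: "bil fscale B"
    proof (rule bilI)
      fix a a' b c
      show "B (a + a') b = B a b + B a' b"
        using rel[OF bilinear_relators.intros(1)[of a a' b]] by (simp add: B_def F.lin_simps[OF \<rho>] diff_diff_eq)
      show "B b (a + a') = B b a + B b a'"
        using rel[OF bilinear_relators.intros(2)[of b a a']] by (simp add: B_def F.lin_simps[OF \<rho>] diff_diff_eq)
      show "B (scale c a) b = fscale c (B a b)"
        using rel[OF bilinear_relators.intros(3)[of scale c a b]]
        unfolding F.lin_diff[OF \<rho>] F.lin_scale[OF \<rho>] B_def by (rule eq_iff_diff_eq_0[THEN iffD2])
      show "B b (scale c a) = fscale c (B b a)"
        using rel[OF bilinear_relators.intros(4)[of b scale c a]]
        unfolding F.lin_diff[OF \<rho>] F.lin_scale[OF \<rho>] B_def by (rule eq_iff_diff_eq_0[THEN iffD2])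
    qed
    have Bp: "bil fscale (\<lambda>a b. B (p a) (p b))" by (rule bil_comp[OF B p(1) p(1)])
    define t where "t = lin_ext fscale (\<lambda>(a, b). pure_tensor (p a, p b)) (rep d)"
    have lin_\<rho>: "\<rho> (lin_ext fscale F u) = lin_ext fscale (\<lambda>i. \<rho> (F i)) u"
      for F :: "'a \<times> 'a \<Rightarrow> 'a \<times> 'a \<Rightarrow>\<^sub>0 'k" and u
      unfolding lin_ext_def F.lin_sum[OF \<rho>] F.lin_scale[OF \<rho>] ..
    have vs: "vector_space (fscale :: 'k \<Rightarrow> ('a \<times> 'a \<Rightarrow>\<^sub>0 'k) \<Rightarrow> _)" ..
    have "\<rho> (rep d) = lin_ext fscale (\<lambda>(a, b). B a b) (rep d)"
      using lin_\<rho>[of pure_tensor "rep d"] by (simp add: lin_ext_pure B_def case_prod_unfold)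
    also have "\<dots> = sweedler cop B d" by (rule sweedler_cop_eq[OF vs B rep, symmetric])
    also have "\<dots> = sweedler cop (\<lambda>a b. B (p a) (p b)) d"
      by (rule sw_cong_subcoalg[OF vs D d B Bp]) (simp add: p(3))
    also have "\<dots> = lin_ext fscale (\<lambda>(a, b). B (p a) (p b)) (rep d)" by (rule sweedler_cop_eq[OF vs Bp rep])
    also have "\<dots> = \<rho> t" unfolding t_def lin_\<rho> by (simp add: B_def case_prod_unfold)
    finally have "\<rho> (t - rep d) = 0" by (simp add: F.lin_simps[OF \<rho>])
    then have "t \<in> \<Delta> d" using comult_memI[OF rep] \<rho>R by blast
    moreover have "Poly_Mapping.keys t \<subseteq> D \<times> D"
    proof -
      have "Poly_Mapping.keys (\<Sum>i\<in>A. fscale (c i) (pure_tensor (p (fst i), p (snd i)))) \<subseteq> D \<times> D"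
        for A :: "('a \<times> 'a) set" and c :: "'a \<times> 'a \<Rightarrow> 'k"
      proof (induction A rule: infinite_finite_induct)
        case (insert i A)
        have "Poly_Mapping.keys (fscale (c i) (pure_tensor (p (fst i), p (snd i)))) \<subseteq> D \<times> D"
          using p(2) by (auto simp: in_keys_iff lookup_single when_def split: if_splits)
        then show ?case using insert
          by (simp add: order_trans[OF Poly_Mapping.keys_add])
      qed simp_all
      then show ?thesis by (simp add: t_def lin_ext_def case_prod_unfold)
    qed
    ultimately show ?thesis by blast
  qed
  then show "subcoalgebra D" using subcoalgD(1)[OF D] by (auto simp: subcoalgebra_def)
qed

lemma coradical_eq: "coradical = corad"
  by (simp add: coradical_def corad_def simple_subcoalgebra_def simple_subcoalg_def subcoalgebra_iff)

end

context hopf_algebra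
begin

interpretation k_space scale ..

lemma sweedler_hopf_cop: "sweedler_hopf scale cop \<epsilon> (*) 1 antipode"
proof -
  interpret sweedler_coalgebra scale cop \<epsilon> by (rule sweedler_coalgebra_cop)
  show ?thesis
  proof (unfold_locales)
    note fld = vector_space_field
    show "lin scale antipode" by (simp add: lin_def antipode_add antipode_scale)
    fix f g x y assume f: "lin (*) f" and g: "lin (*) g"
    note b = bil_functionals[OF f g]
    show "sweedler cop (\<lambda>a b. f a * g b) 1 = f 1 * g 1"
      unfolding sweedler_cop_eq[OF fld b comult_one] by (simp add: lin_ext_single[OF fld])
    show "sweedler cop (\<lambda>a b. f a * g b) (x * y) =
        sweedler cop (\<lambda>a b. sweedler cop (\<lambda>c d. f (a * c) * g (b * d)) y) x"
    proof -
      have b2: "bil (*) (\<lambda>c d. f (a * c) * g (b * d))" for a b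
        by (rule bilI) (simp_all add: lin_simps[OF f] lin_simps[OF g] scale_mult_right algebra_simps)
      have 1: "sweedler cop (\<lambda>c d. f (a * c) * g (b * d)) y =
          lin_ext (*) (\<lambda>(c, d). f (a * c) * g (b * d)) (rep y)" for a b
        by (rule sweedler_cop_eq[OF fld b2 rep])
      have "sweedler cop (\<lambda>a b. sweedler cop (\<lambda>c d. f (a * c) * g (b * d)) y) x =
          lin_ext (*) (\<lambda>(a, b). lin_ext (*) (\<lambda>(c, d). f (a * c) * g (b * d)) (rep y)) (rep x)"
      proof -
        have "sweedler cop (\<lambda>p q. f (scale c a * p) * g (b * q)) y = c * sweedler cop (\<lambda>p q. f (a * p) * g (b * q)) y" for c a b
          unfolding 1 lin_ext_def
          by (simp add: lin_simps[OF f] scale_mult_left sum_distrib_left case_prod_unfold mult_ac)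
        from sweedler_cop[of "\<lambda>a b. sweedler cop (\<lambda>c d. f (a * c) * g (b * d)) y" "(*)" x, OF this]
        show ?thesis by (simp add: 1)
      qed
      then show ?thesis
        unfolding sweedler_cop_eq[OF fld b comult_mult[OF rep rep]] formal_mult_def
        by (simp add: lin_ext_lin_ext[OF fld] case_prod_unfold lin_ext_single[OF fld])
    qed
  next
    fix x
    show "sweedler cop (\<lambda>a b. antipode a * b) x = scale (\<epsilon> x) 1"
      using sweedler_cop[of "\<lambda>a b. antipode a * b" scale x] antipode_left[OF rep, of x]
      by (simp add: antipode_scale scale_mult_left)
    show "sweedler cop (\<lambda>a b. a * antipode b) x = scale (\<epsilon> x) 1"
      using sweedler_cop[of "\<lambda>a b. a * antipode b" scale x] antipode_right[OF rep, of x]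
      by (simp add: scale_mult_left)
  qed (simp_all add: algebra_simps scale_mult_left scale_mult_right counit_one counit_mult)
qed

lemma affine_if_left_noetherian:
  assumes noeth: "left_noetherian TYPE('a)" and sub: "subalgebra coradical"
  shows affine_algebra
proof -
  interpret H: sweedler_hopf scale cop \<epsilon> "(*)" 1 antipode by (rule sweedler_hopf_cop)
  interpret dual_chevalley_hopf scale cop \<epsilon> "(*)" 1 antipode
  proof
    show "H.left_noeth"
      using noeth unfolding H.left_noeth_def left_noetherian_def H.left_idl_def left_ideal_def .
  qed (use sub in \<open>auto simp: coradical_eq subalgebra_def\<close>)
  have eq: "subalg = subalgebra" by (auto simp: fun_eq_iff subalg_def subalgebra_def)
  obtain A where "finite A" "subalg hull A = UNIV" by (rule finitely_generated)
  then show ?thesis unfolding affine_algebra_def eq by blast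
qed

lemma affine_if_right_noetherian:
  assumes noeth: "right_noetherian TYPE('a)" and sub: "subalgebra coradical"
  shows affine_algebra
proof -
  interpret G: sweedler_hopf scale cop \<epsilon> "(*)" 1 antipode by (rule sweedler_hopf_cop)
  interpret H: sweedler_hopf scale "\<lambda>x. map prod.swap (cop x)" \<epsilon> "\<lambda>x y. y * x" 1 antipode by (rule G.opposite)
  \<comment> \<open>Reversing the coproduct exchanges left and right coideals, so it leaves the
    subcoalgebras and the coradical unchanged.\<close>
  have "H.Lf = G.Rf" "H.Rf = G.Lf"
    by (simp_all add: fun_eq_iff H.Lf_def H.Rf_def G.Lf_def G.Rf_def sweedler_swap)
  then have "H.subcoalg = G.subcoalg"
    by (auto simp: fun_eq_iff H.subcoalg_def G.subcoalg_def H.right_coideal_def H.left_coideal_def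
        G.right_coideal_def G.left_coideal_def)
  then have cor: "H.corad = coradical"
    by (simp add: coradical_eq H.corad_def G.corad_def H.simple_subcoalg_def G.simple_subcoalg_def)
  interpret dual_chevalley_hopf scale "\<lambda>x. map prod.swap (cop x)" \<epsilon> "\<lambda>x y. y * x" 1 antipode
  proof
    show "H.left_noeth"
      using noeth unfolding H.left_noeth_def right_noetherian_def H.left_idl_def right_ideal_def .
  qed (use sub in \<open>auto simp: cor subalgebra_def\<close>)
  have eq: "subalg = subalgebra" by (auto simp: fun_eq_iff subalg_def subalgebra_def)
  obtain A where "finite A" "subalg hull A = UNIV" by (rule finitely_generated)
  then show ?thesis unfolding affine_algebra_def eq by blast
qed

end

theorem corollary7p4:
  fixes scale :: "'k::field \<Rightarrow> 'a::ring_1 \<Rightarrow> 'a"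
    and \<Delta> :: "'a \<Rightarrow> ('a \<times> 'a \<Rightarrow>\<^sub>0 'k) set"
    and \<epsilon> :: "'a \<Rightarrow> 'k"
    and antipode :: "'a \<Rightarrow> 'a"
  assumes "hopf_algebra scale \<Delta> \<epsilon> antipode"
    and "left_noetherian TYPE('a) \<or> right_noetherian TYPE('a)"
    and "k_algebra.subalgebra scale (coalgebra.coradical scale \<Delta>)"
  shows "k_algebra.affine_algebra scale"
proof -
  interpret hopf_algebra scale \<Delta> \<epsilon> antipode by fact
  show ?thesis using assms(2,3) affine_if_left_noetherian affine_if_right_noetherian by blast
qed

end
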